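(* Let $n_1,\ldots,n_m$ be positive integers, let $\underline{P}=\{(P^{n_i},* )\}_{i=1}^m$ be the corresponding family of based real projective spaces, and let $K$ be a simplicial complex with vertex set $[m]=\{1,\ldots,m\}$. Then $$\mathrm{TC}(\underline{P}^K)\le\max\left\{\sum_{i\in\sigma_1\bigtriangleup\sigma_2}n_i+\sum_{i\in\sigma_1\cap\sigma_2}\mathrm{TC}(P^{n_i})\;:\;\sigma_1,\sigma_2\in K\right\},$$ where $\sigma_1\bigtriangleup\sigma_2=(\sigma_1\setminus\sigma_2)\cup(\sigma_2\setminus\sigma_1)$ is the symmetric difference of $\sigma_1$ and $\sigma_2$.
   Context: $P^n$ denotes $n$-dimensional real projective space. For a path-connected space $X$, $\mathrm{TC}(X)$ is the smallest $n$ such that $X\times X$ is covered by $n+1$ open sets on each of which the end-points evaluation fibration $X^{[0,1]}\to X\times X$, $\alpha\mapsto(\alpha(0),\alpha(1))$, admits a continuous local section. The polyhedral product $\underline{P}^K$ is the subspace $\bigcup_{\sigma\in K}P^\sigma$ of $\prod_{i=1}^m P^{n_i}$, where $P^\sigma=\prod_{i=1}^m Y_i$ with $Y_i=P^{n_i}$ if $i\in\sigma$ and $Y_i=\{*\}$ if $i\notin\sigma$. *)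

theory Defs
  imports "HOL-Analysis.Analysis" "HOL-Library.Extended_Nat"
begin

text \<open>The quotient (final) topology on the image of \<open>f\<close>. It is characterised by
  \<open>quotient_map_quotient_topology\<close> below.\<close>

definition quotient_topology :: "'a topology \<Rightarrow> ('a \<Rightarrow> 'b) \<Rightarrow> 'b topology" where
  "quotient_topology X f =
     topology (\<lambda>U. U \<subseteq> f ` topspace X \<and> openin X {x \<in> topspace X. f x \<in> U})"

lemma openin_quotient_topology:
  "openin (quotient_topology X f) U \<longleftrightarrow>
     U \<subseteq> f ` topspace X \<and> openin X {x \<in> topspace X. f x \<in> U}"
proof -
  have "istopology (\<lambda>U. U \<subseteq> f ` topspace X \<and> openin X {x \<in> topspace X. f x \<in> U})"
    unfolding istopology_def
  proof (intro conjI allI impI)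
    fix S T
    assume S: "S \<subseteq> f ` topspace X \<and> openin X {x \<in> topspace X. f x \<in> S}"
      and T: "T \<subseteq> f ` topspace X \<and> openin X {x \<in> topspace X. f x \<in> T}"
    show "S \<inter> T \<subseteq> f ` topspace X"
      using S by blast
    have "{x \<in> topspace X. f x \<in> S \<inter> T} =
        {x \<in> topspace X. f x \<in> S} \<inter> {x \<in> topspace X. f x \<in> T}"
      by blast
    then show "openin X {x \<in> topspace X. f x \<in> S \<inter> T}"
      using S T by (simp add: openin_Int)
  next
    fix \<K>
    assume K: "\<forall>S\<in>\<K>. S \<subseteq> f ` topspace X \<and> openin X {x \<in> topspace X. f x \<in> S}"
    then show "\<Union>\<K> \<subseteq> f ` topspace X"
      by blast
    have "{x \<in> topspace X. f x \<in> \<Union>\<K>} = (\<Union>S\<in>\<K>. {x \<in> topspace X. f x \<in> S})"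
      by blast
    then show "openin X {x \<in> topspace X. f x \<in> \<Union>\<K>}"
      using K by auto
  qed
  then show ?thesis
    by (simp add: quotient_topology_def topology_inverse')
qed

lemma topspace_quotient_topology [simp]:
  "topspace (quotient_topology X f) = f ` topspace X"
proof
  show "topspace (quotient_topology X f) \<subseteq> f ` topspace X"
    using openin_topspace openin_quotient_topology by metis
  have "{x \<in> topspace X. f x \<in> f ` topspace X} = topspace X"
    by blast
  then have "openin (quotient_topology X f) (f ` topspace X)"
    by (simp add: openin_quotient_topology)
  then show "f ` topspace X \<subseteq> topspace (quotient_topology X f)"
    by (rule openin_subset)
qed

lemma quotient_map_quotient_topology: "quotient_map X (quotient_topology X f) f"
  by (auto simp: quotient_map_def openin_quotient_topology)

text \<open>Real projective \<open>n\<close>-space as the quotient of the \<open>n\<close>-sphere by the antipodal map;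
  its points are the pairs \<open>{x, -x}\<close>.\<close>

definition real_projective_space :: "nat \<Rightarrow> (nat \<Rightarrow> real) set topology" where
  "real_projective_space n = quotient_topology (nsphere n) (\<lambda>x. {x, \<lambda>k. - x k})"

text \<open>Maps are taken to be extensional, so that a point of the function space is exactly
  a continuous map on \<open>topspace X\<close>.\<close>

definition compact_open_topology :: "'a topology \<Rightarrow> 'b topology \<Rightarrow> ('a \<Rightarrow> 'b) topology" where
  "compact_open_topology X Y = topology_generated_by
     {{f \<in> extensional (topspace X). continuous_map X Y f \<and> f ` C \<subseteq> U} | C U.
        compactin X C \<and> openin Y U}"

lemma topspace_compact_open_topology [simp]:
  "topspace (compact_open_topology X Y) =
     {f \<in> extensional (topspace X). continuous_map X Y f}"
proof -
  have "{f \<in> extensional (topspace X). continuous_map X Y f} =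
      {f \<in> extensional (topspace X). continuous_map X Y f \<and> f ` {} \<subseteq> topspace Y}"
    by simp
  moreover have "compactin X {}" "openin Y (topspace Y)"
    by auto
  ultimately show ?thesis
    unfolding compact_open_topology_def topology_generated_by_topspace by blast
qed

definition path_space :: "'a topology \<Rightarrow> (real \<Rightarrow> 'a) topology" where
  "path_space X = compact_open_topology (top_of_set {0..1}) X"

lemma topspace_path_space: "topspace (path_space X) = {p \<in> extensional {0..1}. pathin X p}"
  by (simp add: path_space_def pathin_def)

definition endpoints :: "(real \<Rightarrow> 'a) \<Rightarrow> 'a \<times> 'a" where
  "endpoints p = (p 0, p 1)"

definition has_local_section :: "'a topology \<Rightarrow> ('a \<times> 'a) set \<Rightarrow> bool" where
  "has_local_section X U \<longleftrightarrow>
     (\<exists>s. continuous_map (subtopology (prod_topology X X) U) (path_space X) s \<and>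
          (\<forall>z\<in>U. endpoints (s z) = z))"

text \<open>The (reduced) topological complexity; it is \<open>\<infinity>\<close> if no finite cover exists.\<close>

definition TC :: "'a topology \<Rightarrow> enat" where
  "TC X = Inf {enat n | n.
     \<exists>U :: nat \<Rightarrow> ('a \<times> 'a) set.
       (\<forall>i\<le>n. openin (prod_topology X X) (U i) \<and> has_local_section X (U i)) \<and>
       (\<Union>i\<le>n. U i) = topspace (prod_topology X X)}"

text \<open>Every element of \<open>V\<close> is required to be a vertex, and the empty simplex belongs
  to the complex.\<close>

definition abstract_simplicial_complex :: "'i set \<Rightarrow> 'i set set \<Rightarrow> bool" where
  "abstract_simplicial_complex V K \<longleftrightarrow>
     (\<forall>\<sigma>\<in>K. finite \<sigma> \<and> \<sigma> \<subseteq> V) \<and> {} \<in> K \<and> (\<forall>v\<in>V. {v} \<in> K) \<and>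
     (\<forall>\<sigma>\<in>K. \<forall>\<tau>. \<tau> \<subseteq> \<sigma> \<longrightarrow> \<tau> \<in> K)"

text \<open>The polyhedral product of the based spaces \<open>(X i, b i)\<close>, \<open>i \<in> I\<close>.\<close>

definition polyhedral_product ::
  "'i set \<Rightarrow> ('i \<Rightarrow> 'a topology) \<Rightarrow> ('i \<Rightarrow> 'a) \<Rightarrow> 'i set set \<Rightarrow> ('i \<Rightarrow> 'a) topology" where
  "polyhedral_product I X b K = subtopology (product_topology X I)
     (\<Union>\<sigma>\<in>K. \<Pi>\<^sub>E i\<in>I. if i \<in> \<sigma> then topspace (X i) else {b i})"

end

theory Submission
  imports Defs
begin

text \<open>In the polyhedral product every coordinate is moved by its own planner, with waiting times chosen
  so that coordinates starting at the base point stay there up to time \<open>1/2\<close> and coordinates ending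
  there have arrived by time \<open>1/2\<close>; the motion therefore stays inside the polyhedral product. The
  bound follows by counting once every factor has, for every \<open>N\<close>, a family of \<open>N + 1\<close> planners such that
  a pair of points is missed by at most \<open>TC\<close> of them, a pair meeting the base point by at most \<open>n\<close>, and
  the pair of base points by none, where moreover the planned motion is constant.

  By cutting the unit interval with a partition of unity, such a family arises from a cover
  \<open>U 0, ..., U k\<close> with \<open>k = TC\<close> in which only \<open>U 0, ..., U n\<close> meet the wedge and only \<open>U 0\<close> contains the
  base point. If \<open>k \<le> n\<close>, a given cover is changed near the base point. If \<open>k > n\<close>, the cover is
  turned into a nowhere vanishing map \<open>S\<^sup>n \<times> S\<^sup>n \<rightarrow> \<real>\<^sup>k\<^sup>+\<^sup>1\<close> that is odd in both variables, as in the
  work of Farber, Tabachnikov and Yuzvinsky; for dimension reasons its restriction to the wedge and the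
  diagonal can be pushed into the first \<open>n + 1\<close> coordinates, and one spare coordinate then suffices to make
  it non-negative on the diagonal, so that points can be joined along great circles.\<close>

section \<open>Motion planners\<close>

text \<open>The common number \<open>N\<close> is what lets covers of different factors be combined:
  a pair of points of the product loses an index \<open>j\<close> only if one of its coordinate
  pairs misses the \<open>j\<close>-th set, the losses add up over the coordinates, and
  \<open>N\<close> losses cannot exhaust \<open>N + 1\<close> indices. The delicate count is
  \<open>n\<close> on the wedge. An optimal cover of P^n x P^n may need more than n + 1 sets, and
  nothing forces it to be economical on pairs that meet the base point; only for
  \<open>k > n\<close> must this be enforced. The diagonal joins the wedge in the dimension argument
  for another reason: the spare coordinate that repairs the sign there is multiplied by a weight
  built from the first n + 1 coordinates, which therefore must not vanish together on the diagonal.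
  Constancy at the pair of base points is forced by the waiting times: there both weights vanish,
  the reparametrised time need not have a limit, and continuity survives only because the motion
  does not depend on time.\<close>

abbreviation II :: "real topology" where
  "II \<equiv> top_of_set {0..1}"

text \<open>A local section in its exponential-law form: homotopies restrict, paste and
  reparametrise without reference to the topology of the path space.\<close>

definition motion_planner :: "'a topology \<Rightarrow> ('a \<times> 'a) set \<Rightarrow> ('a \<times> 'a \<Rightarrow> real \<Rightarrow> 'a) \<Rightarrow> bool" where
  "motion_planner X U h \<longleftrightarrow>
     continuous_map (prod_topology (subtopology (prod_topology X X) U) II) X (\<lambda>(z, t). h z t) \<and>
     (\<forall>z \<in> topspace (prod_topology X X) \<inter> U. h z 0 = fst z \<and> h z 1 = snd z)"

text \<open>Holds because [0,1] is locally compact: near \<open>t\<close> the path \<open>p\<close>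
  maps a compact neighbourhood into \<open>W\<close>, and this is a subbasic condition on
  \<open>p\<close>.\<close>

lemma continuous_map_eval_path:
  "continuous_map (prod_topology (path_space X) II) X (\<lambda>(p, t). p t)"
  unfolding continuous_map_def
proof (intro conjI allI impI)
  show "(\<lambda>(p, t). p t) \<in> topspace (prod_topology (path_space X) II) \<rightarrow> topspace X"
    by (auto simp: topspace_path_space pathin_def continuous_map_def)
  fix W assume W: "openin X W"
  let ?S = "{z \<in> topspace (prod_topology (path_space X) II). (\<lambda>(p, t). p t) z \<in> W}"
  show "openin (prod_topology (path_space X) II) ?S"
  proof (subst openin_subopen, intro ballI)
    fix z assume "z \<in> ?S"
    then obtain p t where z: "z = (p, t)"
      and p: "p \<in> topspace (path_space X)" and t: "0 \<le> t" "t \<le> 1" and pt: "p t \<in> W"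
      by auto
    have "continuous_map II X p"
      using p by (simp add: topspace_path_space pathin_def)
    then have "openin II {s \<in> topspace II. p s \<in> W}"
      using W by (rule openin_continuous_map_preimage)
    then have op: "openin II {s \<in> {0..1}. p s \<in> W}" by simp
    have "t \<in> {s \<in> {0..1}. p s \<in> W}"
      using t pt by simp
    with op obtain e where e: "e > 0" "\<forall>s\<in>{0..1}. dist s t < e \<longrightarrow> s \<in> {s \<in> {0..1}. p s \<in> W}"
      unfolding openin_euclidean_subtopology_iff by meson
    then have e2: "p s \<in> W" if "s \<in> {0..1}" "dist s t < e" for s
      using that by blast
    \<comment> \<open>Half the radius, so that the closed ball, which supplies the compact set,
      still lies in the open ball on which \<open>p\<close> stays in \<open>W\<close>; the open ball
      \<open>T\<close> is the neighbourhood of \<open>t\<close>.\<close>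
    define C where "C = {0..1} \<inter> cball t (e/2)"
    define T where "T = {0..1} \<inter> ball t (e/2)"
    define B where "B = {f \<in> extensional (topspace II). continuous_map II X f \<and> f ` C \<subseteq> W}"
    have "compactin II C"
      unfolding C_def compactin_subtopology by (auto intro: compact_Int)
    then have "openin (path_space X) B"
      unfolding path_space_def compact_open_topology_def B_def
      using W by (intro topology_generated_by_Basis) blast
    moreover have "openin II T"
      unfolding T_def by (auto simp: openin_open)
    ultimately have "openin (prod_topology (path_space X) II) (B \<times> T)"
      by (simp add: openin_prod_Times_iff)
    moreover have "(p, t) \<in> B \<times> T"
    proof -
      have "p ` C \<subseteq> W"
        unfolding C_def using e(1) by (auto intro!: e2 simp: dist_commute)
      then show ?thesis
        using p t e(1) unfolding B_def T_def by (simp add: topspace_path_space pathin_def)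
    qed
    moreover have "B \<times> T \<subseteq> ?S"
    proof
      fix y assume "y \<in> B \<times> T"
      then obtain q s where y: "y = (q, s)" and q: "q \<in> B" and s: "s \<in> T"
        by blast
      have "s \<in> C"
        using s unfolding C_def T_def by simp
      moreover have "q \<in> topspace (path_space X)"
        using q unfolding B_def by (simp add: topspace_path_space pathin_def)
      ultimately show "y \<in> ?S"
        using q s unfolding y B_def T_def by auto
    qed
    ultimately show "\<exists>T. openin (prod_topology (path_space X) II) T \<and> z \<in> T \<and> T \<subseteq> ?S"
      unfolding z by blast
  qed
qed

text \<open>The other half of the exponential law. Preimages of subbasic sets suffice, and the tube
  lemma along the compact \<open>C\<close> spreads the condition from the single path
  \<open>h z\<close> to a neighbourhood of \<open>z\<close>. Restricting to \<open>{0..1}\<close>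
  produces the extensional representative.\<close>

lemma continuous_map_into_path_space:
  assumes h: "continuous_map (prod_topology Z II) X (\<lambda>(z, t). h z t)"
  shows "continuous_map Z (path_space X) (\<lambda>z. restrict (h z) {0..1})"
  unfolding path_space_def compact_open_topology_def
proof (rule continuous_on_generated_topo)
  have slice: "continuous_map II X (h z)" if "z \<in> topspace Z" for z
  proof -
    have "continuous_map II (prod_topology Z II) (\<lambda>t. (z, t))"
      using that by (auto intro!: continuous_intros)
    from continuous_map_compose[OF this h] show ?thesis
      by (simp add: o_def)
  qed
  have rc: "continuous_map II X (restrict (h z) {0..1})" if "z \<in> topspace Z" for z
    using slice[OF that] by (rule continuous_map_eq) auto
  show "(\<lambda>z. restrict (h z) {0..1}) ` topspace Z \<subseteq>
     \<Union> {{f \<in> extensional (topspace II). continuous_map II X f \<and> f ` C \<subseteq> U} | C U.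
        compactin II C \<and> openin X U}"
  proof safe
    fix z assume z: "z \<in> topspace Z"
    have "compactin II {}" "openin X {}" by auto
    then show "restrict (h z) {0..1} \<in> \<Union> {{f \<in> extensional (topspace II). continuous_map II X f \<and> f ` C \<subseteq> U} | C U.
        compactin II C \<and> openin X U}"
      using rc[OF z] by (intro UnionI[of "{f \<in> extensional (topspace II). continuous_map II X f \<and> f ` {} \<subseteq> {}}"])
        (blast, auto)
  qed
  fix B assume "B \<in> {{f \<in> extensional (topspace II). continuous_map II X f \<and> f ` C \<subseteq> U} | C U.
        compactin II C \<and> openin X U}"
  then obtain C U where B: "B = {f \<in> extensional (topspace II). continuous_map II X f \<and> f ` C \<subseteq> U}"
    and C: "compactin II C" and U: "openin X U" by blast
  have C01: "C \<subseteq> {0..1}"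
    using C compactin_subset_topspace by fastforce
  have W: "openin (prod_topology Z II) {y \<in> topspace (prod_topology Z II). (\<lambda>(z, t). h z t) y \<in> U}"
    using h U by (rule openin_continuous_map_preimage)
  show "openin Z ((\<lambda>z. restrict (h z) {0..1}) -` B \<inter> topspace Z)"
  proof (subst openin_subopen, intro ballI)
    fix z assume "z \<in> (\<lambda>z. restrict (h z) {0..1}) -` B \<inter> topspace Z"
    then have z: "z \<in> topspace Z" and hz: "h z ` C \<subseteq> U"
      using C01 unfolding B by (auto simp: image_subset_iff subset_iff)
    have "{z} \<times> C \<subseteq> {y \<in> topspace (prod_topology Z II). (\<lambda>(z, t). h z t) y \<in> U}"
      using z hz C01 by auto
    from tube_lemma_right[OF W C z this] obtain N T where N: "openin Z N" "z \<in> N" "C \<subseteq> T"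
      "N \<times> T \<subseteq> {y \<in> topspace (prod_topology Z II). (\<lambda>(z, t). h z t) y \<in> U}"
      by auto
    have "N \<subseteq> (\<lambda>z. restrict (h z) {0..1}) -` B \<inter> topspace Z"
    proof
      fix y assume y: "y \<in> N"
      then have yZ: "y \<in> topspace Z"
        using N(1) openin_subset by blast
      have "h y ` C \<subseteq> U"
        using N(3,4) y by fastforce
      then show "y \<in> (\<lambda>z. restrict (h z) {0..1}) -` B \<inter> topspace Z"
        using rc[OF yZ] yZ C01 unfolding B by (auto simp: subset_iff)
    qed
    then show "\<exists>T. openin Z T \<and> z \<in> T \<and> T \<subseteq> (\<lambda>z. restrict (h z) {0..1}) -` B \<inter> topspace Z"
      using N by blast
  qed
qed

lemma has_local_section_iff_motion_planner:
  assumes U: "U \<subseteq> topspace (prod_topology X X)"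
  shows "has_local_section X U \<longleftrightarrow> (\<exists>h. motion_planner X U h)"
proof
  assume "has_local_section X U"
  then obtain s where s: "continuous_map (subtopology (prod_topology X X) U) (path_space X) s"
    and e: "\<And>z. z \<in> U \<Longrightarrow> endpoints (s z) = z"
    unfolding has_local_section_def by blast
  let ?Z = "subtopology (prod_topology X X) U"
  have "continuous_map (prod_topology ?Z II) (path_space X) (\<lambda>y. s (fst y))"
    using continuous_map_compose[OF continuous_map_fst s, of II] by (simp add: o_def)
  then have "continuous_map (prod_topology ?Z II) (prod_topology (path_space X) II) (\<lambda>y. (s (fst y), snd y))"
    by (intro continuous_map_pairedI continuous_map_snd)
  from continuous_map_compose[OF this continuous_map_eval_path]
  have "continuous_map (prod_topology ?Z II) X (\<lambda>(z, t). s z t)"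
    by (simp add: o_def case_prod_beta')
  moreover have "s z 0 = fst z \<and> s z 1 = snd z" if "z \<in> U" for z
    using e[OF that] by (cases z) (simp add: endpoints_def)
  ultimately show "\<exists>h. motion_planner X U h"
    unfolding motion_planner_def by blast
next
  assume "\<exists>h. motion_planner X U h"
  then obtain h where h: "continuous_map (prod_topology (subtopology (prod_topology X X) U) II) X (\<lambda>(z, t). h z t)"
     and e: "\<And>z. z \<in> topspace (prod_topology X X) \<inter> U \<Longrightarrow> h z 0 = fst z \<and> h z 1 = snd z"
    unfolding motion_planner_def by blast
  show "has_local_section X U"
    unfolding has_local_section_def
    using continuous_map_into_path_space[OF h] e U
    by (intro exI[of _ "\<lambda>z. restrict (h z) {0..1}"]) (auto simp: endpoints_def subset_iff)
qed

section \<open>Restricting and pasting planners\<close>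

lemma subtopology_prod_left:
  assumes "V \<subseteq> U"
  shows "subtopology (prod_topology (subtopology Y U) Z) (V \<times> topspace Z)
    = prod_topology (subtopology Y V) Z"
proof -
  have "subtopology (prod_topology (subtopology Y U) Z) (V \<times> topspace Z)
      = prod_topology (subtopology (subtopology Y U) V) (subtopology Z (topspace Z))"
    using subtopology_Times by metis
  then show ?thesis
    using assms by (simp add: subtopology_subtopology Int_absorb1)
qed

lemma motion_planner_subset:
  assumes "motion_planner X U h" "V \<subseteq> U"
  shows "motion_planner X V h"
proof -
  have eq: "subtopology (prod_topology (subtopology (prod_topology X X) U) II) (V \<times> topspace II)
      = prod_topology (subtopology (prod_topology X X) V) II"
    using assms(2) by (rule subtopology_prod_left)
  have "continuous_map (prod_topology (subtopology (prod_topology X X) V) II) X (\<lambda>(z, t). h z t)"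
    unfolding eq[symmetric]
    using assms(1) by (auto simp: motion_planner_def intro: continuous_map_from_subtopology)
  then show ?thesis
    using assms unfolding motion_planner_def by blast
qed

text \<open>Disjointness leaves no compatibility to check, so planners on several disjoint open sets
  can share one index. The second clause remembers the values, which later carries constancy at the
  base point through the pasting.\<close>

lemma motion_planner_disjoint_Union:
  assumes op: "\<And>a. a \<in> J \<Longrightarrow> openin (prod_topology X X) (V a)"
    and h: "\<And>a. a \<in> J \<Longrightarrow> motion_planner X (V a) (h a)"
    and disj: "\<And>a c. a \<in> J \<Longrightarrow> c \<in> J \<Longrightarrow> a \<noteq> c \<Longrightarrow> V a \<inter> V c = {}"
  shows "\<exists>g. motion_planner X (\<Union>a\<in>J. V a) g \<and> (\<forall>a\<in>J. \<forall>z\<in>V a. g z = h a z)"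
proof -
  define g where "g = (\<lambda>z. h (THE a. a \<in> J \<and> z \<in> V a) z)"
  have g: "g z = h a z" if "a \<in> J" "z \<in> V a" for a z
  proof -
    have "(THE a. a \<in> J \<and> z \<in> V a) = a"
      using that disj by blast
    then show ?thesis by (simp add: g_def)
  qed
  let ?U = "\<Union>a\<in>J. V a"
  let ?Y = "prod_topology (subtopology (prod_topology X X) ?U) II"
  have "continuous_map ?Y X (\<lambda>(z, t). g z t)"
  proof (rule pasting_lemma[where T = "\<lambda>a. V a \<times> {0..1}" and f = "\<lambda>a (z, t). h a z t" and I = J])
    fix a assume a: "a \<in> J"
    show "openin ?Y (V a \<times> {0..1})"
    proof -
      have "openin (subtopology (prod_topology X X) ?U) (V a)"
        using op[OF a] a by (auto simp: openin_subtopology intro!: exI[of _ "V a"])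
      moreover have "openin II {0..1}" by simp
      ultimately show ?thesis
        unfolding openin_prod_Times_iff by blast
    qed
    have "subtopology ?Y (V a \<times> {0..1}) = prod_topology (subtopology (prod_topology X X) (V a)) II"
      using subtopology_prod_left[of "V a" ?U "prod_topology X X" II] a by auto
    then show "continuous_map (subtopology ?Y (V a \<times> {0..1})) X (\<lambda>(z, t). h a z t)"
      using h[OF a] by (simp add: motion_planner_def)
  next
    fix a c y assume "a \<in> J" "c \<in> J" "y \<in> topspace ?Y \<inter> V a \<times> {0..1} \<inter> V c \<times> {0..1}"
    then show "(case y of (z, t) \<Rightarrow> h a z t) = (case y of (z, t) \<Rightarrow> h c z t)"
      using disj by (cases "a = c") auto
  next
    fix y assume "y \<in> topspace ?Y"
    then show "\<exists>a. a \<in> J \<and> y \<in> V a \<times> {0..1} \<and> (case y of (z, t) \<Rightarrow> g z t) = (case y of (z, t) \<Rightarrow> h a z t)"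
      using g by auto
  qed
  moreover have "\<forall>z \<in> topspace (prod_topology X X) \<inter> ?U. g z 0 = fst z \<and> g z 1 = snd z"
    using h g unfolding motion_planner_def by auto
  ultimately show ?thesis
    using g unfolding motion_planner_def by blast
qed

section \<open>Real projective spaces\<close>

definition sph :: "nat \<Rightarrow> (nat \<Rightarrow> real) set" where
  "sph n = {x. (\<Sum>i\<le>n. (x i)\<^sup>2) = 1 \<and> (\<forall>i>n. x i = 0)}"

definition cls :: "(nat \<Rightarrow> real) \<Rightarrow> (nat \<Rightarrow> real) set" where
  "cls x = {x, - x}"

definition ip :: "nat \<Rightarrow> (nat \<Rightarrow> real) \<Rightarrow> (nat \<Rightarrow> real) \<Rightarrow> real" where
  "ip n x y = (\<Sum>i\<le>n. x i * y i)"

abbreviation RP :: "nat \<Rightarrow> (nat \<Rightarrow> real) set topology" where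
  "RP \<equiv> real_projective_space"

lemma nsphere_eq: "nsphere n = top_of_set (sph n)"
  by (simp add: nsphere sph_def euclidean_product_topology)

lemma topspace_RP [simp]: "topspace (RP n) = cls ` sph n"
  by (simp add: real_projective_space_def nsphere_eq cls_def fun_Compl_def)

lemma uminus_sph [simp]: "- x \<in> sph n \<longleftrightarrow> x \<in> sph n"
  by (simp add: sph_def)

lemma cls_uminus [simp]: "cls (- x) = cls x"
  by (auto simp: cls_def)

lemma uminus_uminus_fun [simp]: "- (- x) = x" for x :: "nat \<Rightarrow> real"
  by (simp add: fun_eq_iff)

lemma cls_eq_iff: "cls x = cls y \<longleftrightarrow> x = y \<or> x = - y"
  by (auto simp: cls_def doubleton_eq_iff)

lemma ip_commute: "ip n x y = ip n y x"
  by (simp add: ip_def mult.commute)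

lemma ip_uminus [simp]: "ip n (- x) y = - ip n x y" "ip n x (- y) = - ip n x y"
  by (simp_all add: ip_def sum_negf)

lemma ip_self: "x \<in> sph n \<Longrightarrow> ip n x x = 1"
  by (simp add: ip_def sph_def power2_eq_square)

lemma ip_diff_square:
  assumes "x \<in> sph n" "y \<in> sph n"
  shows "(\<Sum>i\<le>n. (x i - y i)\<^sup>2) = 2 - 2 * ip n x y"
proof -
  have "(\<Sum>i\<le>n. (x i - y i)\<^sup>2) = (\<Sum>i\<le>n. (x i)\<^sup>2) + (\<Sum>i\<le>n. (y i)\<^sup>2) - 2 * ip n x y"
    unfolding ip_def sum_distrib_left sum.distrib[symmetric] sum_subtractf[symmetric]
    by (simp add: power2_diff mult.assoc)
  then show ?thesis
    using assms by (simp add: sph_def)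
qed

lemma ip_le_1: "x \<in> sph n \<Longrightarrow> y \<in> sph n \<Longrightarrow> ip n x y \<le> 1"
  using ip_diff_square[of x n y] sum_nonneg[of "{..n}" "\<lambda>i. (x i - y i)\<^sup>2"] by simp

lemma ip_eq_1_iff:
  assumes "x \<in> sph n" "y \<in> sph n"
  shows "ip n x y = 1 \<longleftrightarrow> x = y"
proof
  assume "ip n x y = 1"
  then have "(\<Sum>i\<le>n. (x i - y i)\<^sup>2) = 0"
    using ip_diff_square[OF assms] by simp
  then have "\<forall>i\<le>n. x i = y i" by (simp add: sum_nonneg_eq_0_iff)
  moreover have "\<forall>i>n. x i = y i"
    using assms by (simp add: sph_def)
  ultimately show "x = y" by (metis ext not_le)
qed (use assms ip_self in auto)

lemma ip_square_le_1:
  assumes "x \<in> sph n" "y \<in> sph n"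
  shows "(ip n x y)\<^sup>2 \<le> 1"
  using ip_le_1[OF assms] ip_le_1[of "- x" n y] assms by (simp add: abs_square_le_1)

lemma ip_square_eq_1_iff:
  assumes "x \<in> sph n" "y \<in> sph n"
  shows "(ip n x y)\<^sup>2 = 1 \<longleftrightarrow> x = y \<or> x = - y"
proof -
  have "- x = y \<longleftrightarrow> x = - y" by (metis uminus_uminus_fun)
  then show ?thesis
    using ip_eq_1_iff[OF assms] ip_eq_1_iff[of "- x" n y] assms by (simp add: power2_eq_1_iff)
qed

lemma sph_coordinate_le_1:
  assumes "x \<in> sph n"
  shows "\<bar>x i\<bar> \<le> 1"
proof (cases "i \<le> n")
  case True
  then have "(x i)\<^sup>2 \<le> (\<Sum>i\<le>n. (x i)\<^sup>2)" by (intro member_le_sum) auto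
  then show ?thesis
    using assms by (simp add: sph_def abs_square_le_1)
qed (use assms in \<open>auto simp: sph_def\<close>)

section \<open>Topology of the sphere and of its antipodal quotient\<close>

lemma continuous_on_coordinate [continuous_intros]:
  "continuous_on A (\<lambda>x :: nat \<Rightarrow> real. x i)"
  "continuous_on B (\<lambda>z :: (nat \<Rightarrow> real) \<times> 'a::topological_space. fst z i)"
  "continuous_on C (\<lambda>z :: 'a \<times> (nat \<Rightarrow> real). snd z i)"
  by (rule continuous_on_product_then_coordinatewise, intro continuous_intros)+

lemma continuous_on_ip [continuous_intros]:
  "continuous_on A f \<Longrightarrow> continuous_on A g \<Longrightarrow> continuous_on A (\<lambda>z. ip n (f z) (g z))"
  unfolding ip_def
  by (intro continuous_on_sum continuous_on_mult) (rule continuous_on_product_then_coordinatewise, assumption)+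

lemma compact_sph: "compact (sph n)"
proof -
  have "closed (sph n)"
  proof -
    have "sph n = {x. (\<Sum>i\<le>n. (x i)\<^sup>2) = 1} \<inter> (\<Inter>i\<in>{n<..}. {x. x i = 0})"
      by (auto simp: sph_def)
    also have "closed \<dots>"
      by (intro closed_Int closed_INT ballI closed_Collect_eq continuous_intros)
    finally show ?thesis .
  qed
  moreover have "sph n \<subseteq> (\<Pi>\<^sub>E i\<in>UNIV. {-1..1})"
  proof
    fix x assume "x \<in> sph n"
    then have "- 1 \<le> x i \<and> x i \<le> 1" for i
      using sph_coordinate_le_1[of x n i] by linarith
    then show "x \<in> (\<Pi>\<^sub>E i\<in>UNIV. {-1..1})" by auto
  qed
  moreover have "compact (\<Pi>\<^sub>E i\<in>(UNIV::nat set). {-1..1::real})"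
  proof -
    have "compactin (powertop_real UNIV) (\<Pi>\<^sub>E i\<in>(UNIV::nat set). {-1..1::real})"
      by (simp add: compactin_PiE)
    then show ?thesis by (simp add: euclidean_product_topology)
  qed
  ultimately show ?thesis by (metis compact_Int_closed inf.absorb_iff2)
qed

lemma quotient_map_cls: "quotient_map (top_of_set (sph n)) (RP n) cls"
  using quotient_map_quotient_topology[of "nsphere n" "\<lambda>x. {x, \<lambda>k. - x k}"]
  by (simp add: real_projective_space_def nsphere_eq cls_def[abs_def] fun_Compl_def)

lemma openin_RP:
  "openin (RP n) U \<longleftrightarrow> U \<subseteq> cls ` sph n \<and> openin (top_of_set (sph n)) {x \<in> sph n. cls x \<in> U}"
  by (simp add: real_projective_space_def nsphere_eq cls_def[abs_def] fun_Compl_def openin_quotient_topology)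

lemma continuous_map_cls: "continuous_map (top_of_set (sph n)) (RP n) cls"
  using quotient_map_cls quotient_imp_continuous_map by blast

text \<open>The saturation of an open \<open>U\<close> is \<open>U\<close> together with its
  antipodal copy, hence open.\<close>

lemma open_map_cls: "open_map (top_of_set (sph n)) (RP n) cls"
  unfolding open_map_def
proof (intro allI impI)
  fix U assume U: "openin (top_of_set (sph n)) U"
  then have "U \<subseteq> sph n" by (simp add: openin_imp_subset)
  have "continuous_on (sph n) (uminus :: (nat \<Rightarrow> real) \<Rightarrow> _)"
    unfolding fun_Compl_def by (intro continuous_on_coordinatewise_then_product continuous_intros)
  then have "openin (top_of_set (sph n)) (sph n \<inter> uminus -` U)"
    using continuous_openin_preimage[of "sph n" uminus "sph n" U] U by auto
  then have "openin (top_of_set (sph n)) (U \<union> (sph n \<inter> uminus -` U))"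
    using U by (rule openin_Un[rotated])
  moreover have "{x \<in> sph n. cls x \<in> cls ` U} = U \<union> (sph n \<inter> uminus -` U)"
  proof -
    have "(\<exists>y\<in>U. x = y \<or> x = - y) \<longleftrightarrow> x \<in> U \<or> - x \<in> U" for x
      by (metis uminus_uminus_fun)
    then show ?thesis
      using \<open>U \<subseteq> sph n\<close> by (auto simp: cls_eq_iff image_iff)
  qed
  ultimately show "openin (RP n) (cls ` U)"
    using \<open>U \<subseteq> sph n\<close> by (auto simp: openin_RP)
qed

text \<open>The matrix of the orthogonal projection onto the line \<open>p\<close>; the chosen \<open>u\<close> is determined up to sign.\<close>

definition kap :: "(nat \<Rightarrow> real) set \<Rightarrow> nat \<Rightarrow> nat \<Rightarrow> real" where
  "kap p i j = (let u = (SOME u. u \<in> p) in u i * u j)"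

lemma kap_cls [simp]: "kap (cls x) i j = x i * x j"
proof -
  have "(SOME u. u \<in> cls x) \<in> cls x" by (rule someI[of _ x]) (simp add: cls_def)
  then show ?thesis by (auto simp: kap_def cls_def Let_def)
qed

lemma continuous_map_kap: "continuous_map (RP n) euclidean (\<lambda>p. kap p i j)"
proof (rule continuous_compose_quotient_map[OF quotient_map_cls])
  show "continuous_map (top_of_set (sph n)) euclidean ((\<lambda>p. kap p i j) \<circ> cls)"
    unfolding o_def kap_cls continuous_map_iff_continuous
    by (intro continuous_on_mult continuous_on_coordinate)
qed

text \<open>The entrywise product of two projection matrices sums to the squared inner product of
  the unit vectors; equal matrices make it 1, the equality case of Cauchy-Schwarz.\<close>

lemma kap_inj:
  assumes "x \<in> sph n" "y \<in> sph n" "kap (cls x) = kap (cls y)"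
  shows "cls x = cls y"
proof -
  have "(ip n x y)\<^sup>2 = (\<Sum>i\<le>n. \<Sum>j\<le>n. (x i * x j) * (y i * y j))"
    unfolding ip_def power2_eq_square sum_product by (simp add: mult_ac)
  also have "\<dots> = (\<Sum>i\<le>n. \<Sum>j\<le>n. (x i * x j) * (x i * x j))"
    using assms(3) by (simp add: fun_eq_iff)
  also have "\<dots> = (ip n x x)\<^sup>2"
    unfolding ip_def power2_eq_square sum_product by (simp add: mult_ac)
  finally show ?thesis
    using assms by (simp add: ip_self ip_square_eq_1_iff cls_eq_iff)
qed

lemma compact_space_RP: "compact_space (RP n)"
proof -
  have "compactin (top_of_set (sph n)) (sph n)"
    using compact_sph by (simp add: compactin_subtopology)
  then have "compactin (RP n) (cls ` sph n)"
    using continuous_map_cls by (rule image_compactin)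
  then show ?thesis by (simp add: compact_space_def)
qed

text \<open>Openness, unlike the quotient property, passes to products; this is why the product of
  \<open>cls2\<close> with the identity of the unit interval can later be recognised as a quotient
  map.\<close>

lemma open_map_map_prod:
  assumes "open_map X Y f" "open_map X' Y' f'"
  shows "open_map (prod_topology X X') (prod_topology Y Y') (map_prod f f')"
  unfolding open_map_def
proof (intro allI impI)
  fix U assume U: "openin (prod_topology X X') U"
  show "openin (prod_topology Y Y') (map_prod f f' ` U)"
    unfolding openin_prod_topology_alt
  proof (intro allI impI)
    fix a b assume "(a, b) \<in> map_prod f f' ` U"
    then obtain x y where xy: "(x, y) \<in> U" "a = f x" "b = f' y"
      by auto
    then obtain A B where AB: "openin X A" "openin X' B" "x \<in> A" "y \<in> B" "A \<times> B \<subseteq> U"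
      using U unfolding openin_prod_topology_alt by meson
    then have "openin Y (f ` A)" "openin Y' (f' ` B)"
      using assms by (auto simp: open_map_def)
    moreover have "f ` A \<times> f' ` B \<subseteq> map_prod f f' ` U"
      using AB(5) by force
    ultimately show "\<exists>U' V. openin Y U' \<and> openin Y' V \<and> a \<in> U' \<and> b \<in> V \<and> U' \<times> V \<subseteq> map_prod f f' ` U"
      using AB xy by blast
  qed
qed

abbreviation sph2 :: "nat \<Rightarrow> ((nat \<Rightarrow> real) \<times> (nat \<Rightarrow> real)) set" where
  "sph2 n \<equiv> sph n \<times> sph n"

abbreviation RP2 :: "nat \<Rightarrow> ((nat \<Rightarrow> real) set \<times> (nat \<Rightarrow> real) set) topology" where
  "RP2 n \<equiv> prod_topology (RP n) (RP n)"

abbreviation cls2 :: "(nat \<Rightarrow> real) \<times> (nat \<Rightarrow> real) \<Rightarrow> (nat \<Rightarrow> real) set \<times> (nat \<Rightarrow> real) set" where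
  "cls2 \<equiv> map_prod cls cls"

lemma open_map_cls2: "open_map (top_of_set (sph2 n)) (RP2 n) cls2"
  using open_map_map_prod[OF open_map_cls open_map_cls] by simp

lemma continuous_map_cls2: "continuous_map (top_of_set (sph2 n)) (RP2 n) cls2"
proof -
  have "continuous_map (prod_topology (top_of_set (sph n)) (top_of_set (sph n))) (RP2 n)
      (\<lambda>(x, y). (cls x, cls y))"
    by (simp only: continuous_map_prod_top continuous_map_cls simp_thms)
  then show ?thesis by (simp only: map_prod_def prod_topology_subtopology_eu)
qed

lemma topspace_RP2: "topspace (RP2 n) = cls2 ` sph2 n"
  by auto

lemma compact_space_RP2: "compact_space (RP2 n)"
  by (simp add: compact_space_prod_topology compact_space_RP)

lemma continuous_map_into_euclidean_pair:
  assumes "continuous_map X euclidean f" "continuous_map X euclidean g"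
  shows "continuous_map X euclidean (\<lambda>x. (f x, g x))"
  using continuous_map_pairedI[OF assms] by simp

lemma continuous_map_kap_matrix: "continuous_map (RP n) euclidean kap"
proof -
  have "continuous_map (RP n) euclidean (\<lambda>p. kap p i)" for i
    using continuous_map_kap[of n i]
    by (simp add: euclidean_product_topology[symmetric] continuous_map_componentwise_UNIV del: euclidean_product_topology)
  then show ?thesis
    by (subst euclidean_product_topology[symmetric]) (simp add: continuous_map_componentwise_UNIV)
qed

section \<open>Planners from odd functions and conversely\<close>

definition odd2 :: "nat \<Rightarrow> ((nat \<Rightarrow> real) \<times> (nat \<Rightarrow> real) \<Rightarrow> real) \<Rightarrow> bool" where
  "odd2 n f \<longleftrightarrow> (\<forall>x\<in>sph n. \<forall>y\<in>sph n. f (- x, y) = - f (x, y) \<and> f (x, - y) = - f (x, y))"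

lemma odd2D:
  assumes "odd2 n f" "x \<in> sph n" "y \<in> sph n"
  shows "f (- x, y) = - f (x, y)" "f (x, - y) = - f (x, y)"
  using assms by (auto simp: odd2_def)

section \<open>Partitions of unity on P^n x P^n\<close>

text \<open>\<open>E\<close> maps P^n x P^n injectively into a metric space by pairs of projection
  matrices, and the distance to the compact image of the complement of \<open>U\<close> pulls back
  to \<open>G\<close>.\<close>

lemma zero_set_function_RP2:
  assumes U: "openin (RP2 n) U"
  obtains G where "continuous_map (RP2 n) euclideanreal G"
    "\<And>z. z \<in> topspace (RP2 n) \<Longrightarrow> G z \<ge> (0::real) \<and> (G z > 0 \<longleftrightarrow> z \<in> U)"
proof (cases "U = topspace (RP2 n)")
  case True
  \<comment> \<open>\<open>infdist\<close> to the empty set is 0, so an empty complement calls for a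
    constant function.\<close>
  then show ?thesis
    using that[of "\<lambda>_. 1"] by simp
next
  case False
  define E where "E = (\<lambda>z. (kap (fst z), kap (snd z)))"
  define C where "C = topspace (RP2 n) - U"
  have contE: "continuous_map (RP2 n) euclidean E"
    unfolding E_def
    using continuous_map_compose[OF continuous_map_fst continuous_map_kap_matrix]
      continuous_map_compose[OF continuous_map_snd continuous_map_kap_matrix]
    by (intro continuous_map_into_euclidean_pair) (simp_all add: o_def)
  have "closedin (RP2 n) C"
    unfolding C_def using U by blast
  then have "compactin (RP2 n) C" by (rule closedin_compact_space[OF compact_space_RP2])
  then have "compactin euclidean (E ` C)"
    using contE by (rule image_compactin)
  then have clE: "closed (E ` C)" by (simp add: compact_imp_closed)
  have ne: "E ` C \<noteq> {}"
    using False U openin_subset unfolding C_def by blast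
  have inj: "z = w" if "z \<in> topspace (RP2 n)" "w \<in> topspace (RP2 n)" "E z = E w" for z w
  proof -
    have "p = q" if "p \<in> cls ` sph n" "q \<in> cls ` sph n" "kap p = kap q" for p q
      using that kap_inj by blast
    then show ?thesis
      using that unfolding E_def by (metis Pair_inject mem_Times_iff prod.collapse topspace_RP topspace_prod_topology)
  qed
  define G where "G = (\<lambda>z. infdist (E z) (E ` C))"
  have "continuous_map euclidean euclideanreal (\<lambda>w. infdist w (E ` C))"
    by (auto intro!: continuous_intros)
  from continuous_map_compose[OF contE this]
  have "continuous_map (RP2 n) euclideanreal G" by (simp add: G_def o_def)
  moreover have "G z \<ge> 0 \<and> (G z > 0 \<longleftrightarrow> z \<in> U)" if z: "z \<in> topspace (RP2 n)" for z
  proof -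
    have "G z = 0 \<longleftrightarrow> E z \<in> E ` C"
      using in_closed_iff_infdist_zero[OF clE ne] by (simp add: G_def)
    also have "\<dots> \<longleftrightarrow> z \<in> C"
      using inj z unfolding C_def by blast
    finally have "G z = 0 \<longleftrightarrow> z \<notin> U"
      using z by (auto simp: C_def)
    then show ?thesis
      using infdist_nonneg[of "E z" "E ` C"] by (auto simp: G_def less_le)
  qed
  ultimately show ?thesis
    using that by blast
qed

text \<open>The usual normalisation. Positivity exactly on \<open>U i\<close> is recorded because
  later arguments read membership in \<open>U i\<close> off the value of
  \<open>\<rho> i\<close>.\<close>

lemma partition_of_unity_RP2:
  fixes k :: nat
  assumes U: "\<And>i. i \<le> k \<Longrightarrow> openin (RP2 n) (U i)"
    and cover: "topspace (RP2 n) \<subseteq> (\<Union>i\<le>k. U i)"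
  obtains \<rho> where "\<And>i. i \<le> k \<Longrightarrow> continuous_map (RP2 n) euclideanreal (\<rho> i)"
    "\<And>i z. i \<le> k \<Longrightarrow> z \<in> topspace (RP2 n) \<Longrightarrow> \<rho> i z \<ge> (0::real) \<and> (\<rho> i z > 0 \<longleftrightarrow> z \<in> U i)"
    "\<And>z. z \<in> topspace (RP2 n) \<Longrightarrow> (\<Sum>i\<le>k. \<rho> i z) = 1"
proof -
  have "\<exists>G. continuous_map (RP2 n) euclideanreal G \<and>
    (\<forall>z \<in> topspace (RP2 n). G z \<ge> (0::real) \<and> (G z > 0 \<longleftrightarrow> z \<in> U i))" if i: "i \<le> k" for i
  proof -
    obtain G where "continuous_map (RP2 n) euclideanreal G"
      "\<And>z. z \<in> topspace (RP2 n) \<Longrightarrow> G z \<ge> (0::real) \<and> (G z > 0 \<longleftrightarrow> z \<in> U i)"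
      using zero_set_function_RP2[OF U[OF i]] by blast
    then show ?thesis by blast
  qed
  then obtain G where G: "\<And>i. i \<le> k \<Longrightarrow> continuous_map (RP2 n) euclideanreal (G i)"
    "\<And>i z. i \<le> k \<Longrightarrow> z \<in> topspace (RP2 n) \<Longrightarrow> G i z \<ge> (0::real) \<and> (G i z > 0 \<longleftrightarrow> z \<in> U i)"
    by metis
  define s where "s = (\<lambda>z. \<Sum>i\<le>k. G i z)"
  have s: "s z > 0" if z: "z \<in> topspace (RP2 n)" for z
  proof -
    obtain i where "i \<le> k" "z \<in> U i"
      using cover z by blast
    then show ?thesis
      unfolding s_def using G(2)[OF _ z] by (intro sum_pos2[of _ i]) auto
  qed
  have cs: "continuous_map (RP2 n) euclideanreal s"
    unfolding s_def using G(1) by (intro continuous_map_sum) auto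
  show ?thesis
  proof (rule that[of "\<lambda>i z. G i z / s z"])
    show "continuous_map (RP2 n) euclideanreal (\<lambda>z. G i z / s z)" if "i \<le> k" for i
      using G(1)[OF that] cs s by (intro continuous_map_real_divide) (auto simp: less_imp_neq[symmetric])
    show "0 \<le> G i z / s z \<and> (0 < G i z / s z \<longleftrightarrow> z \<in> U i)" if "i \<le> k" "z \<in> topspace (RP2 n)" for i z
      using G(2)[OF that] s[OF that(2)] by (simp add: zero_less_divide_iff)
    show "(\<Sum>i\<le>k. G i z / s z) = 1" if "z \<in> topspace (RP2 n)" for z
    proof -
      have "(\<Sum>i\<le>k. G i z / s z) = s z / s z"
        by (simp add: sum_divide_distrib[symmetric] s_def)
      then show ?thesis
        using s[OF that] by simp
    qed
  qed
qed

section \<open>Planners along great circles\<close>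

text \<open>The chord from \<open>x\<close> to \<open>y\<close> projected radially to the sphere: it
  traces the short great-circle arc without any angle and fails only for antipodal end
  points.\<close>

definition seg :: "nat \<Rightarrow> (nat \<Rightarrow> real) \<Rightarrow> (nat \<Rightarrow> real) \<Rightarrow> real \<Rightarrow> nat \<Rightarrow> real" where
  "seg n x y t = (\<lambda>i. ((1 - t) * x i + t * y i) / sqrt (\<Sum>j\<le>n. ((1 - t) * x j + t * y j)\<^sup>2))"

lemma seg_denominator_pos:
  assumes "x \<in> sph n" "y \<in> sph n" "x \<noteq> - y" "0 \<le> t" "t \<le> 1"
  shows "(\<Sum>j\<le>n. ((1 - t) * x j + t * y j)\<^sup>2) > 0"
proof -
  have "(\<Sum>j\<le>n. ((1 - t) * x j + t * y j)\<^sup>2)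
      = (1 - t)\<^sup>2 * (\<Sum>j\<le>n. (x j)\<^sup>2) + t\<^sup>2 * (\<Sum>j\<le>n. (y j)\<^sup>2) + 2 * t * (1 - t) * ip n x y"
    unfolding ip_def sum_distrib_left sum.distrib[symmetric]
    by (intro sum.cong refl) (simp add: power2_eq_square algebra_simps)
  also have "\<dots> = (1 - t)\<^sup>2 + t\<^sup>2 + 2 * t * (1 - t) * ip n x y"
    using assms by (simp add: sph_def)
  \<comment> \<open>Completing the square at the midpoint \<open>t = 1/2\<close> leaves
    \<open>(1 + ip n x y) / 2\<close>, which vanishes only for antipodal points.\<close>
  also have "\<dots> = (1 - 2 * t)\<^sup>2 * ((1 - ip n x y) / 2) + (1 + ip n x y) / 2"
    by (simp add: power2_eq_square field_simps)
  also have "\<dots> > 0"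
  proof -
    have "- ip n x y < 1"
      using ip_le_1[of "- x" n y] ip_eq_1_iff[of "- x" n y] assms by (auto simp: less_le)
    then show ?thesis
      using ip_le_1[OF assms(1,2)] by (intro add_nonneg_pos mult_nonneg_nonneg) auto
  qed
  finally show ?thesis .
qed

lemma seg_in_sph:
  assumes "x \<in> sph n" "y \<in> sph n" "x \<noteq> - y" "0 \<le> t" "t \<le> 1"
  shows "seg n x y t \<in> sph n"
proof -
  let ?d = "\<Sum>j\<le>n. ((1 - t) * x j + t * y j)\<^sup>2"
  have "(\<Sum>i\<le>n. (seg n x y t i)\<^sup>2) = ?d / ?d"
    using seg_denominator_pos[OF assms] unfolding seg_def
    by (simp add: power_divide sum_divide_distrib[symmetric])
  then show ?thesis
    using seg_denominator_pos[OF assms] assms by (simp add: sph_def seg_def)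
qed

lemma seg_ends:
  assumes "x \<in> sph n" "y \<in> sph n"
  shows "seg n x y 0 = x" "seg n x y 1 = y"
  using assms by (simp_all add: seg_def sph_def)

lemma seg_same: "x \<in> sph n \<Longrightarrow> seg n x x t = x"
  by (simp add: seg_def sph_def algebra_simps)

lemma seg_uminus: "seg n (- x) (- y) t = - seg n x y t"
proof -
  have "(\<Sum>j\<le>n. ((1 - t) * (- x) j + t * (- y) j)\<^sup>2) = (\<Sum>j\<le>n. ((1 - t) * x j + t * y j)\<^sup>2)"
    by (intro sum.cong refl) (simp add: power2_eq_square algebra_simps)
  then show ?thesis by (simp add: seg_def fun_eq_iff divide_simps)
qed

text \<open>Where \<open>f\<close> does not vanish, exactly two of the four pairs of unit vectors
  over a pair of lines make it positive, and these differ by a simultaneous sign. The short arcs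
  joining them are antipodal to each other and define one path in P^n. Non-negativity on the
  diagonal makes \<open>f (- y, y)\<close> non-positive, which excludes antipodal end
  points.\<close>

lemma sign_motion_planner:
  assumes f: "continuous_on (sph2 n) f" and odd: "odd2 n f"
    and diag: "\<And>x. x \<in> sph n \<Longrightarrow> f (x, x) \<ge> 0"
  shows "openin (RP2 n) (cls2 ` {z \<in> sph2 n. f z \<noteq> 0})"
    and "\<exists>h. motion_planner (RP n) (cls2 ` {z \<in> sph2 n. f z \<noteq> 0}) h \<and>
      (\<forall>x\<in>sph n. f (x, x) \<noteq> 0 \<longrightarrow> (\<forall>t. h (cls2 (x, x)) t = cls x))"
proof -
  define P where "P = {z \<in> sph2 n. f z > 0}"
  define U where "U = cls2 ` {z \<in> sph2 n. f z \<noteq> 0}"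
  have "openin (top_of_set (sph2 n)) (sph2 n \<inter> f -` {0<..})"
    using f by (rule continuous_openin_preimage_gen) auto
  then have opP: "openin (top_of_set (sph2 n)) P" by (simp add: P_def Int_def vimage_def)
  have U_eq: "U = cls2 ` P"
  proof
    show "U \<subseteq> cls2 ` P"
    proof
      fix z assume "z \<in> U"
      then obtain x y where xy: "z = cls2 (x, y)" "x \<in> sph n" "y \<in> sph n" "f (x, y) \<noteq> 0"
        unfolding U_def by auto
      show "z \<in> cls2 ` P"
      proof (cases "f (x, y) > 0")
        case True
        then show ?thesis
          using xy by (auto simp: P_def)
      next
        case False
        then have "(- x, y) \<in> P"
          using xy odd2D[OF odd, of x y] by (auto simp: P_def)
        moreover have "z = cls2 (- x, y)"
          using xy by simp
        ultimately show ?thesis by blast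
      qed
    qed
  qed (auto simp: P_def U_def)
  have opU: "openin (RP2 n) U"
    unfolding U_eq using open_map_cls2 opP by (auto simp: open_map_def)
  have unique: "(x', y') = (x, y) \<or> (x', y') = (- x, - y)"
    if "(x, y) \<in> P" "(x', y') \<in> P" "cls2 (x', y') = cls2 (x, y)" for x y x' y'
    using that odd2D[OF odd, of x y] unfolding P_def by (auto simp: cls_eq_iff)
  \<comment> \<open>Any positive lift will do: the two candidates give the same path by
    \<open>seg_uminus\<close>.\<close>
  define r where "r = (\<lambda>z. SOME w. w \<in> P \<and> cls2 w = z)"
  define h where "h = (\<lambda>z t. cls (seg n (fst (r z)) (snd (r z)) t))"
  have h: "h (cls2 (x, y)) t = cls (seg n x y t)" if xy: "(x, y) \<in> P" for x y t
  proof -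
    have "r (cls2 (x, y)) \<in> P \<and> cls2 (r (cls2 (x, y))) = cls2 (x, y)"
      unfolding r_def using xy by (rule someI[of "\<lambda>w. w \<in> P \<and> cls2 w = cls2 (x, y)" "(x, y)", OF conjI]) simp
    then have "r (cls2 (x, y)) = (x, y) \<or> r (cls2 (x, y)) = (- x, - y)"
      using unique[OF xy, of "fst (r (cls2 (x, y)))" "snd (r (cls2 (x, y)))"] by simp
    then show ?thesis by (auto simp: h_def seg_uminus)
  qed
  have not_opp: "x \<noteq> - y" if "(x, y) \<in> P" for x y
  proof
    assume "x = - y"
    then have "f (x, y) = - f (y, y)"
      using that odd2D[OF odd, of y y] by (simp add: P_def)
    then show False
      using that diag[of y] by (auto simp: P_def)
  qed
  have "continuous_map (prod_topology (subtopology (RP2 n) U) II) (RP n) (\<lambda>(z, t). h z t)"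
  \<comment> \<open>Continuity is tested upstairs on \<open>P\<close> times the unit interval, where
    the open surjection \<open>map_prod cls2 id\<close> is a quotient map; the chosen lift
    \<open>r\<close> need not be continuous.\<close>
  proof (rule continuous_compose_quotient_map)
    have "open_map (top_of_set P) (subtopology (RP2 n) U) cls2"
      unfolding open_map_def
    proof (intro allI impI)
      fix W assume W: "openin (top_of_set P) W"
      then have "openin (RP2 n) (cls2 ` W)"
        using open_map_cls2 opP openin_trans by (metis open_map_def)
      moreover have "cls2 ` W \<subseteq> U"
        using W openin_imp_subset unfolding U_eq by blast
      ultimately show "openin (subtopology (RP2 n) U) (cls2 ` W)"
        by (metis inf.absorb_iff1 openin_subtopology)
    qed
    then have op: "open_map (top_of_set (P \<times> {0..1::real})) (prod_topology (subtopology (RP2 n) U) II) (map_prod cls2 id)"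
      using open_map_map_prod[of "top_of_set P" "subtopology (RP2 n) U" cls2 II II id] by (simp add: open_map_id)
    have "continuous_map (top_of_set P) (subtopology (RP2 n) U) cls2"
      using continuous_map_from_subtopology[OF continuous_map_cls2[of n], of P]
      by (auto simp: continuous_map_in_subtopology subtopology_subtopology U_eq P_def Int_absorb1 Int_absorb2)
    then have "continuous_map (prod_topology (top_of_set P) II) (prod_topology (subtopology (RP2 n) U) II)
      (\<lambda>(x, y). (cls2 x, id y))"
      unfolding continuous_map_prod_top by (simp add: continuous_map_id)
    then have ct: "continuous_map (top_of_set (P \<times> {0..1::real})) (prod_topology (subtopology (RP2 n) U) II) (map_prod cls2 id)"
      by (simp add: map_prod_def)
    show "quotient_map (top_of_set (P \<times> {0..1})) (prod_topology (subtopology (RP2 n) U) II) (map_prod cls2 id)"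
      using ct op by (rule continuous_open_imp_quotient_map)
        (use openin_subset[OF opU] in \<open>simp add: map_prod_surj_on U_eq Int_absorb1\<close>)
    have "continuous_on (P \<times> {0..1}) (\<lambda>w. seg n (fst (fst w)) (snd (fst w)) (snd w))"
    proof (rule continuous_on_coordinatewise_then_product)
      fix i
      have c: "continuous_on (P \<times> {0..1::real}) (\<lambda>w. fst (fst w) j)" "continuous_on (P \<times> {0..1::real}) (\<lambda>w. snd (fst w) j)" for j
        by (rule continuous_on_product_then_coordinatewise, intro continuous_intros)+
      show "continuous_on (P \<times> {0..1}) (\<lambda>w. seg n (fst (fst w)) (snd (fst w)) (snd w) i)"
        unfolding seg_def
      proof (intro continuous_on_divide continuous_on_real_sqrt continuous_on_sum continuous_on_power
          continuous_on_add continuous_on_mult c continuous_on_diff continuous_on_const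
          continuous_on_snd continuous_on_id ballI)
        fix w assume "w \<in> P \<times> {0..1::real}"
        then show "sqrt (\<Sum>j\<le>n. ((1 - snd w) * fst (fst w) j + snd w * snd (fst w) j)\<^sup>2) \<noteq> 0"
          using seg_denominator_pos[of "fst (fst w)" n "snd (fst w)" "snd w"] not_opp[of "fst (fst w)" "snd (fst w)"]
          by (auto simp: P_def)
      qed
    qed
    moreover have "(\<lambda>w. seg n (fst (fst w)) (snd (fst w)) (snd w)) \<in> P \<times> {0..1} \<rightarrow> sph n"
      using seg_in_sph not_opp by (auto simp: P_def)
    ultimately have "continuous_map (top_of_set (P \<times> {0..1})) (top_of_set (sph n)) (\<lambda>w. seg n (fst (fst w)) (snd (fst w)) (snd w))"
      by auto
    from continuous_map_compose[OF this continuous_map_cls]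
    have "continuous_map (top_of_set (P \<times> {0..1})) (RP n) (cls \<circ> (\<lambda>w. seg n (fst (fst w)) (snd (fst w)) (snd w)))" .
    then show "continuous_map (top_of_set (P \<times> {0..1})) (RP n) ((\<lambda>(z, t). h z t) \<circ> map_prod cls2 id)"
    proof (rule continuous_map_eq)
      fix w assume "w \<in> topspace (top_of_set (P \<times> {0..1::real}))"
      then obtain x y t where w: "w = ((x, y), t)" and xy: "(x, y) \<in> P"
        by auto
      show "(cls \<circ> (\<lambda>w. seg n (fst (fst w)) (snd (fst w)) (snd w))) w = ((\<lambda>(z, t). h z t) \<circ> map_prod cls2 id) w"
        using h[OF xy, of t] by (simp add: w)
    qed
  qed
  moreover have "\<forall>z \<in> topspace (RP2 n) \<inter> U. h z 0 = fst z \<and> h z 1 = snd z"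
  proof
    fix z assume "z \<in> topspace (RP2 n) \<inter> U"
    then obtain x y where xy: "(x, y) \<in> P" "z = cls2 (x, y)"
      unfolding U_eq by auto
    then have "x \<in> sph n" "y \<in> sph n" by (auto simp: P_def)
    then show "h z 0 = fst z \<and> h z 1 = snd z"
      using h[OF xy(1)] xy(2) seg_ends by simp
  qed
  ultimately have mp: "motion_planner (RP n) U h" by (simp add: motion_planner_def)
  have "h (cls2 (x, x)) t = cls x" if "x \<in> sph n" "f (x, x) \<noteq> 0" for x t
    using h[of x x t] seg_same[OF that(1)] that diag[of x] by (auto simp: P_def)
  then have "\<forall>x\<in>sph n. f (x, x) \<noteq> 0 \<longrightarrow> (\<forall>t. h (cls2 (x, x)) t = cls x)"
    by blast
  with mp show "\<exists>h. motion_planner (RP n) (cls2 ` {z \<in> sph2 n. f z \<noteq> 0}) h \<and>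
      (\<forall>x\<in>sph n. f (x, x) \<noteq> 0 \<longrightarrow> (\<forall>t. h (cls2 (x, x)) t = cls x))"
    unfolding U_def by blast
  show "openin (RP2 n) (cls2 ` {z \<in> sph2 n. f z \<noteq> 0})"
    using opU by (simp only: U_def)
qed

section \<open>From planners back to odd functions\<close>

lemma kap_ip:
  "(\<Sum>i\<le>n. \<Sum>j\<le>n. kap (cls x) i j * kap (cls y) i j) = (ip n x y)\<^sup>2"
  unfolding ip_def power2_eq_square sum_product by (simp add: mult_ac)

text \<open>The relative orientation of the two end points is transported along the planned path by
  projecting successively onto the lines at the times \<open>j / N\<close>; no path lifting is needed.\<close>

lemma odd2_from_motion_planner:
  assumes h: "motion_planner (RP n) U h" and C: "closedin (RP2 n) C" "C \<subseteq> U"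
  obtains f where "odd2 n f" "continuous_on {z \<in> sph2 n. cls2 z \<in> U} f"
    "\<And>z. z \<in> sph2 n \<Longrightarrow> cls2 z \<in> C \<Longrightarrow> f z \<noteq> 0"
proof -
  define V where "V = {z \<in> sph2 n. cls2 z \<in> U}"
  define D where "D = {z \<in> sph2 n. cls2 z \<in> C}"
  have DV: "D \<subseteq> V"
    using C(2) by (auto simp: D_def V_def)
  have hc: "continuous_map (prod_topology (subtopology (RP2 n) U) II) (RP n) (\<lambda>(z, t). h z t)"
    and he: "\<And>z. z \<in> topspace (RP2 n) \<inter> U \<Longrightarrow> h z 0 = fst z \<and> h z 1 = snd z"
    using h by (auto simp: motion_planner_def)
  define k where "k = (\<lambda>(z, t). kap (h (cls2 z) t))"
  have cls2V: "continuous_map (top_of_set V) (subtopology (RP2 n) U) cls2"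
    using continuous_map_from_subtopology[OF continuous_map_cls2[of n], of V]
    by (auto simp: continuous_map_in_subtopology subtopology_subtopology V_def Int_absorb1)
  then have "continuous_map (prod_topology (top_of_set V) II) (prod_topology (subtopology (RP2 n) U) II)
      (\<lambda>(x, y). (cls2 x, id y))"
    unfolding continuous_map_prod_top by (simp add: continuous_map_id)
  from continuous_map_compose[OF this hc]
  have hV: "continuous_map (top_of_set (V \<times> {0..1::real})) (RP n) (\<lambda>(z, t). h (cls2 z) t)"
    by (simp add: o_def case_prod_beta')
  have kc: "continuous_on (V \<times> {0..1}) (\<lambda>w. k w i j)" for i j
    using continuous_map_compose[OF hV continuous_map_kap[of n i j]]
    by (simp add: o_def k_def case_prod_beta')
  have rep: "\<exists>u\<in>sph n. h (cls2 z) t = cls u" if "z \<in> V" "0 \<le> t" "t \<le> 1" for z t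
  proof -
    have "h (cls2 z) t \<in> cls ` sph n"
      using continuous_map_funspace[OF hV] that by (auto simp: Pi_iff)
    then show ?thesis by blast
  qed
  \<comment> \<open>The squared cosine of the angle between the lines at times \<open>s\<close> and
    \<open>t\<close>; it equals 1 for \<open>s = t\<close>.\<close>
  define G where "G = (\<lambda>(z, s, t). \<Sum>i\<le>n. \<Sum>j\<le>n. k (z, s) i j * k (z, t) i j)"
  have "compact D"
  proof -
    have "closedin (top_of_set (sph2 n)) D"
      using closedin_continuous_map_preimage[OF continuous_map_cls2 C(1)] by (simp add: D_def)
    then show ?thesis
      using compact_sph closedin_compact compact_Times by blast
  qed
  then have cmp: "compact (D \<times> {0..1::real} \<times> {0..1::real})"
    by (intro compact_Times) auto
  have Gc: "continuous_on (D \<times> {0..1::real} \<times> {0..1::real}) G"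
  proof -
    have 1: "continuous_on (D \<times> {0..1::real} \<times> {0..1::real}) (\<lambda>w. k (fst w, fst (snd w)) i j)" for i j
      using DV by (intro continuous_on_compose2[OF kc[of i j]] continuous_intros) auto
    have 2: "continuous_on (D \<times> {0..1::real} \<times> {0..1::real}) (\<lambda>w. k (fst w, snd (snd w)) i j)" for i j
      using DV by (intro continuous_on_compose2[OF kc[of i j]] continuous_intros) auto
    show ?thesis
      unfolding G_def case_prod_beta' by (intro continuous_on_sum continuous_on_mult 1 2)
  qed
  have Gip: "G (z, s, t) = (ip n u v)\<^sup>2" if "h (cls2 z) s = cls u" "h (cls2 z) t = cls v" for z s t u v
    using that by (simp only: G_def k_def prod.case kap_ip)
  \<comment> \<open>Uniform continuity over the compact part \<open>D\<close> gives one time step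
    for which consecutive lines are never orthogonal; on the rest of \<open>V\<close> they may be,
    and \<open>f\<close> may vanish.\<close>
  obtain d where d: "d > 0" "\<And>w w'. w \<in> D \<times> {0..1} \<times> {0..1} \<Longrightarrow> w' \<in> D \<times> {0..1} \<times> {0..1} \<Longrightarrow>
      dist w' w < d \<Longrightarrow> dist (G w') (G w) < 1"
    using compact_uniformly_continuous[OF Gc cmp, unfolded uniformly_continuous_on_def, rule_format, of 1]
    by auto
  have Gpos: "G (z, s, t) > 0" if "z \<in> D" "s \<in> {0..1}" "t \<in> {0..1}" "\<bar>s - t\<bar> < d" for z s t
  proof -
    have "\<exists>u\<in>sph n. h (cls2 z) t = cls u"
      using subsetD[OF DV that(1)] that(3) by (intro rep) auto
    then obtain u where u: "u \<in> sph n" "h (cls2 z) t = cls u"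
      by blast
    then have "G (z, t, t) = 1"
      using Gip[of z t u t u] by (simp add: ip_self)
    moreover have "dist (z, s, t) (z, t, t) < d"
      using that(4) by (simp only: dist_Pair_Pair dist_real_def dist_self) simp
    ultimately show ?thesis
      using d(2)[of "(z, t, t)" "(z, s, t)"] that by (simp add: dist_real_def)
  qed
  obtain N :: nat where N: "N > 0" "1 / real N < d"
    using ex_inverse_of_nat_less[OF d(1)] by (auto simp: inverse_eq_divide)
  \<comment> \<open>\<open>W j\<close> starts with the lift \<open>fst z\<close> and multiplies
    successively by the projection matrices at times \<open>1/N, ..., j/N\<close>; over
    \<open>D\<close> it stays a non-zero multiple of a unit vector on the current line.\<close>
  define W :: "nat \<Rightarrow> (nat \<Rightarrow> real) \<times> (nat \<Rightarrow> real) \<Rightarrow> nat \<Rightarrow> real" where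
    "W = rec_nat fst (\<lambda>j w z i. \<Sum>l\<le>n. k (z, real (Suc j) / real N) i l * w z l)"
  have W0: "W 0 z = fst z" and WS: "W (Suc j) z i = (\<Sum>l\<le>n. k (z, real (Suc j) / real N) i l * W j z l)" for j z i
    by (simp_all add: W_def)
  define f where "f = (\<lambda>z. ip n (W N z) (snd z))"
  have time: "real j / real N \<in> {0..1}" if "j \<le> N" for j
    using that N(1) by (simp add: divide_le_eq)
  have Wc: "continuous_on V (\<lambda>z. W j z i)" if "j \<le> N" for j i
    using that
  proof (induction j arbitrary: i)
    case 0
    show ?case
      unfolding W0 by (rule continuous_on_coordinate(2))
  next
    case (Suc j)
    have "continuous_on V (\<lambda>z. k (z, real (Suc j) / real N) i l)" for l
      using time[OF Suc.prems] by (intro continuous_on_compose2[OF kc[of i l]] continuous_intros) auto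
    then show ?case
      unfolding WS using Suc by (intro continuous_on_sum continuous_on_mult) auto
  qed
  have fc: "continuous_on V f"
    unfolding f_def ip_def by (intro continuous_on_sum continuous_on_mult Wc continuous_on_coordinate) simp
  have k_sign: "k ((- x, y), t) = k ((x, y), t)" "k ((x, - y), t) = k ((x, y), t)" for x y t
    by (simp_all add: k_def)
  \<comment> \<open>The matrices depend only on the lines, so the first sign enters linearly through
    \<open>fst z\<close>, and the second one only in the final pairing with
    \<open>snd z\<close>.\<close>
  have "W j (- x, y) i = - W j (x, y) i \<and> W j (x, - y) i = W j (x, y) i" for j i x y
    by (induction j arbitrary: i) (simp_all add: W0 WS k_sign sum_negf)
  then have fodd: "odd2 n f" by (simp add: odd2_def f_def ip_def sum_negf)
  have nz: "f z \<noteq> 0" if z: "z \<in> D" for z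
  proof -
    have zV: "z \<in> V"
      using z DV by blast
    then have zs: "fst z \<in> sph n" "snd z \<in> sph n" "cls2 z \<in> topspace (RP2 n) \<inter> U"
      by (auto simp: V_def)
    have "\<exists>c u. c \<noteq> 0 \<and> u \<in> sph n \<and> h (cls2 z) (real j / real N) = cls u \<and> (\<forall>i. W j z i = c * u i)"
      if "j \<le> N" for j
      using that
    proof (induction j)
      case 0
      show ?case
        using he[OF zs(3)] zs(1) by (intro exI[of _ 1] exI[of _ "fst z"]) (simp add: W0)
    next
      case (Suc j)
      then obtain c u where cu: "c \<noteq> 0" "u \<in> sph n" "h (cls2 z) (real j / real N) = cls u"
        "\<And>i. W j z i = c * u i"
        by auto
      obtain v where v: "v \<in> sph n" "h (cls2 z) (real (Suc j) / real N) = cls v"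
        using rep[OF zV, of "real (Suc j) / real N"] time[OF Suc.prems] by (metis atLeastAtMost_iff)
      have "\<bar>real j / real N - real (Suc j) / real N\<bar> = 1 / real N"
        using N(1) by (simp add: field_simps)
      then have "G (z, real j / real N, real (Suc j) / real N) > 0"
        using N(2) time[of j] time[OF Suc.prems] Suc.prems z by (intro Gpos) auto
      then have "ip n v u \<noteq> 0"
        using Gip[OF cu(3) v(2)] by (auto simp: ip_commute)
      moreover have "W (Suc j) z i = (c * ip n v u) * v i" for i
        unfolding WS cu(4) k_def prod.case v(2) kap_cls ip_def sum_distrib_left sum_distrib_right
        by (intro sum.cong refl) (simp add: mult_ac)
      ultimately show ?case
        using v cu(1) by (intro exI[of _ "c * ip n v u"] exI[of _ v]) simp
    qed
    from this[of N] obtain c u where cu: "c \<noteq> 0" "u \<in> sph n" "h (cls2 z) 1 = cls u" "\<And>i. W N z i = c * u i"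
      using N(1) by auto
    have "cls u = cls (snd z)"
      using he[OF zs(3)] cu(3) by simp
    then have "(ip n u (snd z))\<^sup>2 = 1"
      using ip_square_eq_1_iff[OF cu(2) zs(2)] by (simp add: cls_eq_iff)
    then have "ip n u (snd z) \<noteq> 0" by auto
    moreover have "f z = c * ip n u (snd z)"
      unfolding f_def ip_def cu(4) sum_distrib_left by (simp add: mult_ac)
    ultimately show ?thesis
      using cu(1) by simp
  qed
  show ?thesis
    using that[of f] fodd fc nz unfolding V_def D_def by blast
qed

text \<open>Where \<open>r\<close> is positive, \<open>f\<close> is continuous on a relatively open
  set; where \<open>r\<close> vanishes, boundedness of \<open>f\<close> squeezes the product to
  0.\<close>

lemma continuous_on_bump_mult:
  fixes r f :: "'a::topological_space \<Rightarrow> real"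
  assumes r: "continuous_on S r" and nn: "\<And>z. z \<in> S \<Longrightarrow> r z \<ge> 0"
    and f: "continuous_on {z \<in> S. r z > 0} f" and bnd: "\<And>z. \<bar>f z\<bar> \<le> 1"
  shows "continuous_on S (\<lambda>z. r z * f z)"
  unfolding continuous_on_def
proof
  fix z assume z: "z \<in> S"
  have rz: "(r \<longlongrightarrow> r z) (at z within S)"
    using r z by (simp add: continuous_on_def)
  show "((\<lambda>z. r z * f z) \<longlongrightarrow> r z * f z) (at z within S)"
  proof (cases "r z > 0")
    case True
    have "eventually (\<lambda>w. r w > 0) (at z within S)"
      using rz True by (rule order_tendstoD)
    moreover have "(f \<longlongrightarrow> f z) (at z within {z \<in> S. r z > 0})"
      using f z True by (simp add: continuous_on_def)
    ultimately have "(f \<longlongrightarrow> f z) (at z within S)"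
      unfolding tendsto_def eventually_at_filter
    proof (intro allI impI)
      fix T assume T: "\<forall>S'. open S' \<longrightarrow> f z \<in> S' \<longrightarrow>
          (\<forall>\<^sub>F x in nhds z. x \<noteq> z \<longrightarrow> x \<in> {z \<in> S. r z > 0} \<longrightarrow> f x \<in> S')" "open T" "f z \<in> T"
        and r: "\<forall>\<^sub>F x in nhds z. x \<noteq> z \<longrightarrow> x \<in> S \<longrightarrow> r x > 0"
      from T have "\<forall>\<^sub>F x in nhds z. x \<noteq> z \<longrightarrow> x \<in> {z \<in> S. r z > 0} \<longrightarrow> f x \<in> T"
        by blast
      with r show "\<forall>\<^sub>F x in nhds z. x \<noteq> z \<longrightarrow> x \<in> S \<longrightarrow> f x \<in> T"
        by (rule eventually_elim2) blast
    qed
    then show ?thesis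
      using rz by (rule tendsto_mult[rotated])
  next
    case False
    then have r0: "r z = 0"
      using nn[OF z] by simp
    have "((\<lambda>z. r z * f z) \<longlongrightarrow> 0) (at z within S)"
    proof (rule Lim_null_comparison)
      show "eventually (\<lambda>w. norm (r w * f w) \<le> \<bar>r w\<bar>) (at z within S)"
        using bnd by (intro always_eventually allI) (simp add: abs_mult mult_left_le)
      show "((\<lambda>w. \<bar>r w\<bar>) \<longlongrightarrow> 0) (at z within S)"
        using tendsto_rabs[OF rz] r0 by simp
    qed
    then show ?thesis by (simp add: r0)
  qed
qed

lemma abs_div_one_plus_abs_le_1: "\<bar>a / (1 + \<bar>a\<bar>)\<bar> \<le> 1" for a :: real
proof -
  have "\<bar>a / (1 + \<bar>a\<bar>)\<bar> = \<bar>a\<bar> / (1 + \<bar>a\<bar>)"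
    by (simp add: abs_divide)
  then show ?thesis
    using abs_ge_zero[of a] by (simp only: divide_le_eq_1) linarith
qed

lemma ex_ge_average:
  fixes a :: "nat \<Rightarrow> real"
  assumes "(\<Sum>i\<le>k. a i) = 1"
  shows "\<exists>i\<le>k. a i \<ge> 1 / real (Suc k)"
proof (rule ccontr)
  assume "\<not> ?thesis"
  then have "a i < 1 / real (Suc k)" if "i \<in> {..k}" for i
    using that by (meson atMost_iff not_le)
  moreover have "0 < card {..k}"
    unfolding card_atMost by (rule zero_less_Suc)
  ultimately have "sum a {..k} < of_nat (card {..k}) * (1 / real (Suc k))"
    by (rule sum_bounded_above_strict)
  then show False
    using assms by simp
qed

text \<open>A function obtained from one planner is continuous only over its open set and non-zero
  for sure only over a closed part of it. Level sets of a partition of unity give closed parts that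
  still cover, and multiplication with the partition extends the functions by zero.\<close>

lemma odd2_functions_from_cover:
  fixes k :: nat
  assumes U: "\<And>i. i \<le> k \<Longrightarrow> openin (RP2 n) (U i)"
    and cover: "topspace (RP2 n) \<subseteq> (\<Union>i\<le>k. U i)"
    and h: "\<And>i. i \<le> k \<Longrightarrow> motion_planner (RP n) (U i) (h i)"
  obtains f where "\<And>i. i \<le> k \<Longrightarrow> odd2 n (f i)" "\<And>i. i \<le> k \<Longrightarrow> continuous_on (sph2 n) (f i)"
    "\<And>z. z \<in> sph2 n \<Longrightarrow> \<exists>i\<le>k. f i z \<noteq> 0"
proof -
  obtain \<rho> where \<rho>: "\<And>i. i \<le> k \<Longrightarrow> continuous_map (RP2 n) euclideanreal (\<rho> i)"
    "\<And>i z. i \<le> k \<Longrightarrow> z \<in> topspace (RP2 n) \<Longrightarrow> \<rho> i z \<ge> (0::real) \<and> (\<rho> i z > 0 \<longleftrightarrow> z \<in> U i)"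
    "\<And>z. z \<in> topspace (RP2 n) \<Longrightarrow> (\<Sum>i\<le>k. \<rho> i z) = 1"
    using partition_of_unity_RP2[OF U cover] by blast
  \<comment> \<open>Among \<open>k + 1\<close> numbers with sum 1 one is at least the average, so
    the sets \<open>C i\<close> cover.\<close>
  define c where "c = 1 / real (Suc k)"
  have c: "c > 0" by (simp add: c_def)
  define C where "C = (\<lambda>i. {z \<in> topspace (RP2 n). \<rho> i z \<in> {c..}})"
  have "\<exists>f. odd2 n f \<and> continuous_on {z \<in> sph2 n. cls2 z \<in> U i} f \<and> (\<forall>z\<in>sph2 n. cls2 z \<in> C i \<longrightarrow> f z \<noteq> 0)"
    if i: "i \<le> k" for i
  proof -
    have "closedin (RP2 n) (C i)"
      unfolding C_def using \<rho>(1)[OF i] by (rule closedin_continuous_map_preimage) simp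
    moreover have "C i \<subseteq> U i"
    proof
      fix z assume z: "z \<in> C i"
      then have "\<rho> i z > 0" "z \<in> topspace (RP2 n)"
        using c by (simp_all add: C_def)
      then show "z \<in> U i"
        using \<rho>(2)[OF i] by blast
    qed
    ultimately obtain f where "odd2 n f" "continuous_on {z \<in> sph2 n. cls2 z \<in> U i} f"
      "\<And>z. z \<in> sph2 n \<Longrightarrow> cls2 z \<in> C i \<Longrightarrow> f z \<noteq> 0"
      using odd2_from_motion_planner[OF h[OF i]] by blast
    then show ?thesis by blast
  qed
  note ex = this
  define f where "f = (\<lambda>i. SOME f. odd2 n f \<and> continuous_on {z \<in> sph2 n. cls2 z \<in> U i} f \<and>
    (\<forall>z\<in>sph2 n. cls2 z \<in> C i \<longrightarrow> f z \<noteq> 0))"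
  have f_all: "odd2 n (f i) \<and> continuous_on {z \<in> sph2 n. cls2 z \<in> U i} (f i) \<and>
    (\<forall>z\<in>sph2 n. cls2 z \<in> C i \<longrightarrow> f i z \<noteq> 0)" if "i \<le> k" for i
    unfolding f_def using ex[OF that] by (rule someI_ex)
  have f: "\<And>i. i \<le> k \<Longrightarrow> odd2 n (f i)"
    "\<And>i. i \<le> k \<Longrightarrow> continuous_on {z \<in> sph2 n. cls2 z \<in> U i} (f i)"
    "\<And>i z. i \<le> k \<Longrightarrow> z \<in> sph2 n \<Longrightarrow> cls2 z \<in> C i \<Longrightarrow> f i z \<noteq> 0"
    using f_all by blast+
  \<comment> \<open>The map \<open>a / (1 + \<bar>a\<bar>)\<close> is odd, bounded and has the same
    zeros, as needed for a product with a factor that tends to 0 at the boundary of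
    \<open>U i\<close>.\<close>
  define g where "g = (\<lambda>i z. \<rho> i (cls2 z) * (f i z / (1 + \<bar>f i z\<bar>)))"
  show ?thesis
  proof (rule that[of g])
    fix i assume i: "i \<le> k"
    show "odd2 n (g i)"
      using f(1)[OF i] by (simp add: odd2_def g_def)
    show "continuous_on (sph2 n) (g i)"
      unfolding g_def
    proof (rule continuous_on_bump_mult)
      show "continuous_on (sph2 n) (\<lambda>z. \<rho> i (cls2 z))"
        using continuous_map_compose[OF continuous_map_cls2 \<rho>(1)[OF i]] by (simp add: o_def)
      have in_top: "cls2 z \<in> topspace (RP2 n)" if "z \<in> sph2 n" for z
        using that by auto
      show "\<rho> i (cls2 z) \<ge> 0" if "z \<in> sph2 n" for z
        using \<rho>(2)[OF i in_top[OF that]] by simp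
      have "{z \<in> sph2 n. \<rho> i (cls2 z) > 0} = {z \<in> sph2 n. cls2 z \<in> U i}"
        using \<rho>(2)[OF i in_top] by blast
      then have fi: "continuous_on {z \<in> sph2 n. \<rho> i (cls2 z) > 0} (f i)"
        using f(2)[OF i] by simp
      show "continuous_on {z \<in> sph2 n. \<rho> i (cls2 z) > 0} (\<lambda>z. f i z / (1 + \<bar>f i z\<bar>))"
      proof (rule continuous_on_divide[OF fi])
        show "continuous_on {z \<in> sph2 n. \<rho> i (cls2 z) > 0} (\<lambda>z. 1 + \<bar>f i z\<bar>)"
          by (rule continuous_on_add[OF continuous_on_const continuous_on_rabs[OF fi]])
        show "\<forall>z\<in>{z \<in> sph2 n. \<rho> i (cls2 z) > 0}. 1 + \<bar>f i z\<bar> \<noteq> 0"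
        proof
          fix z show "1 + \<bar>f i z\<bar> \<noteq> 0"
            using abs_ge_zero[of "f i z"] by linarith
        qed
      qed
      show "\<bar>f i z / (1 + \<bar>f i z\<bar>)\<bar> \<le> 1" for z
        by (rule abs_div_one_plus_abs_le_1)
    qed
  next
    fix z assume z: "z \<in> sph2 n"
    then have ct: "cls2 z \<in> topspace (RP2 n)"
      unfolding topspace_RP2 by (rule imageI)
    obtain i where i: "i \<le> k" "\<rho> i (cls2 z) \<ge> c"
      using ex_ge_average[OF \<rho>(3)[OF ct]] unfolding c_def by blast
    have "cls2 z \<in> C i" by (simp only: C_def mem_Collect_eq atLeast_iff ct i(2) simp_thms)
    then have "f i z \<noteq> 0" by (rule f(3)[OF i(1) z])
    moreover have "\<rho> i (cls2 z) \<noteq> 0"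
      by (rule less_imp_neq[OF less_le_trans[OF c i(2)], symmetric])
    moreover have "1 + \<bar>f i z\<bar> \<noteq> 0"
      by (rule less_imp_neq[OF add_pos_nonneg[OF zero_less_one abs_ge_zero], symmetric])
    ultimately have "g i z \<noteq> 0"
      by (simp only: g_def mult_eq_0_iff divide_eq_0_iff simp_thms)
    then show "\<exists>i\<le>k. g i z \<noteq> 0"
      using i(1) by blast
  qed
qed

section \<open>Removing coordinates by counting\<close>

text \<open>Lipschitz for the maximum distance of the first \<open>n + 1\<close> coordinates, stated
  through an arbitrary upper bound \<open>e\<close> of that distance, since a grid cell supplies
  such a bound. A merely continuous map could raise dimension and would defeat the counting.\<close>

definition lip2_with :: "nat \<Rightarrow> real \<Rightarrow> ((nat \<Rightarrow> real) \<times> (nat \<Rightarrow> real) \<Rightarrow> real) \<Rightarrow> bool" where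
  "lip2_with n L f \<longleftrightarrow> (\<forall>x\<in>sph n. \<forall>y\<in>sph n. \<forall>x'\<in>sph n. \<forall>y'\<in>sph n. \<forall>e.
     (\<forall>i\<le>n. \<bar>x i - x' i\<bar> \<le> e) \<longrightarrow> (\<forall>i\<le>n. \<bar>y i - y' i\<bar> \<le> e) \<longrightarrow> \<bar>f (x, y) - f (x', y')\<bar> \<le> L * e)"

definition lip2 :: "nat \<Rightarrow> ((nat \<Rightarrow> real) \<times> (nat \<Rightarrow> real) \<Rightarrow> real) \<Rightarrow> bool" where
  "lip2 n f \<longleftrightarrow> (\<exists>L\<ge>0. lip2_with n L f)"

lemma lip2_withD:
  assumes "lip2_with n L f" "x \<in> sph n" "y \<in> sph n" "x' \<in> sph n" "y' \<in> sph n"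
    "\<And>i. i \<le> n \<Longrightarrow> \<bar>x i - x' i\<bar> \<le> e" "\<And>i. i \<le> n \<Longrightarrow> \<bar>y i - y' i\<bar> \<le> e"
  shows "\<bar>f (x, y) - f (x', y')\<bar> \<le> L * e"
  using assms unfolding lip2_with_def by blast

lemma lip2I:
  assumes "L \<ge> 0" "\<And>x y x' y' e. x \<in> sph n \<Longrightarrow> y \<in> sph n \<Longrightarrow> x' \<in> sph n \<Longrightarrow> y' \<in> sph n \<Longrightarrow>
    (\<And>i. i \<le> n \<Longrightarrow> \<bar>x i - x' i\<bar> \<le> e) \<Longrightarrow> (\<And>i. i \<le> n \<Longrightarrow> \<bar>y i - y' i\<bar> \<le> e) \<Longrightarrow>
    \<bar>f (x, y) - f (x', y')\<bar> \<le> L * e"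
  shows "lip2 n f"
  unfolding lip2_def lip2_with_def using assms by (intro exI[of _ L]) simp

lemma lip2_const: "lip2 n (\<lambda>_. c)"
  by (rule lip2I[of 0]) auto

lemma lip2_add:
  assumes "lip2 n f" "lip2 n g"
  shows "lip2 n (\<lambda>z. f z + g z)"
proof -
  obtain L where L: "L \<ge> 0" "lip2_with n L f"
    using assms(1) unfolding lip2_def by blast
  obtain M where M: "M \<ge> 0" "lip2_with n M g"
    using assms(2) unfolding lip2_def by blast
  show ?thesis
  proof (rule lip2I[of "L + M"])
    fix x y x' y' :: "nat \<Rightarrow> real" and e
    assume a: "x \<in> sph n" "y \<in> sph n" "x' \<in> sph n" "y' \<in> sph n"
      "\<And>i. i \<le> n \<Longrightarrow> \<bar>x i - x' i\<bar> \<le> e" "\<And>i. i \<le> n \<Longrightarrow> \<bar>y i - y' i\<bar> \<le> e"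
    show "\<bar>f (x, y) + g (x, y) - (f (x', y') + g (x', y'))\<bar> \<le> (L + M) * e"
      using lip2_withD[OF L(2) a] lip2_withD[OF M(2) a] by (simp add: distrib_right)
  qed (use L M in simp)
qed

lemma lip2_mult:
  assumes "lip2 n f" "lip2 n g" and c: "continuous_on (sph2 n) f" "continuous_on (sph2 n) g"
  shows "lip2 n (\<lambda>z. f z * g z)"
proof -
  obtain L where L: "L \<ge> 0" "lip2_with n L f"
    using assms(1) unfolding lip2_def by blast
  obtain M where M: "M \<ge> 0" "lip2_with n M g"
    using assms(2) unfolding lip2_def by blast
  have cmp: "compact (sph2 n)" by (intro compact_Times compact_sph)
  obtain A where A: "\<And>z. z \<in> sph2 n \<Longrightarrow> \<bar>f z\<bar> \<le> A"
    using compact_imp_bounded[OF compact_continuous_image[OF c(1) cmp]] by (auto simp: bounded_iff)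
  obtain B where B: "\<And>z. z \<in> sph2 n \<Longrightarrow> \<bar>g z\<bar> \<le> B"
    using compact_imp_bounded[OF compact_continuous_image[OF c(2) cmp]] by (auto simp: bounded_iff)
  show ?thesis
  proof (rule lip2I[of "\<bar>A\<bar> * M + \<bar>B\<bar> * L"])
    fix x y x' y' :: "nat \<Rightarrow> real" and e
    assume a: "x \<in> sph n" "y \<in> sph n" "x' \<in> sph n" "y' \<in> sph n"
      "\<And>i. i \<le> n \<Longrightarrow> \<bar>x i - x' i\<bar> \<le> e" "\<And>i. i \<le> n \<Longrightarrow> \<bar>y i - y' i\<bar> \<le> e"
    have "f (x, y) * g (x, y) - f (x', y') * g (x', y')
        = f (x, y) * (g (x, y) - g (x', y')) + g (x', y') * (f (x, y) - f (x', y'))"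
      by (simp add: algebra_simps)
    then have "\<bar>f (x, y) * g (x, y) - f (x', y') * g (x', y')\<bar>
        \<le> \<bar>f (x, y)\<bar> * \<bar>g (x, y) - g (x', y')\<bar> + \<bar>g (x', y')\<bar> * \<bar>f (x, y) - f (x', y')\<bar>"
      by (metis abs_mult abs_triangle_ineq)
    also have "\<dots> \<le> \<bar>A\<bar> * (M * e) + \<bar>B\<bar> * (L * e)"
    proof (intro add_mono mult_mono)
      show "\<bar>f (x, y)\<bar> \<le> \<bar>A\<bar>"
        using A[of "(x, y)"] a by simp
      show "\<bar>g (x', y')\<bar> \<le> \<bar>B\<bar>"
        using B[of "(x', y')"] a by simp
    qed (use lip2_withD[OF L(2) a] lip2_withD[OF M(2) a] in auto)
    finally show "\<bar>f (x, y) * g (x, y) - f (x', y') * g (x', y')\<bar> \<le> (\<bar>A\<bar> * M + \<bar>B\<bar> * L) * e"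
      by (simp add: algebra_simps)
  qed (use L M in simp)
qed

lemma lip2_coordinate:
  assumes "i \<le> n"
  shows "lip2 n (\<lambda>z. fst z i)" "lip2 n (\<lambda>z. snd z i)"
  using assms by (auto intro!: lip2I[of 1])

lemma sph_eqI:
  assumes "x \<in> sph n" "y \<in> sph n" "\<And>i. i \<le> n \<Longrightarrow> x i = y i"
  shows "x = y"
proof
  fix i show "x i = y i"
    using assms by (cases "i \<le> n") (auto simp: sph_def)
qed

text \<open>Stone-Weierstrass for the algebra of continuous Lipschitz functions; the coordinates
  belong to it and separate points.\<close>

lemma lip2_dense:
  assumes f: "continuous_on (sph2 n) f" and e: "e > 0"
  obtains g where "continuous_on (sph2 n) g" "lip2 n g" "\<And>z. z \<in> sph2 n \<Longrightarrow> \<bar>f z - g z\<bar> < e"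
proof -
  interpret function_ring_on "{g. continuous_on (sph2 n) g \<and> lip2 n g}" "sph2 n"
  proof
    show "compact (sph2 n)" by (intro compact_Times compact_sph)
    fix x y :: "(nat \<Rightarrow> real) \<times> (nat \<Rightarrow> real)"
    assume xy: "x \<in> sph2 n" "y \<in> sph2 n" "x \<noteq> y"
    have "\<exists>i\<le>n. fst x i \<noteq> fst y i \<or> snd x i \<noteq> snd y i"
    proof (rule ccontr)
      assume a: "\<not> ?thesis"
      then have eq: "fst x i = fst y i" "snd x i = snd y i" if "i \<le> n" for i
        using that by blast+
      have mem: "fst x \<in> sph n" "fst y \<in> sph n" "snd x \<in> sph n" "snd y \<in> sph n"
        using xy by (simp_all only: mem_Times_iff)
      have "fst x = fst y"
        using mem(1,2) eq(1) by (rule sph_eqI)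
      moreover have "snd x = snd y"
        using mem(3,4) eq(2) by (rule sph_eqI)
      ultimately show False
        using xy(3) by (simp add: prod_eq_iff)
    qed
    then obtain i where i: "i \<le> n" "fst x i \<noteq> fst y i \<or> snd x i \<noteq> snd y i"
      by blast
    have mem: "(\<lambda>z. fst z i) \<in> {g. continuous_on (sph2 n) g \<and> lip2 n g}"
      "(\<lambda>z. snd z i) \<in> {g. continuous_on (sph2 n) g \<and> lip2 n g}"
      by (intro CollectI conjI lip2_coordinate i continuous_on_coordinate)+
    from i(2) show "\<exists>f\<in>{g. continuous_on (sph2 n) g \<and> lip2 n g}. f x \<noteq> f y"
    proof
      assume "fst x i \<noteq> fst y i"
      then show ?thesis
        using mem(1) by (rule bexI[of "\<lambda>f. f x \<noteq> f y" "\<lambda>z. fst z i"])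
    next
      assume "snd x i \<noteq> snd y i"
      then show ?thesis
        using mem(2) by (rule bexI[of "\<lambda>f. f x \<noteq> f y" "\<lambda>z. snd z i"])
    qed
  next
    fix f g :: "(nat \<Rightarrow> real) \<times> (nat \<Rightarrow> real) \<Rightarrow> real"
    assume f: "f \<in> {g. continuous_on (sph2 n) g \<and> lip2 n g}"
    then show "continuous_on (sph2 n) f" by blast
    assume g: "g \<in> {g. continuous_on (sph2 n) g \<and> lip2 n g}"
    have fg: "continuous_on (sph2 n) f" "lip2 n f" "continuous_on (sph2 n) g" "lip2 n g"
      using f g by blast+
    show "(\<lambda>x. f x + g x) \<in> {g. continuous_on (sph2 n) g \<and> lip2 n g}"
      by (intro CollectI conjI continuous_on_add lip2_add fg)
    show "(\<lambda>x. f x * g x) \<in> {g. continuous_on (sph2 n) g \<and> lip2 n g}"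
      by (intro CollectI conjI continuous_on_mult lip2_mult fg)
  next
    fix c :: real
    show "(\<lambda>_. c) \<in> {g. continuous_on (sph2 n) g \<and> lip2 n g}"
      by (intro CollectI conjI continuous_on_const lip2_const)
  qed
  obtain g where g: "g \<in> {g. continuous_on (sph2 n) g \<and> lip2 n g}" and fg: "\<forall>z\<in>sph2 n. \<bar>f z - g z\<bar> < e"
    using Stone_Weierstrass_basic[OF f e] by (elim bexE) (rule that)
  show ?thesis
  proof (rule that[of g])
    show "continuous_on (sph2 n) g" "lip2 n g"
      using g by blast+
    fix z assume "z \<in> sph2 n"
    with fg show "\<bar>f z - g z\<bar> < e" ..
  qed
qed

lemma lip2_flip:
  assumes "lip2 n f" "a = 1 \<or> a = (-1::real)" "b = 1 \<or> b = (-1::real)"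
  shows "lip2 n (\<lambda>z. f (\<lambda>i. a * fst z i, \<lambda>i. b * snd z i))"
proof -
  obtain L where L: "L \<ge> 0" "lip2_with n L f"
    using assms(1) unfolding lip2_def by blast
  have s: "(\<lambda>i. c * x i) \<in> sph n" if "c = 1 \<or> c = (-1::real)" "x \<in> sph n" for c x
    using that by (auto simp: sph_def)
  have d: "\<bar>c * p - c * q\<bar> = \<bar>p - q\<bar>" if "c = 1 \<or> c = (-1::real)" for c p q :: real
    using that by auto
  show ?thesis
  proof (rule lip2I[OF L(1)])
    fix x y x' y' :: "nat \<Rightarrow> real" and e
    assume "x \<in> sph n" "y \<in> sph n" "x' \<in> sph n" "y' \<in> sph n"
      "\<And>i. i \<le> n \<Longrightarrow> \<bar>x i - x' i\<bar> \<le> e" "\<And>i. i \<le> n \<Longrightarrow> \<bar>y i - y' i\<bar> \<le> e"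
    then show "\<bar>f (\<lambda>i. a * fst (x, y) i, \<lambda>i. b * snd (x, y) i) - f (\<lambda>i. a * fst (x', y') i, \<lambda>i. b * snd (x', y') i)\<bar> \<le> L * e"
      using assms(2,3) by (intro lip2_withD[OF L(2)] s) (simp_all add: d)
  qed
qed

lemma continuous_on_flip:
  fixes a b :: real
  assumes f: "continuous_on (sph2 n) f" and ab: "a = 1 \<or> a = -1" "b = 1 \<or> b = -1"
  shows "continuous_on (sph2 n) (\<lambda>z. f (\<lambda>i. a * fst z i, \<lambda>i. b * snd z i) :: real)"
proof (rule continuous_on_compose2[OF f])
  show "continuous_on (sph2 n) (\<lambda>z. (\<lambda>i. a * fst z i, \<lambda>i. b * snd z i))"
    by (intro continuous_on_Pair continuous_on_coordinatewise_then_product continuous_on_mult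
        continuous_on_const continuous_on_coordinate)
  show "(\<lambda>z. (\<lambda>i. a * fst z i, \<lambda>i. b * snd z i)) ` sph2 n \<subseteq> sph2 n"
    using ab by (auto simp: sph_def)
qed

text \<open>Averaging an approximation over the four sign changes, weighted with the signs of a
  function odd in both variables, makes it odd. Since \<open>f\<close> equals its own average, the
  error does not grow.\<close>

lemma odd2_lip2_dense:
  assumes f: "continuous_on (sph2 n) f" "odd2 n f" and e: "e > 0"
  obtains g where "continuous_on (sph2 n) g" "lip2 n g" "odd2 n g" "\<And>z. z \<in> sph2 n \<Longrightarrow> \<bar>f z - g z\<bar> < e"
proof -
  obtain g where g: "continuous_on (sph2 n) g" "lip2 n g" "\<And>z. z \<in> sph2 n \<Longrightarrow> \<bar>f z - g z\<bar> < e"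
    using lip2_dense[OF f(1) e] by blast
  define G where "G = (\<lambda>(a::real) (b::real) z. g (\<lambda>i. a * fst z i, \<lambda>i. b * snd z i))"
  define g' where "g' = (\<lambda>z. (1/4) * (G 1 1 z + (-1) * G (-1) 1 z + (-1) * G 1 (-1) z + G (-1) (-1) z))"
  have G: "continuous_on (sph2 n) (G a b)" "lip2 n (G a b)" if "a = 1 \<or> a = -1" "b = 1 \<or> b = -1" for a b
    unfolding G_def using continuous_on_flip[OF g(1) that] lip2_flip[OF g(2) that] by auto
  have expl: "g' (x, y) = (1/4) * (g (x, y) - g (- x, y) - g (x, - y) + g (- x, - y))" for x y
    by (simp add: g'_def G_def fun_Compl_def)
  have "continuous_on (sph2 n) g'"
    unfolding g'_def by (intro continuous_on_mult continuous_on_add continuous_on_const G) simp_all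
  moreover have "lip2 n g'"
    unfolding g'_def
    by (intro lip2_mult lip2_add lip2_const continuous_on_mult continuous_on_add continuous_on_const G) simp_all
  moreover have "odd2 n g'" by (auto simp: odd2_def expl field_simps)
  moreover have "\<bar>f z - g' z\<bar> < e" if zs: "z \<in> sph2 n" for z
  proof -
    obtain x y where z: "z = (x, y)" "x \<in> sph n" "y \<in> sph n"
      using zs by blast
    have "\<bar>f (x, y) - g (x, y)\<bar> < e" "\<bar>- f (x, y) - g (- x, y)\<bar> < e"
      "\<bar>- f (x, y) - g (x, - y)\<bar> < e" "\<bar>f (x, y) - g (- x, - y)\<bar> < e"
      using g(3)[of "(x, y)"] g(3)[of "(- x, y)"] g(3)[of "(x, - y)"] g(3)[of "(- x, - y)"]
        odd2D[OF f(2), of x y] odd2D[OF f(2), of x "- y"] z by simp_all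
    then show ?thesis
      unfolding z expl abs_less_iff by (simp add: field_simps)
  qed
  ultimately show ?thesis
    using that by blast
qed

lemma compact_pos_lower_bound:
  fixes m :: "'a::topological_space \<Rightarrow> real"
  assumes "compact S" "continuous_on S m" "\<And>z. z \<in> S \<Longrightarrow> m z > 0"
  shows "\<exists>d>0. \<forall>z\<in>S. d \<le> m z"
proof (cases "S = {}")
  case True
  then show ?thesis by (intro exI[of _ 1]) simp
next
  case False
  then obtain w where "w \<in> S" "\<forall>z\<in>S. m w \<le> m z"
    using continuous_attains_inf[OF assms(1) _ assms(2)] by blast
  then show ?thesis
    using assms(3) by blast
qed

lemma odd2_lip2_functions:
  fixes k :: nat
  assumes f: "\<And>i. i \<le> k \<Longrightarrow> odd2 n (f i)" "\<And>i. i \<le> k \<Longrightarrow> continuous_on (sph2 n) (f i)"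
    "\<And>z. z \<in> sph2 n \<Longrightarrow> \<exists>i\<le>k. f i z \<noteq> 0"
  obtains g where "\<And>i. i \<le> k \<Longrightarrow> odd2 n (g i)" "\<And>i. i \<le> k \<Longrightarrow> continuous_on (sph2 n) (g i)"
    "\<And>i. i \<le> k \<Longrightarrow> lip2 n (g i)" "\<And>z. z \<in> sph2 n \<Longrightarrow> \<exists>i\<le>k. g i z \<noteq> 0"
proof -
  have "continuous_on (sph2 n) (\<lambda>z. \<Sum>i\<le>k. \<bar>f i z\<bar>)"
    using f(2) by (intro continuous_on_sum continuous_on_rabs) simp
  moreover have "(\<Sum>i\<le>k. \<bar>f i z\<bar>) > 0" if z: "z \<in> sph2 n" for z
  proof -
    obtain i where "i \<le> k" "f i z \<noteq> 0"
      using f(3)[OF z] by blast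
    then show ?thesis by (intro sum_pos2[of _ i]) auto
  qed
  ultimately obtain d where d: "d > 0" "\<And>z. z \<in> sph2 n \<Longrightarrow> d \<le> (\<Sum>i\<le>k. \<bar>f i z\<bar>)"
    using compact_pos_lower_bound[OF compact_Times[OF compact_sph compact_sph], of n n "\<lambda>z. \<Sum>i\<le>k. \<bar>f i z\<bar>"]
    by blast
  \<comment> \<open>If all \<open>g i\<close> vanished at a point, the \<open>k + 1\<close> values
    \<open>\<bar>f i z\<bar>\<close> would each be below \<open>e\<close> and add up to less than
    \<open>d\<close>.\<close>
  define e where "e = d / real (Suc k)"
  have e: "e > 0"
    using d(1) by (simp add: e_def)
  define g where "g = (\<lambda>i. SOME g. continuous_on (sph2 n) g \<and> lip2 n g \<and> odd2 n g \<and> (\<forall>z\<in>sph2 n. \<bar>f i z - g z\<bar> < e))"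
  have g: "continuous_on (sph2 n) (g i) \<and> lip2 n (g i) \<and> odd2 n (g i) \<and> (\<forall>z\<in>sph2 n. \<bar>f i z - g i z\<bar> < e)"
    if i: "i \<le> k" for i
  proof -
    obtain g' where "continuous_on (sph2 n) g'" "lip2 n g'" "odd2 n g'" "\<And>z. z \<in> sph2 n \<Longrightarrow> \<bar>f i z - g' z\<bar> < e"
      using odd2_lip2_dense[OF f(2)[OF i] f(1)[OF i] e] by blast
    then have "\<exists>g. continuous_on (sph2 n) g \<and> lip2 n g \<and> odd2 n g \<and> (\<forall>z\<in>sph2 n. \<bar>f i z - g z\<bar> < e)"
      by blast
    then show ?thesis
      unfolding g_def by (rule someI_ex)
  qed
  have "\<exists>i\<le>k. g i z \<noteq> 0" if z: "z \<in> sph2 n" for z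
  proof (rule ccontr)
    assume a: "\<not> ?thesis"
    have "\<bar>f i z\<bar> < e" if "i \<in> {..k}" for i
    proof -
      have i: "i \<le> k"
        using that by simp
      then have "g i z = 0" "\<bar>f i z - g i z\<bar> < e"
        using a g[OF i] z by blast+
      then show ?thesis by simp
    qed
    moreover have "0 < card {..k}"
      unfolding card_atMost by (rule zero_less_Suc)
    ultimately have "(\<Sum>i\<le>k. \<bar>f i z\<bar>) < of_nat (card {..k}) * e"
      by (rule sum_bounded_above_strict)
    also have "\<dots> = d" by (simp add: e_def)
    finally show False
      using d(2)[OF z] by simp
  qed
  note nz = this
  show ?thesis
  proof (rule that[of g])
    fix i assume "i \<le> k"
    from g[OF this] show "odd2 n (g i)" "continuous_on (sph2 n) (g i)" "lip2 n (g i)"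
      by blast+
  qed (rule nz)
qed

section \<open>Counting grid points on cones\<close>

text \<open>The radius \<open>s\<close> is the inner product of the cone point over \<open>x\<close>
  with the unit vector \<open>x\<close>, while the other cone point has inner product at most
  \<open>s'\<close> with it. Swapping the points bounds the opposite difference.\<close>

lemma cone_points_close:
  assumes x: "x \<in> sph n" "x' \<in> sph n" and s: "s \<ge> 0" "s' \<ge> 0"
    and close: "\<And>i. i \<le> n \<Longrightarrow> \<bar>s * x i - s' * x' i\<bar> \<le> e"
  shows "s - s' \<le> real (Suc n) * e"
proof -
  have "s - s' \<le> s * ip n x x - s' * ip n x' x"
    using ip_self[OF x(1)] mult_left_le[OF ip_le_1[OF x(2,1)] s(2)] by simp
  also have "\<dots> = (\<Sum>i\<le>n. (s * x i - s' * x' i) * x i)"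
    unfolding ip_def sum_distrib_left sum_subtractf[symmetric] by (simp add: algebra_simps)
  also have "\<dots> \<le> (\<Sum>i\<le>n. e)"
  proof (rule sum_mono)
    fix i assume "i \<in> {..n}"
    then have c: "\<bar>s * x i - s' * x' i\<bar> \<le> e"
      using close by simp
    have "(s * x i - s' * x' i) * x i \<le> \<bar>s * x i - s' * x' i\<bar> * \<bar>x i\<bar>"
      unfolding abs_mult[symmetric] by (rule abs_ge_self)
    also have "\<dots> \<le> \<bar>s * x i - s' * x' i\<bar> * 1"
      using sph_coordinate_le_1[OF x(1), of i] by (intro mult_left_mono) simp_all
    finally show "(s * x i - s' * x' i) * x i \<le> e"
      using c by simp
  qed
  finally show ?thesis by simp
qed

text \<open>The extension of \<open>f\<close> that is homogeneous of degree one is Lipschitz on the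
  cone. Directions at a small radius may differ by the order of \<open>e / s'\<close>, but the
  factor \<open>s'\<close> in front of \<open>f x - f x'\<close> absorbs this. The number
  \<open>n + 2\<close> is \<open>n + 1\<close> from the radii plus 1 from the points.\<close>

lemma cone_values_close:
  fixes f :: "(nat \<Rightarrow> real) \<Rightarrow> real"
  assumes lip: "\<And>x x' e. x \<in> sph n \<Longrightarrow> x' \<in> sph n \<Longrightarrow> (\<And>i. i \<le> n \<Longrightarrow> \<bar>x i - x' i\<bar> \<le> e) \<Longrightarrow> \<bar>f x - f x'\<bar> \<le> L * e"
    and bnd: "\<And>x. x \<in> sph n \<Longrightarrow> \<bar>f x\<bar> \<le> B" and L: "L \<ge> 0"
    and x: "x \<in> sph n" "x' \<in> sph n" and s: "s \<ge> 0" "s' \<ge> 0"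
    and close: "\<And>i. i \<le> n \<Longrightarrow> \<bar>s * x i - s' * x' i\<bar> \<le> e"
  shows "\<bar>s * f x - s' * f x'\<bar> \<le> (real (Suc n) * B + L * real (n + 2)) * e"
proof -
  have "\<bar>s - s'\<bar> \<le> real (Suc n) * e"
    using cone_points_close[OF x s close] cone_points_close[OF x(2,1) s(2,1), of e] close
    by (simp add: abs_le_iff abs_minus_commute)
  note ss = this
  have B: "B \<ge> 0"
    using bnd[OF x(1)] by linarith
  have e: "e \<ge> 0"
    using close[of 0] by linarith
  have 1: "\<bar>(s - s') * f x\<bar> \<le> (real (Suc n) * e) * B"
    unfolding abs_mult using ss bnd[OF x(1)] e by (intro mult_mono) simp_all
  have 2: "\<bar>s' * (f x - f x')\<bar> \<le> L * (real (n + 2) * e)"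
  proof (cases "s' = 0")
    case True
    then show ?thesis
      using L e by simp
  next
    case False
    then have s': "s' > 0"
      using s(2) by simp
    have "\<bar>x i - x' i\<bar> \<le> real (n + 2) * e / s'" if i: "i \<le> n" for i
    proof -
      have "s' * \<bar>x i - x' i\<bar> = \<bar>(s' - s) * x i + (s * x i - s' * x' i)\<bar>"
      proof -
        have "s' * (x i - x' i) = (s' - s) * x i + (s * x i - s' * x' i)"
          by (simp add: algebra_simps)
        then show ?thesis
          using s' by (metis abs_mult abs_of_pos)
      qed
      also have "\<dots> \<le> \<bar>s - s'\<bar> * \<bar>x i\<bar> + \<bar>s * x i - s' * x' i\<bar>"
        using abs_triangle_ineq[of "(s' - s) * x i" "s * x i - s' * x' i"]
        by (simp only: abs_mult abs_minus_commute[of s' s])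
      also have "\<dots> \<le> \<bar>s - s'\<bar> * 1 + e"
        using sph_coordinate_le_1[OF x(1), of i] close[OF i] by (intro add_mono mult_left_mono) simp_all
      also have "\<dots> \<le> real (n + 2) * e"
        using ss by (simp add: algebra_simps)
      finally show ?thesis
        using s' by (simp add: field_simps)
    qed
    from lip[OF x this] have "\<bar>f x - f x'\<bar> \<le> L * (real (n + 2) * e / s')" .
    then have "s' * \<bar>f x - f x'\<bar> \<le> s' * (L * (real (n + 2) * e / s'))"
      using s' by (intro mult_left_mono) simp_all
    then show ?thesis
      using s' by (simp add: abs_mult)
  qed
  have "s * f x - s' * f x' = (s - s') * f x + s' * (f x - f x')" by (simp add: algebra_simps)
  then have "\<bar>s * f x - s' * f x'\<bar> \<le> \<bar>(s - s') * f x\<bar> + \<bar>s' * (f x - f x')\<bar>"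
    by (metis abs_triangle_ineq)
  also have "\<dots> \<le> (real (Suc n) * B + L * real (n + 2)) * e"
    using 1 2 by (simp add: algebra_simps)
  finally show ?thesis .
qed

text \<open>A Lipschitz cone over finitely many \<open>n\<close>-spheres is \<open>(n + 1)\<close>-dimensional and cannot fill an open
  set of \<open>\<real>\<^sup>d\<close> for \<open>d \<ge> n + 2\<close>; counting grid points replaces measure theory, which is not available
  for a dimension that is a variable.\<close>

lemma direction_outside_cones:
  fixes F :: "'r \<Rightarrow> (nat \<Rightarrow> real) \<Rightarrow> nat \<Rightarrow> real"
  assumes R: "finite R" and d: "n + 2 \<le> d" and L: "L \<ge> 0" and \<delta>: "\<delta> > 0"
    and lip: "\<And>r j x x' e. r \<in> R \<Longrightarrow> j < d \<Longrightarrow> x \<in> sph n \<Longrightarrow> x' \<in> sph n \<Longrightarrow>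
      (\<And>i. i \<le> n \<Longrightarrow> \<bar>x i - x' i\<bar> \<le> e) \<Longrightarrow> \<bar>F r x j - F r x' j\<bar> \<le> L * e"
    and bnd: "\<And>r j x. r \<in> R \<Longrightarrow> j < d \<Longrightarrow> x \<in> sph n \<Longrightarrow> \<bar>F r x j\<bar> \<le> B"
    and nz: "\<And>r x. r \<in> R \<Longrightarrow> x \<in> sph n \<Longrightarrow> \<exists>j<d. \<bar>F r x j\<bar> \<ge> \<delta>"
  shows "\<exists>w. (\<forall>j<d. w j > 0) \<and> (\<forall>r\<in>R. \<forall>x\<in>sph n. \<forall>s\<ge>0. \<exists>j<d. w j \<noteq> s * F r x j)"
proof (rule ccontr)
  assume none: "\<not> ?thesis"
  have hit: "\<exists>r x s. r \<in> R \<and> x \<in> sph n \<and> s \<ge> 0 \<and> (\<forall>j<d. w j = s * F r x j)"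
    if "\<And>j. j < d \<Longrightarrow> w j > 0" for w
    using none that by blast
  \<comment> \<open>\<open>K\<close> exceeds the Lipschitz constant of the homogeneous extensions
    found in \<open>cone_values_close\<close>.\<close>
  obtain K :: nat where K: "real (Suc n) * B + L * real (n + 2) < real K"
    using reals_Archimedean2 by blast
  \<comment> \<open>\<open>S\<close> bounds the radii: grid points have coordinates at most 1, and
    at each point of a sphere some coordinate of \<open>F\<close> has size at least
    \<open>\<delta>\<close>.\<close>
  obtain S :: nat where S: "1 / \<delta> < real S"
    using reals_Archimedean2 by blast
  have S0: "S > 0"
    using S \<delta> by (metis gr0I less_numeral_extra(3) of_nat_0 order_less_asym zero_less_divide_1_iff)
  have K0: "K > 0 \<or> R = {}"
  proof -
    have "K > 0" if "r \<in> R" for r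
    proof -
      have "(\<lambda>i. if i = 0 then 1 else 0) \<in> sph n"
        using in_topspace_nsphere[of n] by (simp add: nsphere_eq)
      from bnd[OF that _ this, of 0] have "B \<ge> 0"
        using d by (simp add: order_trans[OF abs_ge_zero])
      then have "0 \<le> real (Suc n) * B + L * real (n + 2)"
        using L by simp
      then show ?thesis
        using K by linarith
    qed
    then show ?thesis by blast
  qed
  \<comment> \<open>At most \<open>card R * (c * G) ^ Suc n\<close> cells can occur. One further
    factor \<open>G\<close>, chosen to exceed \<open>card R * c ^ Suc n\<close>, makes the
    \<open>G ^ d\<close> grid points too many for them.\<close>
  define c where "c = 3 * S * K"
  define G where "G = Suc (card R * c ^ Suc n)"
  define Q where "Q = K * G"
  have G0: "G > 0" by (simp add: G_def)
  define pts where "pts = PiE {..<d} (\<lambda>_. {..<G})"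
  \<comment> \<open>Adding 1 keeps the grid points in the open positive orthant.\<close>
  define w :: "(nat \<Rightarrow> nat) \<Rightarrow> nat \<Rightarrow> real" where "w = (\<lambda>p j. (real (p j) + 1) / real G)"
  have wpos: "w p j > 0" for p :: "nat \<Rightarrow> nat" and j
    using G0 by (simp add: w_def)
  define ok where "ok = (\<lambda>p y. fst y \<in> R \<and> fst (snd y) \<in> sph n \<and> snd (snd y) \<ge> 0 \<and>
      (\<forall>j<d. w p j = snd (snd y) * F (fst y) (fst (snd y)) j))"
  define h where "h = (\<lambda>p. SOME y. ok p y)"
  have h: "ok p (h p)" for p
  proof -
    obtain r x s where rxs: "r \<in> R \<and> x \<in> sph n \<and> s \<ge> 0 \<and> (\<forall>j<d. w p j = s * F r x j)"
      using hit[of "w p", OF wpos] by (elim exE) (rule that)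
    have "ok p (r, x, s)"
      unfolding ok_def fst_conv snd_conv by (rule rxs)
    then show ?thesis
      unfolding h_def by (rule someI)
  qed
  define r where "r = (\<lambda>p. fst (h p))"
  define x where "x = (\<lambda>p. fst (snd (h p)))"
  define s where "s = (\<lambda>p. snd (snd (h p)))"
  have rxs: "r p \<in> R" "x p \<in> sph n" "s p \<ge> 0" and w_eq: "j < d \<Longrightarrow> w p j = s p * F (r p) (x p) j" for p j
    using h[of p] by (simp_all add: r_def x_def s_def ok_def)
  have K1: "K > 0"
    using K0 rxs(1) by blast
  have Q0: "Q > 0"
    using K1 G0 by (simp add: Q_def)
  have s_le: "s p \<le> real S" if p: "p \<in> pts" for p
  proof -
    obtain j where j: "j < d" "\<bar>F (r p) (x p) j\<bar> \<ge> \<delta>"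
      using nz[OF rxs(1,2)] by blast
    have "p j < G"
      using p j(1) by (auto simp: pts_def PiE_iff)
    then have "w p j \<le> 1"
      using G0 by (simp add: w_def)
    moreover have "s p * \<delta> \<le> s p * \<bar>F (r p) (x p) j\<bar>"
      using j(2) rxs(3) by (intro mult_left_mono)
    moreover have "s p * \<bar>F (r p) (x p) j\<bar> = w p j"
      using w_eq[OF j(1)] wpos[of p j] rxs(3)[of p] by (metis abs_mult abs_of_nonneg abs_of_pos)
    ultimately have "s p \<le> 1 / \<delta>"
      using \<delta> by (simp add: field_simps)
    then show ?thesis
      using S by simp
  qed
  \<comment> \<open>Cells of side \<open>1 / Q\<close> for the points of the cone. Since
    \<open>Q = K * G\<close>, values over one cell differ by less than \<open>1 / G\<close>, so a
    cell receives at most one grid point.\<close>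
  define cell where "cell = (\<lambda>p. (r p, restrict (\<lambda>i. \<lfloor>s p * x p i * real Q\<rfloor>) {..n}))"
  have cell_in: "cell p \<in> R \<times> PiE {..n} (\<lambda>_. {- int (S * Q) .. int (S * Q)})" if p: "p \<in> pts" for p
  proof -
    have "\<lfloor>s p * x p i * real Q\<rfloor> \<in> {- int (S * Q) .. int (S * Q)}" for i
    proof -
      have "\<bar>s p * x p i\<bar> \<le> real S * 1"
        unfolding abs_mult using s_le[OF p] rxs(3)[of p] sph_coordinate_le_1[OF rxs(2)]
        by (intro mult_mono) simp_all
      then have "\<bar>s p * x p i\<bar> * real Q \<le> real S * real Q"
        by (intro mult_right_mono) simp_all
      then have "\<bar>s p * x p i * real Q\<bar> \<le> real_of_int (int (S * Q))"
        by (simp add: abs_mult)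
      then show ?thesis
        unfolding atLeastAtMost_iff le_floor_iff floor_le_iff abs_le_iff
        by (simp add: algebra_simps)
    qed
    then show ?thesis
      using rxs(1) by (simp add: cell_def)
  qed
  have inj: "inj_on cell pts"
  proof (rule inj_onI)
    fix p q assume pq: "p \<in> pts" "q \<in> pts" "cell p = cell q"
    then have r_eq: "r p = r q" by (simp add: cell_def)
    have fl: "\<lfloor>s p * x p i * real Q\<rfloor> = \<lfloor>s q * x q i * real Q\<rfloor>" if i: "i \<le> n" for i
    proof -
      have "snd (cell p) i = snd (cell q) i"
        using pq(3) by simp
      then show ?thesis
        using i by (simp add: cell_def)
    qed
    have close: "\<bar>s p * x p i - s q * x q i\<bar> \<le> 1 / real Q" if i: "i \<le> n" for i
    proof -
      have "\<bar>s p * x p i * real Q - s q * x q i * real Q\<bar> \<le> 1"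
        using fl[OF i] by linarith
      then have "\<bar>s p * x p i - s q * x q i\<bar> * real Q \<le> 1"
        unfolding left_diff_distrib[symmetric] by (simp add: abs_mult)
      then show ?thesis
        using Q0 by (simp add: field_simps)
    qed
    have "p j = q j" if j: "j < d" for j
    proof -
      have "\<bar>s p * F (r p) (x p) j - s q * F (r p) (x q) j\<bar> \<le> (real (Suc n) * B + L * real (n + 2)) * (1 / real Q)"
        using lip[OF rxs(1) j] bnd[OF rxs(1) j] L rxs(2) rxs(2) rxs(3) rxs(3) close
        by (rule cone_values_close)
      also have "\<dots> < real K * (1 / real Q)"
        using K Q0 by (intro mult_strict_right_mono) simp_all
      also have "\<dots> = 1 / real G"
        using K1 by (simp add: Q_def)
      finally have "\<bar>w p j - w q j\<bar> < 1 / real G"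
        using w_eq[OF j] r_eq by simp
      then have "\<bar>real (p j) - real (q j)\<bar> < 1"
        using G0 by (simp add: w_def diff_divide_distrib[symmetric] abs_divide divide_less_cancel)
      then show ?thesis by linarith
    qed
    then show "p = q"
      using pq(1,2) unfolding pts_def by (intro PiE_ext[of p _ _ q]) auto
  qed
  have "G ^ d = card pts" by (simp add: pts_def card_PiE)
  also have "\<dots> = card (cell ` pts)"
    using inj by (simp add: card_image)
  also have "\<dots> \<le> card (R \<times> PiE {..n} (\<lambda>_. {- int (S * Q) .. int (S * Q)}))"
  proof (rule card_mono)
    show "finite (R \<times> PiE {..n} (\<lambda>_. {- int (S * Q) .. int (S * Q)}))"
      by (intro finite_cartesian_product R finite_PiE finite_atMost finite_atLeastAtMost_int)
    show "cell ` pts \<subseteq> R \<times> PiE {..n} (\<lambda>_. {- int (S * Q) .. int (S * Q)})"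
      by (rule image_subsetI) (rule cell_in)
  qed
  also have "\<dots> = card R * (2 * (S * Q) + 1) ^ Suc n"
  proof -
    have "card {- int m .. int m} = 2 * m + 1" for m :: nat by simp
    then show ?thesis
      by (simp only: card_cartesian_product card_PiE finite_atMost prod_constant card_atMost)
  qed
  also have "\<dots> \<le> card R * (c * G) ^ Suc n"
  proof -
    have "S * Q \<ge> 1"
      using S0 Q0 by (simp add: Suc_le_eq)
    then have "2 * (S * Q) + 1 \<le> 3 * (S * Q)" by linarith
    also have "\<dots> = c * G" by (simp add: c_def Q_def mult_ac)
    finally show ?thesis by (intro mult_left_mono power_mono) simp_all
  qed
  also have "\<dots> = card R * c ^ Suc n * G ^ Suc n" by (simp add: power_mult_distrib mult_ac)
  also have "\<dots> < G * G ^ Suc n"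
    using G0 by (intro mult_strict_right_mono) (simp_all add: G_def)
  also have "\<dots> \<le> G ^ d"
  proof -
    have "G * G ^ Suc n = G ^ (n + 2)" by simp
    also have "\<dots> \<le> G ^ d"
      using d G0 by (intro power_increasing) simp_all
    finally show ?thesis .
  qed
  finally show False by simp
qed

section \<open>Projection along a free direction\<close>

text \<open>Three n-spheres in S^n x S^n lying over the wedge and the diagonal. The other sign
  copies over the same pairs of lines are taken care of by oddness.\<close>

definition wedge_diag :: "nat \<Rightarrow> (nat \<Rightarrow> real) \<Rightarrow> ((nat \<Rightarrow> real) \<times> (nat \<Rightarrow> real)) set" where
  "wedge_diag n b = (\<lambda>x. (x, b)) ` sph n \<union> (\<lambda>x. (b, x)) ` sph n \<union> (\<lambda>x. (x, x)) ` sph n"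

text \<open>A common parametrisation of the three spheres by a number below 3, where every
  \<open>r\<close> other than 0 and 1 gives the diagonal; it turns them into one finite family of
  cones.\<close>

definition wedge_diag_point :: "(nat \<Rightarrow> real) \<Rightarrow> nat \<Rightarrow> (nat \<Rightarrow> real) \<Rightarrow> (nat \<Rightarrow> real) \<times> (nat \<Rightarrow> real)" where
  "wedge_diag_point b r x = (if r = 0 then (x, b) else if r = 1 then (b, x) else (x, x))"

lemma wedge_diag_point_in: "b \<in> sph n \<Longrightarrow> x \<in> sph n \<Longrightarrow> wedge_diag_point b r x \<in> wedge_diag n b"
  by (simp add: wedge_diag_point_def wedge_diag_def)

lemma wedge_diag_cases:
  assumes "z \<in> wedge_diag n b"
  shows "\<exists>r<3. \<exists>x\<in>sph n. z = wedge_diag_point b r x"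
proof -
  consider x where "x \<in> sph n" "z = (x, b)" | x where "x \<in> sph n" "z = (b, x)" | x where "x \<in> sph n" "z = (x, x)"
    using assms unfolding wedge_diag_def by blast
  then show ?thesis
  proof cases
    case (1 x)
    then show ?thesis by (intro exI[of _ 0] conjI bexI[of _ x]) (simp_all add: wedge_diag_point_def)
  next
    case (2 x)
    then show ?thesis by (intro exI[of _ 1] conjI bexI[of _ x]) (simp_all add: wedge_diag_point_def)
  next
    case (3 x)
    then show ?thesis by (intro exI[of _ 2] conjI bexI[of _ x]) (simp_all add: wedge_diag_point_def)
  qed
qed

lemma wedge_diag_subset: "b \<in> sph n \<Longrightarrow> wedge_diag n b \<subseteq> sph2 n"
  by (auto simp: wedge_diag_def)

lemma compact_wedge_diag: "compact (wedge_diag n b)"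
  unfolding wedge_diag_def
  by (intro compact_Un compact_continuous_image compact_sph continuous_on_Pair continuous_on_const continuous_on_id)

definition odd_lip :: "nat \<Rightarrow> ((nat \<Rightarrow> real) \<times> (nat \<Rightarrow> real) \<Rightarrow> real) \<Rightarrow> bool" where
  "odd_lip n f \<longleftrightarrow> odd2 n f \<and> continuous_on (sph2 n) f \<and> lip2 n f"

lemma odd_lip_add_mult:
  assumes "odd_lip n f" "odd_lip n g"
  shows "odd_lip n (\<lambda>z. f z + c * g z)"
proof -
  have "odd2 n (\<lambda>z. f z + c * g z)"
    using assms by (simp add: odd_lip_def odd2_def)
  moreover have "continuous_on (sph2 n) (\<lambda>z. f z + c * g z)"
    using assms unfolding odd_lip_def by (intro continuous_on_add continuous_on_mult continuous_on_const) simp_all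
  moreover have "lip2 n (\<lambda>z. f z + c * g z)"
    using assms unfolding odd_lip_def by (intro lip2_add lip2_mult lip2_const continuous_on_const) simp_all
  ultimately show ?thesis by (simp add: odd_lip_def)
qed

text \<open>Geometrically, the first \<open>d + 1\<close> coordinates are projected along a vector
  \<open>w\<close> whose line meets the image of the three spheres nowhere; such a \<open>w\<close>
  exists since their cones have dimension \<open>n + 1 < d + 1\<close>. Only multiples of coordinate
  \<open>d\<close>, which itself is kept, are subtracted from the others, so no new common zero
  arises on S^n x S^n.\<close>

lemma eliminate_coordinate:
  fixes k :: nat
  assumes G: "\<And>i. i \<le> k \<Longrightarrow> odd_lip n (G i)" and nz: "\<And>z. z \<in> sph2 n \<Longrightarrow> \<exists>i\<le>k. G i z \<noteq> 0"
    and b: "b \<in> sph n" and d: "n + 1 \<le> d" "d \<le> k"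
    and nzA: "\<And>z. z \<in> wedge_diag n b \<Longrightarrow> \<exists>i<Suc d. G i z \<noteq> 0"
  obtains G' where "\<And>i. i \<le> k \<Longrightarrow> odd_lip n (G' i)" "\<And>z. z \<in> sph2 n \<Longrightarrow> \<exists>i\<le>k. G' i z \<noteq> 0"
    "\<And>z. z \<in> wedge_diag n b \<Longrightarrow> \<exists>i<d. G' i z \<noteq> 0"
proof -
  \<comment> \<open>A cone consists of rays, so both signs are included to keep the whole line
    through \<open>w\<close> free.\<close>
  define R where "R = {..<3::nat} \<times> {1, -1::real}"
  define F where "F = (\<lambda>r x j. snd r * G j (wedge_diag_point b (fst r) x))"
  have finR: "finite R" by (simp add: R_def)
  have sgn: "\<bar>snd r\<bar> = 1" if "r \<in> R" for r
    using that by (auto simp: R_def)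
  have sp: "wedge_diag_point b (fst r) x \<in> wedge_diag n b" if "x \<in> sph n" for r :: "nat \<times> real" and x
    using b that by (rule wedge_diag_point_in)
  have cmp: "compact (sph2 n)" by (intro compact_Times compact_sph)
  define Lf where "Lf = (\<lambda>i. SOME L. L \<ge> 0 \<and> lip2_with n L (G i))"
  have Lf: "Lf i \<ge> 0 \<and> lip2_with n (Lf i) (G i)" if "i \<le> k" for i
  proof -
    have "\<exists>L. L \<ge> 0 \<and> lip2_with n L (G i)"
      using G[OF that] unfolding odd_lip_def lip2_def by blast
    then show ?thesis
      unfolding Lf_def by (rule someI_ex)
  qed
  define L where "L = (\<Sum>i\<le>k. Lf i)"
  have L0: "L \<ge> 0"
    unfolding L_def using Lf by (intro sum_nonneg) simp
  have Li: "Lf i \<le> L" if "i \<le> k" for i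
    unfolding L_def using that Lf by (intro member_le_sum) simp_all
  have cont_sum: "continuous_on (sph2 n) (\<lambda>z. \<Sum>i\<in>I. \<bar>G i z\<bar>)" if "I \<subseteq> {..k}" for I
    using that G unfolding odd_lip_def by (intro continuous_on_sum continuous_on_rabs) (simp add: subset_iff)
  obtain B where B: "\<And>z. z \<in> sph2 n \<Longrightarrow> \<bar>\<Sum>i\<le>k. \<bar>G i z\<bar>\<bar> \<le> B"
    using compact_imp_bounded[OF compact_continuous_image[OF cont_sum[OF order_refl] cmp]]
    unfolding bounded_iff by auto
  have Bi: "\<bar>G i z\<bar> \<le> B" if "i \<le> k" "z \<in> sph2 n" for i z
  proof -
    have "\<bar>G i z\<bar> \<le> (\<Sum>i\<le>k. \<bar>G i z\<bar>)"
      using that(1) by (intro member_le_sum) simp_all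
    then show ?thesis
      using B[OF that(2)] by linarith
  qed
  have subs: "{..<Suc d} \<subseteq> {..k}"
    using d(2) by auto
  have pos: "(\<Sum>i<Suc d. \<bar>G i z\<bar>) > 0" if z: "z \<in> wedge_diag n b" for z
  proof -
    obtain i where "i < Suc d" "G i z \<noteq> 0"
      using nzA[OF z] by blast
    then show ?thesis by (intro sum_pos2[of _ i]) simp_all
  qed
  have "\<exists>\<delta>>0. \<forall>z\<in>wedge_diag n b. \<delta> \<le> (\<Sum>i<Suc d. \<bar>G i z\<bar>)"
    by (rule compact_pos_lower_bound[OF compact_wedge_diag continuous_on_subset[OF cont_sum[OF subs] wedge_diag_subset[OF b]] pos])
  then obtain \<delta> where \<delta>: "\<delta> > 0" "\<And>z. z \<in> wedge_diag n b \<Longrightarrow> \<delta> \<le> (\<Sum>i<Suc d. \<bar>G i z\<bar>)"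
    by blast
  have "\<exists>w. (\<forall>j<Suc d. w j > 0) \<and> (\<forall>r\<in>R. \<forall>x\<in>sph n. \<forall>s\<ge>0. \<exists>j<Suc d. w j \<noteq> s * F r x j)"
  proof (rule direction_outside_cones[of R n "Suc d" L "\<delta> / real (Suc d)" F B])
    show "n + 2 \<le> Suc d"
      using d(1) by simp
    show "\<delta> / real (Suc d) > 0"
      using \<delta>(1) by simp
    show "\<bar>F r x j - F r x' j\<bar> \<le> L * e"
      if a: "r \<in> R" "j < Suc d" "x \<in> sph n" "x' \<in> sph n" "\<And>i. i \<le> n \<Longrightarrow> \<bar>x i - x' i\<bar> \<le> e" for r j x x' e
    proof -
      have j: "j \<le> k"
        using a(2) d(2) by simp
      have e: "e \<ge> 0"
        using a(5)[of 0] by linarith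
      have "\<bar>G j (wedge_diag_point b (fst r) x) - G j (wedge_diag_point b (fst r) x')\<bar> \<le> Lf j * e"
        unfolding wedge_diag_point_def using Lf[OF j] a b e by (auto intro!: lip2_withD[of n])
      also have "\<dots> \<le> L * e"
        using Li[OF j] e by (rule mult_right_mono)
      finally show ?thesis
        unfolding F_def right_diff_distrib[symmetric] abs_mult sgn[OF a(1)] by simp
    qed
    show "\<bar>F r x j\<bar> \<le> B" if "r \<in> R" "j < Suc d" "x \<in> sph n" for r j x
    proof -
      have "wedge_diag_point b (fst r) x \<in> sph2 n"
        using sp[OF that(3)] wedge_diag_subset[OF b] by blast
      then show ?thesis
        unfolding F_def abs_mult sgn[OF that(1)] using Bi[of j] that(2) d(2) by simp
    qed
    show "\<exists>j<Suc d. \<delta> / real (Suc d) \<le> \<bar>F r x j\<bar>" if r: "r \<in> R" and x: "x \<in> sph n" for r x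
    proof (rule ccontr)
      assume "\<not> ?thesis"
      then have "\<bar>G j (wedge_diag_point b (fst r) x)\<bar> < \<delta> / real (Suc d)" if "j \<in> {..<Suc d}" for j
        using that unfolding F_def abs_mult sgn[OF r] mult_1 lessThan_iff not_le[symmetric] by blast
      moreover have "0 < card {..<Suc d}"
        unfolding card_lessThan by (rule zero_less_Suc)
      ultimately have "(\<Sum>j<Suc d. \<bar>G j (wedge_diag_point b (fst r) x)\<bar>) < of_nat (card {..<Suc d}) * (\<delta> / real (Suc d))"
        by (rule sum_bounded_above_strict)
      also have "\<dots> = \<delta>" by simp
      finally show False
        using \<delta>(2)[OF sp[OF x, of r]] by linarith
    qed
  qed (use finR L0 in \<open>simp_all\<close>)
  then obtain w where w: "\<And>j. j < Suc d \<Longrightarrow> w j > 0"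
    "\<And>r x s. r \<in> R \<Longrightarrow> x \<in> sph n \<Longrightarrow> s \<ge> 0 \<Longrightarrow> \<exists>j<Suc d. w j \<noteq> s * F r x j"
    by blast
  define G' where "G' = (\<lambda>i z. if i < d then G i z + (- (w i / w d)) * G d z else G i z)"
  show ?thesis
  proof (rule that[of G'])
    show "odd_lip n (G' i)" if "i \<le> k" for i
      unfolding G'_def using odd_lip_add_mult[OF G[OF that] G[OF d(2)]] G[OF that]
      by (cases "i < d") (simp_all only: if_True if_False)
    show "\<exists>i\<le>k. G' i z \<noteq> 0" if z: "z \<in> sph2 n" for z
    proof (rule ccontr)
      assume "\<not> ?thesis"
      then have 0: "G' i z = 0" if "i \<le> k" for i
        using that by blast
      have "G d z = 0"
        using 0[OF d(2)] by (simp add: G'_def)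
      then have "G i z = 0" if "i \<le> k" for i
        using 0[OF that] by (simp add: G'_def split: if_splits)
      then show False
        using nz[OF z] by blast
    qed
    show "\<exists>i<d. G' i z \<noteq> 0" if z: "z \<in> wedge_diag n b" for z
    proof (rule ccontr)
      assume "\<not> ?thesis"
      then have 0: "G' i z = 0" if "i < d" for i
        using that by blast
      have wd: "w d > 0"
        using w(1) by simp
      have Gi: "G i z = (w i / w d) * G d z" if "i < Suc d" for i
        using 0[of i] that wd by (cases "i = d") (simp_all add: G'_def)
      have Gd: "G d z \<noteq> 0"
        using nzA[OF z] Gi by (metis mult_zero_right)
      obtain r x where rx: "r < 3" "x \<in> sph n" "z = wedge_diag_point b r x"
        using wedge_diag_cases[OF z] by blast
      \<comment> \<open>If the projection vanished at \<open>z\<close>, the vector of the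
        \<open>G i z\<close> would be a multiple of \<open>w\<close>; the sign
        \<open>\<sigma>\<close> and the radius \<open>w d / \<bar>G d z\<bar>\<close> would then
        exhibit \<open>w\<close> on one of the cones.\<close>
      define \<sigma> :: real where "\<sigma> = (if G d z > 0 then 1 else -1)"
      have "(r, \<sigma>) \<in> R"
        using rx(1) by (simp add: R_def \<sigma>_def)
      moreover have "w d / \<bar>G d z\<bar> \<ge> 0"
        using wd by simp
      ultimately obtain j where j: "j < Suc d" "w j \<noteq> (w d / \<bar>G d z\<bar>) * F (r, \<sigma>) x j"
        using w(2)[OF _ rx(2)] by blast
      have "\<sigma> * G d z = \<bar>G d z\<bar>" by (simp add: \<sigma>_def)
      then have "(w d / \<bar>G d z\<bar>) * (\<sigma> * ((w j / w d) * G d z)) = w j"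
        using Gd wd by (simp add: field_simps)
      moreover have "F (r, \<sigma>) x j = \<sigma> * ((w j / w d) * G d z)"
        unfolding F_def fst_conv snd_conv rx(3)[symmetric] Gi[OF j(1)] by (rule refl)
      ultimately show False
        using j(2) by simp
    qed
  qed
qed

text \<open>Downward induction from \<open>Suc k\<close> to \<open>Suc n\<close> coordinates. It
  stops there because the cones of dimension \<open>n + 1\<close> no longer have smaller dimension
  than the target.\<close>

lemma eliminate_coordinates:
  fixes k :: nat
  assumes G: "\<And>i. i \<le> k \<Longrightarrow> odd_lip n (G i)" "\<And>z. z \<in> sph2 n \<Longrightarrow> \<exists>i\<le>k. G i z \<noteq> 0"
    and b: "b \<in> sph n" and nk: "n \<le> k"
  shows "\<exists>G'. (\<forall>i\<le>k. odd_lip n (G' i)) \<and> (\<forall>z\<in>sph2 n. \<exists>i\<le>k. G' i z \<noteq> 0) \<and>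
    (\<forall>z\<in>wedge_diag n b. \<exists>i\<le>n. G' i z \<noteq> 0)"
proof -
  have "Suc n \<le> Suc k"
    using nk by simp
  then have "\<exists>G'. (\<forall>i\<le>k. odd_lip n (G' i)) \<and> (\<forall>z\<in>sph2 n. \<exists>i\<le>k. G' i z \<noteq> 0) \<and>
      (\<forall>z\<in>wedge_diag n b. \<exists>i<Suc n. G' i z \<noteq> 0)"
  proof (induction rule: inc_induct)
    case base
    have "\<forall>z\<in>wedge_diag n b. \<exists>i<Suc k. G i z \<noteq> 0"
      using G(2) wedge_diag_subset[OF b] by (meson less_Suc_eq_le subsetD)
    then show ?case
      using G by blast
  next
    case (step d)
    then obtain G' where G': "\<forall>i\<le>k. odd_lip n (G' i)" "\<forall>z\<in>sph2 n. \<exists>i\<le>k. G' i z \<noteq> 0"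
      "\<forall>z\<in>wedge_diag n b. \<exists>i<Suc d. G' i z \<noteq> 0"
      by (elim exE conjE) (rule that)
    have "n + 1 \<le> d" "d \<le> k"
      using step by simp_all
    from eliminate_coordinate[OF _ _ b this, of G'] G'
    obtain G'' where "\<And>i. i \<le> k \<Longrightarrow> odd_lip n (G'' i)" "\<And>z. z \<in> sph2 n \<Longrightarrow> \<exists>i\<le>k. G'' i z \<noteq> 0"
      "\<And>z. z \<in> wedge_diag n b \<Longrightarrow> \<exists>i<d. G'' i z \<noteq> 0"
      by blast
    then show ?case by blast
  qed
  then show ?thesis
    unfolding less_Suc_eq_le .
qed

section \<open>Covers adapted to the base point\<close>

text \<open>When the unit interval is cut by partial sums, the set with index 0 causes no miss; so a
  pair lying only in \<open>U 0\<close> is never missed, and one lying only in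
  \<open>U 0, ..., U n\<close> at most \<open>n\<close> times. For \<open>k \<le> n\<close> the last
  condition is void.\<close>

definition pointed_cover ::
  "nat \<Rightarrow> (nat \<Rightarrow> real) set \<Rightarrow> nat \<Rightarrow> (nat \<Rightarrow> ((nat \<Rightarrow> real) set \<times> (nat \<Rightarrow> real) set) set) \<Rightarrow>
   (nat \<Rightarrow> (nat \<Rightarrow> real) set \<times> (nat \<Rightarrow> real) set \<Rightarrow> real \<Rightarrow> (nat \<Rightarrow> real) set) \<Rightarrow> bool" where
  "pointed_cover n b k U h \<longleftrightarrow>
     (\<forall>i\<le>k. openin (RP2 n) (U i) \<and> motion_planner (RP n) (U i) (h i)) \<and>
     topspace (RP2 n) \<subseteq> (\<Union>i\<le>k. U i) \<and>
     (\<forall>t. h 0 (b, b) t = b) \<and> (\<forall>i\<le>k. i > 0 \<longrightarrow> (b, b) \<notin> U i) \<and>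
     (\<forall>i\<le>k. i > n \<longrightarrow> (\<forall>p\<in>topspace (RP n). (p, b) \<notin> U i \<and> (b, p) \<notin> U i))"

lemma odd2_ip: "odd2 n (\<lambda>z. ip n (fst z) (snd z))"
  by (simp add: odd2_def)

lemma continuous_on_ip_pair: "continuous_on A (\<lambda>z. ip n (fst z) (snd z))"
  by (intro continuous_on_ip continuous_on_fst continuous_on_snd continuous_on_id)

text \<open>An odd function vanishes on all four lifts of a pair of lines or on none.\<close>

lemma cls2_mem_nonzero_iff:
  assumes f: "odd2 n f" and z: "z \<in> sph2 n"
  shows "cls2 z \<in> cls2 ` {w \<in> sph2 n. f w \<noteq> 0} \<longleftrightarrow> f z \<noteq> 0"
proof
  assume "cls2 z \<in> cls2 ` {w \<in> sph2 n. f w \<noteq> 0}"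
  then obtain w where w0: "cls2 z = cls2 w" "w \<in> {w \<in> sph2 n. f w \<noteq> 0}"
    by (rule imageE)
  then have w: "w \<in> sph2 n" "f w \<noteq> 0" "cls2 z = cls2 w" by simp_all
  define x y where "x = fst w" and "y = snd w"
  have xy: "w = (x, y)" by (simp add: x_def y_def)
  have xy_in: "x \<in> sph n" "y \<in> sph n"
    using w(1) by (simp_all add: x_def y_def mem_Times_iff)
  have fxy: "f (x, y) \<noteq> 0"
    using w(2) unfolding xy .
  have flips: "f (- x, y) \<noteq> 0" "f (x, - y) \<noteq> 0" "f (- x, - y) \<noteq> 0"
    using fxy odd2D[OF f xy_in] odd2D[OF f xy_in(1), of "- y"] xy_in(2) by simp_all
  have "cls (fst z) = cls x" "cls (snd z) = cls y"
    using arg_cong[OF w(3), of fst] arg_cong[OF w(3), of snd] by (simp_all add: x_def y_def)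
  then have "(fst z = x \<or> fst z = - x) \<and> (snd z = y \<or> snd z = - y)"
    by (simp only: cls_eq_iff simp_thms)
  then consider "z = (x, y)" | "z = (- x, y)" | "z = (x, - y)" | "z = (- x, - y)"
    unfolding prod_eq_iff fst_conv snd_conv by blast
  then show "f z \<noteq> 0"
    using fxy flips by cases (simp_all only: not_False_eq_True)
next
  assume "f z \<noteq> 0"
  then show "cls2 z \<in> cls2 ` {w \<in> sph2 n. f w \<noteq> 0}"
    using z by (intro imageI CollectI conjI)
qed

lemma pointed_cover_from_functions:
  fixes k :: nat
  assumes odd: "\<And>i. i \<le> k \<Longrightarrow> odd2 n (f i)" and cont: "\<And>i. i \<le> k \<Longrightarrow> continuous_on (sph2 n) (f i)"
    and nz: "\<And>z. z \<in> sph2 n \<Longrightarrow> \<exists>i\<le>k. f i z \<noteq> 0"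
    and diag: "\<And>i x. i \<le> k \<Longrightarrow> x \<in> sph n \<Longrightarrow> f i (x, x) \<ge> 0"
    and b: "b \<in> sph n" and bb: "\<And>i. i \<le> k \<Longrightarrow> i > 0 \<Longrightarrow> f i (b, b) = 0"
    and wedge: "\<And>i x. i \<le> k \<Longrightarrow> i > n \<Longrightarrow> x \<in> sph n \<Longrightarrow> f i (x, b) = 0 \<and> f i (b, x) = 0"
  shows "\<exists>U h. pointed_cover n (cls b) k U h"
proof -
  define U where "U = (\<lambda>i. cls2 ` {z \<in> sph2 n. f i z \<noteq> 0})"
  define P where "P = (\<lambda>i h. motion_planner (RP n) (U i) h \<and>
    (\<forall>x\<in>sph n. f i (x, x) \<noteq> 0 \<longrightarrow> (\<forall>t. h (cls2 (x, x)) t = cls x)))"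
  define h where "h = (\<lambda>i. SOME h. P i h)"
  have opU: "openin (RP2 n) (U i)" if i: "i \<le> k" for i
    unfolding U_def by (rule sign_motion_planner(1)[OF cont[OF i] odd[OF i] diag[OF i]])
  have h: "P i (h i)" if i: "i \<le> k" for i
  proof -
    have "\<exists>h. P i h"
      unfolding P_def U_def by (rule sign_motion_planner(2)[OF cont[OF i] odd[OF i] diag[OF i]])
    then show ?thesis
      unfolding h_def by (rule someI_ex)
  qed
  have mem: "cls2 z \<in> U i \<longleftrightarrow> f i z \<noteq> 0" if "i \<le> k" "z \<in> sph2 n" for i z
    unfolding U_def by (rule cls2_mem_nonzero_iff[OF odd[OF that(1)] that(2)])
  have cover: "topspace (RP2 n) \<subseteq> (\<Union>i\<le>k. U i)"
  proof
    fix p assume "p \<in> topspace (RP2 n)"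
    then obtain z where z2: "p = cls2 z" "z \<in> sph2 n"
      unfolding topspace_RP2 by (rule imageE)
    note z = z2(2,1)
    obtain i where i: "i \<le> k" "f i z \<noteq> 0"
      using nz[OF z(1)] by blast
    then have "p \<in> U i"
      using mem[OF i(1) z(1)] by (simp only: z(2) simp_thms)
    then show "p \<in> (\<Union>i\<le>k. U i)"
      using i(1) by (intro UN_I) simp_all
  qed
  have bb_mem: "(cls b, cls b) \<in> U i \<longleftrightarrow> f i (b, b) \<noteq> 0" if "i \<le> k" for i
    using mem[OF that, of "(b, b)"] b by (simp only: map_prod_simp mem_Sigma_iff simp_thms)
  \<comment> \<open>Only \<open>f 0\<close> can be non-zero at \<open>(b, b)\<close>, and some
    function is; hence the planner of \<open>f 0\<close> is defined and constant there.\<close>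
  have f0: "f 0 (b, b) \<noteq> 0"
  proof -
    have "(b, b) \<in> sph2 n"
      using b by simp
    then obtain i where "i \<le> k" "f i (b, b) \<noteq> 0"
      using nz by blast
    then show ?thesis
      using bb[of i] by (cases "i = 0") simp_all
  qed
  have "h 0 (cls b, cls b) t = cls b" for t
  proof -
    have "h 0 (cls2 (b, b)) t = cls b"
      using h[of 0] f0 b unfolding P_def by blast
    then show ?thesis by simp
  qed
  moreover have "(p, cls b) \<notin> U i \<and> (cls b, p) \<notin> U i" if "i \<le> k" "i > n" and p: "p \<in> topspace (RP n)" for i p
  proof -
    obtain x where x: "x \<in> sph n" "p = cls x"
      using p unfolding topspace_RP by blast
    show ?thesis
      using mem[OF that(1), of "(x, b)"] mem[OF that(1), of "(b, x)"] wedge[OF that(1,2) x(1)] x b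
      by (simp only: map_prod_simp mem_Sigma_iff simp_thms)
  qed
  ultimately have "pointed_cover n (cls b) k U h"
    unfolding pointed_cover_def
  proof (intro conjI allI impI ballI)
    fix i assume i: "i \<le> k"
    show "openin (RP2 n) (U i)" by (rule opU[OF i])
    show "motion_planner (RP n) (U i) (h i)"
      using h[OF i] unfolding P_def by (rule conjunct1)
    assume "i > 0"
    then show "(cls b, cls b) \<notin> U i"
      using bb[OF i] bb_mem[OF i] by simp
  qed (use cover in simp_all)
  then show ?thesis by (intro exI)
qed

section \<open>Repairing the sign on the diagonal\<close>

text \<open>\<open>H\<close> may be negative on the diagonal, where great-circle planners require
  non-negative values. Since \<open>n < k\<close>, there is a coordinate \<open>n + 1\<close> beyond
  those needed on the wedge, and it can carry \<open>q\<close>, which is positive on the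
  diagonal.\<close>

lemma pointed_cover_high:
  fixes k :: nat
  assumes odd: "\<And>i. i \<le> k \<Longrightarrow> odd2 n (H i)" and cont: "\<And>i. i \<le> k \<Longrightarrow> continuous_on (sph2 n) (H i)"
    and nz: "\<And>z. z \<in> sph2 n \<Longrightarrow> \<exists>i\<le>k. H i z \<noteq> 0"
    and sp: "\<And>z. z \<in> wedge_diag n b \<Longrightarrow> \<exists>i\<le>n. H i z \<noteq> 0"
    and b: "b \<in> sph n" and bb: "H 0 (b, b) > 0" and nk: "n < k"
  shows "\<exists>U h. pointed_cover n (cls b) k U h"
proof -
  \<comment> \<open>The weights \<open>wa\<close>, \<open>dd\<close>, \<open>m\<close>,
    \<open>u0\<close>, \<open>u1\<close> are even in both variables, so multiplication by them
    preserves oddness. \<open>wa\<close> vanishes exactly over the pairs containing the base line,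
    \<open>dd\<close> exactly over the diagonal, and \<open>m\<close> exactly where the first
    \<open>n + 1\<close> coordinates of \<open>H\<close> vanish.\<close>
  define q where "q = (\<lambda>z. ip n (fst z) (snd z))"
  define wa where "wa = (\<lambda>z. (1 - (ip n (fst z) b)\<^sup>2) * (1 - (ip n (snd z) b)\<^sup>2))"
  define dd where "dd = (\<lambda>z. 1 - (q z)\<^sup>2)"
  define m where "m = (\<lambda>z. \<Sum>i\<le>n. (H i z)\<^sup>2)"
  define u0 where "u0 = (\<lambda>z. wa z * m z * (q z)\<^sup>2)"
  \<comment> \<open>At \<open>(x, x)\<close> this is the positive part of \<open>H 0\<close>, so
    \<open>u1 * H 0\<close> is non-negative there.\<close>
  define u1 where "u1 = (\<lambda>z. dd z + max 0 (H 0 z * q z))"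
  define f where "f = (\<lambda>i z. if i = 0 then u1 z * H 0 z else if i \<le> n then u1 z * dd z * H i z
     else if i = Suc n then u1 z * wa z * dd z * H i z + u0 z * q z else u1 z * wa z * dd z * H i z)"
  \<comment> \<open>Up to positive factors, \<open>f\<close> interpolates between \<open>H\<close> (where \<open>u0 = 0\<close>, in particular on the wedge) and
    \<open>q\<close> in the spare coordinate \<open>Suc n\<close> (where \<open>u1 = 0\<close>, that is, on the part of the diagonal on which
    \<open>H 0\<close> is not positive).\<close>
  have q_flip: "q (- x, y) = - q (x, y)" "q (x, - y) = - q (x, y)" for x y
    by (simp_all add: q_def)
  have wa_flip: "wa (- x, y) = wa (x, y)" "wa (x, - y) = wa (x, y)" for x y
    by (simp_all add: wa_def)
  have dd_flip: "dd (- x, y) = dd (x, y)" "dd (x, - y) = dd (x, y)" for x y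
    by (simp_all add: dd_def q_flip)
  have H_flip: "H i (- x, y) = - H i (x, y)" "H i (x, - y) = - H i (x, y)" if "i \<le> k" "x \<in> sph n" "y \<in> sph n" for i x y
    using odd2D[OF odd[OF that(1)] that(2,3)] by simp_all
  have m_flip: "m (- x, y) = m (x, y)" "m (x, - y) = m (x, y)" if "x \<in> sph n" "y \<in> sph n" for x y
    unfolding m_def using nk that by (auto intro!: sum.cong simp: H_flip)
  have u_flip: "u0 (- x, y) = u0 (x, y)" "u0 (x, - y) = u0 (x, y)" "u1 (- x, y) = u1 (x, y)" "u1 (x, - y) = u1 (x, y)"
    if "x \<in> sph n" "y \<in> sph n" for x y
    using that by (simp_all add: u0_def u1_def q_flip wa_flip dd_flip m_flip H_flip)
  have f_0: "f 0 z = u1 z * H 0 z"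
    and f_low: "0 < i \<Longrightarrow> i \<le> n \<Longrightarrow> f i z = u1 z * dd z * H i z"
    and f_mid: "f (Suc n) z = u1 z * wa z * dd z * H (Suc n) z + u0 z * q z"
    and f_high: "Suc n < i \<Longrightarrow> f i z = u1 z * wa z * dd z * H i z" for i z
    by (simp_all add: f_def)
  have f_odd: "odd2 n (f i)" if "i \<le> k" for i
    unfolding odd2_def f_def using that by (simp add: u_flip wa_flip dd_flip H_flip q_flip)
  have q_cont: "continuous_on (sph2 n) q"
    unfolding q_def by (rule continuous_on_ip_pair)
  have wa_cont: "continuous_on (sph2 n) wa"
    unfolding wa_def
    by (intro continuous_on_mult continuous_on_diff continuous_on_const continuous_on_power continuous_on_ip
        continuous_on_fst continuous_on_snd continuous_on_id)
  have dd_cont: "continuous_on (sph2 n) dd"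
    unfolding dd_def by (intro continuous_on_diff continuous_on_const continuous_on_power q_cont)
  have m_cont: "continuous_on (sph2 n) m"
    unfolding m_def using nk by (intro continuous_on_sum continuous_on_power cont) simp
  have u0_cont: "continuous_on (sph2 n) u0"
    unfolding u0_def by (intro continuous_on_mult wa_cont m_cont continuous_on_power q_cont)
  have u1_cont: "continuous_on (sph2 n) u1"
    unfolding u1_def by (intro continuous_on_add dd_cont continuous_on_max continuous_on_const continuous_on_mult cont q_cont) simp
  have f_cont: "continuous_on (sph2 n) (f i)" if "i \<le> k" for i
  proof -
    have 1: "continuous_on (sph2 n) (\<lambda>z. u1 z * H 0 z)"
      by (intro continuous_on_mult u1_cont cont) simp
    have 2: "continuous_on (sph2 n) (\<lambda>z. u1 z * dd z * H i z)"
      by (intro continuous_on_mult u1_cont dd_cont cont that)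
    have 3: "continuous_on (sph2 n) (\<lambda>z. u1 z * wa z * dd z * H i z)"
      by (intro continuous_on_mult u1_cont wa_cont dd_cont cont that)
    have 4: "continuous_on (sph2 n) (\<lambda>z. u1 z * wa z * dd z * H i z + u0 z * q z)"
      by (intro continuous_on_add 3 continuous_on_mult u0_cont q_cont)
    consider "i = 0" | "i \<noteq> 0" "i \<le> n" | "i = Suc n" | "i > Suc n"
      by linarith
    then show ?thesis
      unfolding f_def by cases (use 1 2 3 4 in simp_all)
  qed
  have dd_nonneg: "dd z \<ge> 0" if "z \<in> sph2 n" for z
    using that ip_square_le_1[of "fst z" n "snd z"] by (simp add: dd_def q_def mem_Times_iff)
  have dd0: "dd z = 0 \<longleftrightarrow> fst z = snd z \<or> fst z = - snd z" if "z \<in> sph2 n" for z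
    using that ip_square_eq_1_iff[of "fst z" n "snd z"] by (auto simp: dd_def q_def mem_Times_iff)
  have m_pos: "m z > 0" if "i \<le> n" "H i z \<noteq> 0" for i z
    unfolding m_def using that by (intro sum_pos2[of _ i]) simp_all
  have m_diag: "m (x, x) > 0" if "x \<in> sph n" for x
  proof -
    have "(x, x) \<in> wedge_diag n b"
      using that by (simp add: wedge_diag_def)
    then show ?thesis
      using sp m_pos by blast
  qed
  have wa0: "wa (x, y) = 0 \<longleftrightarrow> (x = b \<or> x = - b) \<or> (y = b \<or> y = - b)" if "x \<in> sph n" "y \<in> sph n" for x y
    using ip_square_eq_1_iff[OF that(1) b] ip_square_eq_1_iff[OF that(2) b] by (auto simp: wa_def)
  have m_wa: "m (x, y) > 0" if "x \<in> sph n" "y \<in> sph n" "wa (x, y) = 0" for x y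
  proof -
    have "m (b, y) > 0" if "y \<in> sph n" for y
      using sp[of "(b, y)"] m_pos that by (auto simp: wedge_diag_def)
    moreover have "m (x, b) > 0" if "x \<in> sph n" for x
      using sp[of "(x, b)"] m_pos that by (auto simp: wedge_diag_def)
    ultimately show ?thesis
      using wa0[OF that(1,2)] that m_flip[OF b that(2)] m_flip[OF that(1) b] by (elim iffE impE disjE) simp_all
  qed
  have u1_nonneg: "u1 z \<ge> 0" if "z \<in> sph2 n" for z
    using dd_nonneg[OF that] by (simp add: u1_def)
  have f_nz: "\<exists>i\<le>k. f i (x, y) \<noteq> 0" if xy: "x \<in> sph n" "y \<in> sph n" for x y
  proof (rule ccontr)
    assume "\<not> ?thesis"
    then have 0: "f i (x, y) = 0" if "i \<le> k" for i
      using that by blast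
    have z2: "(x, y) \<in> sph2 n"
      using xy by simp
    show False
    proof (cases "u1 (x, y) = 0")
      \<comment> \<open>This is the part over the diagonal where \<open>H 0 * q\<close> is not
        positive. There \<open>m\<close> is positive, and \<open>wa\<close> is non-zero because
        \<open>H 0 (b, b) > 0\<close> keeps the base point out; so coordinate \<open>Suc n\<close>
        does not vanish.\<close>
      case True
      then have dz: "dd (x, y) = 0" and Hq: "H 0 (x, y) * q (x, y) \<le> 0"
        using dd_nonneg[OF z2] unfolding u1_def by linarith+
      from dz have "x = y \<or> x = - y"
        using dd0[OF z2] by simp
      then have mp: "m (x, y) > 0"
        using m_diag[OF xy(2)] m_flip[OF xy(2) xy(2)] by auto
      have q1: "(q (x, y))\<^sup>2 = 1"
        using dz by (simp add: dd_def)
      have "wa (x, y) \<noteq> 0"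
      proof
        assume "wa (x, y) = 0"
        then have "(x = b \<or> x = - b) \<and> (y = b \<or> y = - b)"
          using wa0[OF xy] \<open>x = y \<or> x = - y\<close> by (metis uminus_uminus_fun)
        then have "H 0 (x, y) * q (x, y) = H 0 (b, b)"
          using H_flip[of 0 b b] H_flip[of 0 b "- b"] b q_flip ip_self[OF b] by (auto simp: q_def)
        then show False
          using Hq bb by simp
      qed
      moreover have "f (Suc n) (x, y) = u0 (x, y) * q (x, y)"
        unfolding f_mid True by simp
      moreover have "q (x, y) \<noteq> 0"
        using q1 by auto
      moreover have "f (Suc n) (x, y) = 0"
        using nk by (intro 0) simp
      ultimately show False
        using mp by (simp add: u0_def)
    next
      \<comment> \<open>Now the coordinates of \<open>f\<close> up to \<open>n\<close> vanish only
        together with those of \<open>H\<close>. Then \<open>m\<close> and \<open>u0\<close> are 0,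
        which removes the correction from coordinate \<open>Suc n\<close>, and \<open>wa\<close> is
        non-zero because \<open>m\<close> is positive over the wedge.\<close>
      case False
      have H0: "H 0 (x, y) = 0"
        using 0[of 0] False unfolding f_0 by simp
      have dn0: "dd (x, y) \<noteq> 0"
        using False H0 unfolding u1_def by simp
      have Hn: "H i (x, y) = 0" if i: "i \<le> n" for i
      proof (cases "i = 0")
        case True
        then show ?thesis
          using H0 by (simp only:)
      next
        case i0: False
        have "i \<le> k"
          using i nk by linarith
        with 0 have "u1 (x, y) * dd (x, y) * H i (x, y) = 0"
          using f_low[of i "(x, y)"] i i0 by (simp only: neq0_conv)
        then show ?thesis
          using False dn0 by (simp only: mult_eq_0_iff simp_thms)
      qed
      have m0: "m (x, y) = 0"
        unfolding m_def using Hn by (intro sum.neutral) simp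
      have wn0: "wa (x, y) \<noteq> 0"
        using m_wa[OF xy] m0 by (metis less_irrefl)
      have u00: "u0 (x, y) = 0"
        unfolding u0_def m0 by simp
      have "H i (x, y) = 0" if i: "i \<le> k" for i
      proof (cases "i \<le> n")
        case True
        then show ?thesis by (rule Hn)
      next
        case i0: False
        then consider "i = Suc n" | "Suc n < i"
          by linarith
        then have "u1 (x, y) * wa (x, y) * dd (x, y) * H i (x, y) = 0"
        proof cases
          case 1
          then show ?thesis
            using 0[OF i] f_mid[of "(x, y)"] u00 by simp
        next
          case 2
          then show ?thesis
            using 0[OF i] f_high[OF 2, of "(x, y)"] by (simp only:)
        qed
        then show ?thesis
          using False dn0 wn0 by (simp only: mult_eq_0_iff simp_thms)
      qed
      then show False
        using nz[OF z2] by blast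
    qed
  qed
  have f_diag: "f i (x, x) \<ge> 0" if "i \<le> k" "x \<in> sph n" for i x
  proof -
    have q1: "q (x, x) = 1" and d0: "dd (x, x) = 0"
      using ip_self[OF that(2)] by (simp_all add: q_def dd_def)
    have "wa (x, x) \<ge> 0"
      using ip_square_le_1[OF that(2) b] by (simp add: wa_def)
    then have "u0 (x, x) \<ge> 0"
      using m_diag[OF that(2)] by (simp add: u0_def)
    moreover have "u1 (x, x) * H 0 (x, x) \<ge> 0" by (simp add: u1_def d0 q1 max_def)
    ultimately show ?thesis by (simp add: f_def d0 q1)
  qed
  have wab: "wa (x, b) = 0 \<and> wa (b, x) = 0" for x
    using ip_self[OF b] by (simp add: wa_def)
  have f_bb: "f i (b, b) = 0" if "i > 0" for i
  proof -
    have "dd (b, b) = 0"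
      using ip_self[OF b] by (simp add: q_def dd_def)
    then show ?thesis
      using that wab[of b] by (simp add: f_def u0_def)
  qed
  have f_wedge: "f i (x, b) = 0 \<and> f i (b, x) = 0" if "i > n" for i x
    using that wab[of x] by (simp add: f_def u0_def)
  show ?thesis
  proof (rule pointed_cover_from_functions[of k n f b])
    fix z assume "z \<in> sph2 n"
    then show "\<exists>i\<le>k. f i z \<noteq> 0"
      using f_nz[of "fst z" "snd z"] by (simp add: mem_Times_iff)
  qed (use f_odd f_cont f_diag f_bb f_wedge b in \<open>blast+\<close>)
qed

section \<open>Repairing the cover at the base point\<close>

text \<open>Along half a great circle in the first variable an odd function changes sign.
  Consequently a single planner never suffices, which secures the second set needed near the base
  point.\<close>

lemma odd2_has_zero:
  assumes n: "n > 0" and f: "odd2 n f" "continuous_on (sph2 n) f"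
  shows "\<exists>z\<in>sph2 n. f z = 0"
proof -
  define \<gamma> where "\<gamma> = (\<lambda>t i. if i = 0 then cos t else if i = (1::nat) then sin t else (0::real))"
  have \<gamma>: "\<gamma> t \<in> sph n" for t
  proof -
    have "(\<Sum>i\<le>n. (\<gamma> t i)\<^sup>2) = (\<Sum>i\<in>{0, 1}. (\<gamma> t i)\<^sup>2)"
      using n by (intro sum.mono_neutral_right) (auto simp: \<gamma>_def)
    also have "\<dots> = 1" by (simp add: \<gamma>_def)
    finally show ?thesis
      using n by (auto simp: sph_def \<gamma>_def)
  qed
  have "continuous_on {0..pi} \<gamma>"
  proof (rule continuous_on_coordinatewise_then_product)
    fix i
    show "continuous_on {0..pi} (\<lambda>t. \<gamma> t i)"
      unfolding \<gamma>_def by (cases "i = 0"; cases "i = 1") (auto intro!: continuous_on_cos continuous_on_sin continuous_on_id continuous_on_const)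
  qed
  then have c: "continuous_on {0..pi} (\<lambda>t. f (\<gamma> t, \<gamma> 0))"
    using \<gamma> by (intro continuous_on_compose2[OF f(2)] continuous_on_Pair continuous_on_const) (auto simp only: mem_Times_iff fst_conv snd_conv)
  have "\<gamma> pi = - \<gamma> 0" by (auto simp: \<gamma>_def)
  then have opp: "f (\<gamma> pi, \<gamma> 0) = - f (\<gamma> 0, \<gamma> 0)"
    using odd2D(1)[OF f(1) \<gamma> \<gamma>] by simp
  have "\<exists>t\<ge>0. t \<le> pi \<and> f (\<gamma> t, \<gamma> 0) = 0"
  proof (cases "f (\<gamma> 0, \<gamma> 0) \<le> 0")
    case True
    then show ?thesis
      using opp c by (intro IVT'[of "\<lambda>t. f (\<gamma> t, \<gamma> 0)"]) simp_all
  next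
    case False
    then show ?thesis
      using opp c by (intro IVT2'[of "\<lambda>t. f (\<gamma> t, \<gamma> 0)"]) simp_all
  qed
  then obtain t where "f (\<gamma> t, \<gamma> 0) = 0"
    by blast
  moreover have "(\<gamma> t, \<gamma> 0) \<in> sph2 n"
    using \<gamma> by simp
  ultimately show ?thesis by (rule bexI)
qed

lemma motion_planner_Un:
  assumes "openin (prod_topology X X) V" "openin (prod_topology X X) W" "V \<inter> W = {}"
    and "motion_planner X V g" "motion_planner X W h"
  shows "\<exists>f. motion_planner X (V \<union> W) f \<and> (\<forall>z\<in>V. f z = g z) \<and> (\<forall>z\<in>W. f z = h z)"
proof -
  define S where "S = (\<lambda>a::bool. if a then V else W)"
  define G where "G = (\<lambda>a::bool. if a then g else h)"
  have "openin (prod_topology X X) (S a)" "motion_planner X (S a) (G a)" for a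
    using assms by (simp_all add: S_def G_def)
  moreover have "S a \<inter> S c = {}" if "a \<noteq> c" for a c
    using assms(3) that by (auto simp: S_def)
  ultimately have "\<exists>f. motion_planner X (\<Union>a\<in>UNIV. S a) f \<and> (\<forall>a\<in>UNIV. \<forall>z\<in>S a. f z = G a z)"
    by (intro motion_planner_disjoint_Union)
  then obtain f where f: "motion_planner X (\<Union>a\<in>UNIV. S a) f" "\<And>a z. z \<in> S a \<Longrightarrow> f z = G a z"
    by blast
  have "(\<Union>a\<in>UNIV. S a) = V \<union> W" by (auto simp: S_def split: if_splits)
  moreover have "f z = g z" if "z \<in> V" for z
    using f(2)[of z True] that by (simp add: S_def G_def)
  moreover have "f z = h z" if "z \<in> W" for z
    using f(2)[of z False] that by (simp add: S_def G_def)
  ultimately show ?thesis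
    using f(1) by (intro exI[of _ f]) simp
qed

text \<open>Near the base point the given planner on \<open>U 0\<close> is exchanged for the constant one; the shell
  between the two regions is handed over to \<open>U 1\<close>, which is why two sets are needed.\<close>

lemma pointed_cover_low:
  fixes k :: nat
  assumes U: "\<And>i. i \<le> k \<Longrightarrow> openin (RP2 n) (U i)" "\<And>i. i \<le> k \<Longrightarrow> motion_planner (RP n) (U i) (h i)"
    and cover: "topspace (RP2 n) \<subseteq> (\<Union>i\<le>k. U i)"
    and b: "b \<in> sph n" and k: "0 < k" "k \<le> n" and U0: "(cls b, cls b) \<in> U 0"
  shows "\<exists>U h. pointed_cover n (cls b) k U h"
proof -
  let ?z = "(cls b, cls b)"
  \<comment> \<open>\<open>q\<close> vanishes only on orthogonal pairs, and its great-circle planner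
    is constant on the diagonal; this is the replacement near the base point.\<close>
  define q where "q = (\<lambda>z. ip n (fst z) (snd z))"
  define D where "D = cls2 ` {z \<in> sph2 n. q z \<noteq> 0}"
  have q: "continuous_on (sph2 n) q" "odd2 n q" "\<And>x. x \<in> sph n \<Longrightarrow> q (x, x) \<ge> 0"
    unfolding q_def by (simp_all add: continuous_on_ip_pair odd2_ip ip_self)
  have bD: "?z \<in> D"
    using cls2_mem_nonzero_iff[OF q(2), of "(b, b)"] b ip_self[OF b] unfolding D_def q_def by simp
  have opD: "openin (RP2 n) D"
    unfolding D_def by (rule sign_motion_planner(1)[OF q])
  obtain g where g: "motion_planner (RP n) D g" "\<forall>x\<in>sph n. q (x, x) \<noteq> 0 \<longrightarrow> (\<forall>t. g (cls2 (x, x)) t = cls x)"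
  proof -
    have "\<exists>h. motion_planner (RP n) D h \<and> (\<forall>x\<in>sph n. q (x, x) \<noteq> 0 \<longrightarrow> (\<forall>t. h (cls2 (x, x)) t = cls x))"
      unfolding D_def by (rule sign_motion_planner(2)[OF q])
    then show ?thesis
      using that by blast
  qed
  have gb: "g ?z t = cls b" for t
    using g(2) b ip_self[OF b] by (simp add: q_def)
  define Ob where "Ob = U 0 \<inter> D"
  have opO: "openin (RP2 n) Ob"
    unfolding Ob_def using U(1)[of 0] opD by (intro openin_Int) simp_all
  have bO: "?z \<in> Ob"
    using U0 bD by (simp add: Ob_def)
  have z_top: "?z \<in> topspace (RP2 n)"
    using b by simp
  obtain E where E: "continuous_map (RP2 n) euclideanreal E"
    "\<And>z. z \<in> topspace (RP2 n) \<Longrightarrow> E z \<ge> 0 \<and> (E z > 0 \<longleftrightarrow> z \<in> Ob)"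
    by (rule zero_set_function_RP2[OF opO]) (rule that)
  have E0: "E ?z > 0"
    using E(2)[OF z_top] bO by blast
  \<comment> \<open>A radial coordinate around the base pair: it is 0 there and below 5 only inside
    \<open>Ob\<close>. The factor 5 makes room for the levels 1/2, 1, 2, 3, 4 that separate the
    regions.\<close>
  define r where "r = (\<lambda>z. 5 * (1 - E z / E ?z))"
  have rb: "r ?z = 0"
    using E0 by (simp add: r_def)
  have r_cont: "continuous_map (RP2 n) euclideanreal r"
    unfolding r_def using E(1) E0
    by (intro continuous_map_real_mult continuous_map_diff continuous_map_real_divide) simp_all
  have r_in: "z \<in> Ob" if "z \<in> topspace (RP2 n)" "r z < 5" for z
  proof -
    have "E z / E ?z > 0"
      using that(2) by (simp add: r_def)
    then have "E z > 0"
      using E0 by (simp add: zero_less_divide_iff)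
    then show ?thesis
      using E(2)[OF that(1)] by blast
  qed
  define L where "L = (\<lambda>T. {z \<in> topspace (RP2 n). r z \<in> T})"
  have opL: "openin (RP2 n) (L T)" if "open T" for T
    unfolding L_def using r_cont that by (intro openin_continuous_map_preimage[of _ euclideanreal]) simp_all
  have L_O: "L T \<subseteq> Ob" if "T \<subseteq> {..<5}" for T
    unfolding L_def using r_in that by blast
  have "\<exists>f. motion_planner (RP n) ((U 0 \<inter> L {2<..}) \<union> L {..<1}) f \<and>
      (\<forall>z\<in>U 0 \<inter> L {2<..}. f z = h 0 z) \<and> (\<forall>z\<in>L {..<1}. f z = g z)"
  proof (rule motion_planner_Un)
    show "openin (RP2 n) (U 0 \<inter> L {2<..})" "openin (RP2 n) (L {..<1})"
      using U(1)[of 0] opL by (simp_all add: openin_Int)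
    show "U 0 \<inter> L {2<..} \<inter> L {..<1} = {}"
      unfolding L_def by auto
    show "motion_planner (RP n) (U 0 \<inter> L {2<..}) (h 0)"
      by (rule motion_planner_subset[OF U(2)]) simp_all
    have "L {..<1} \<subseteq> Ob" by (rule L_O) auto
    then show "motion_planner (RP n) (L {..<1}) g"
      by (intro motion_planner_subset[OF g(1)]) (simp add: Ob_def)
  qed
  then obtain f0 where f0: "motion_planner (RP n) ((U 0 \<inter> L {2<..}) \<union> L {..<1}) f0" "\<forall>z\<in>L {..<1}. f0 z = g z"
    by blast
  have "\<exists>f. motion_planner (RP n) ((U 1 \<inter> L {4<..}) \<union> L {1/2<..<3}) f \<and>
      (\<forall>z\<in>U 1 \<inter> L {4<..}. f z = h 1 z) \<and> (\<forall>z\<in>L {1/2<..<3}. f z = h 0 z)"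
  proof (rule motion_planner_Un)
    show "openin (RP2 n) (U 1 \<inter> L {4<..})" "openin (RP2 n) (L {1/2<..<3})"
      using U(1)[of 1] opL k by (simp_all add: openin_Int)
    show "U 1 \<inter> L {4<..} \<inter> L {1/2<..<3} = {}"
      unfolding L_def by auto
    show "motion_planner (RP n) (U 1 \<inter> L {4<..}) (h 1)"
      using k by (intro motion_planner_subset[OF U(2)]) simp_all
    have "L {1/2<..<3} \<subseteq> Ob" by (rule L_O) auto
    then show "motion_planner (RP n) (L {1/2<..<3}) (h 0)"
      by (intro motion_planner_subset[OF U(2)]) (simp_all add: Ob_def)
  qed
  then obtain f1 where f1: "motion_planner (RP n) ((U 1 \<inter> L {4<..}) \<union> L {1/2<..<3}) f1"
    by blast
  \<comment> \<open>The shell in \<open>V 1\<close> covers the levels from 1 to 2 left out by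
    \<open>V 0\<close>; it starts at 1/2 to overlap \<open>V 0\<close> and yet avoid the base pair.
    The gap from 3 to 4 keeps it disjoint from the rest of \<open>V 1\<close>, and there
    \<open>V 0\<close> takes over, since points with \<open>r z < 5\<close> lie in
    \<open>U 0\<close>.\<close>
  define V where "V = (\<lambda>i. if i = 0 then (U 0 \<inter> L {2<..}) \<union> L {..<1}
    else if i = 1 then (U 1 \<inter> L {4<..}) \<union> L {1/2<..<3} else U i \<inter> L {4<..})"
  define f where "f = (\<lambda>i. if i = 0 then f0 else if i = 1 then f1 else h i)"
  have V_open: "openin (RP2 n) (V i)" if "i \<le> k" for i
    using U(1)[OF that] U(1)[of 0] U(1)[of 1] opL k
    unfolding V_def by (simp add: openin_Int openin_Un)
  have V_plan: "motion_planner (RP n) (V i) (f i)" if "i \<le> k" for i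
  proof -
    have "motion_planner (RP n) (U i \<inter> L {4<..}) (h i)"
      using U(2)[OF that] by (rule motion_planner_subset) simp
    then show ?thesis
      using f0(1) f1 unfolding V_def f_def by simp
  qed
  have V_cover: "topspace (RP2 n) \<subseteq> (\<Union>i\<le>k. V i)"
  proof
    fix z assume z: "z \<in> topspace (RP2 n)"
    have 0: "z \<in> (\<Union>i\<le>k. V i)" if "z \<in> V i" "i \<le> k" for i
      using that by blast
    consider "r z < 1" | "1 \<le> r z" "r z \<le> 2" | "2 < r z" "r z \<le> 4" | "4 < r z"
      by linarith
    then show "z \<in> (\<Union>i\<le>k. V i)"
    proof cases
      case 1
      then show ?thesis
        using z by (intro 0[of 0]) (simp_all add: V_def L_def)
    next
      case 2
      then show ?thesis
        using z k by (intro 0[of 1]) (simp_all add: V_def L_def)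
    next
      case 3
      then have "z \<in> U 0"
        using r_in[OF z] by (simp add: Ob_def)
      then show ?thesis
        using z 3 by (intro 0[of 0]) (simp_all add: V_def L_def)
    next
      case 4
      obtain i where i: "i \<le> k" "z \<in> U i"
        using cover z by blast
      then show ?thesis
        using z 4 by (intro 0[of i]) (auto simp: V_def L_def)
    qed
  qed
  have "?z \<in> L {..<1}"
    using z_top rb by (simp add: L_def)
  then have f_b: "f 0 ?z t = cls b" for t
    using f0(2) gb by (simp add: f_def)
  have V_b: "?z \<notin> V i" if "i > 0" for i
    using that rb by (simp add: V_def L_def)
  have "pointed_cover n (cls b) k V f"
    unfolding pointed_cover_def using V_open V_plan V_cover f_b V_b k(2) by (intro conjI allI impI) simp_all
  then show ?thesis by (intro exI)
qed

lemma pointed_cover_exists: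
  fixes k :: nat
  assumes n: "n > 0" and U: "\<And>i. i \<le> k \<Longrightarrow> openin (RP2 n) (U i)" "\<And>i. i \<le> k \<Longrightarrow> motion_planner (RP n) (U i) (h i)"
    and cover: "topspace (RP2 n) \<subseteq> (\<Union>i\<le>k. U i)" and b: "b \<in> sph n"
  shows "\<exists>U h. pointed_cover n (cls b) k U h"
proof -
  obtain f where f: "\<And>i. i \<le> k \<Longrightarrow> odd2 n (f i)" "\<And>i. i \<le> k \<Longrightarrow> continuous_on (sph2 n) (f i)"
    "\<And>z. z \<in> sph2 n \<Longrightarrow> \<exists>i\<le>k. f i z \<noteq> 0"
    by (rule odd2_functions_from_cover[OF U(1) cover U(2)]) (assumption, assumption, rule that)
  show ?thesis
  proof (cases "k \<le> n")
    case True
    have "k > 0"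
    proof (rule ccontr)
      assume "\<not> k > 0"
      then have k: "k = 0" by simp
      obtain z where "z \<in> sph2 n" "f 0 z = 0"
        using odd2_has_zero[OF n f(1,2)] k by blast
      then show False
        using f(3) k by auto
    qed
    have "(cls b, cls b) \<in> topspace (RP2 n)"
      using b by simp
    then obtain j where j: "j \<le> k" "(cls b, cls b) \<in> U j"
      using cover by blast
    \<comment> \<open>Renumbering puts a set containing the base pair at index 0.\<close>
    define \<pi> where "\<pi> = Transposition.transpose 0 j"
    have \<pi>: "\<pi> i \<le> k" if "i \<le> k" for i
      using that j(1) by (simp add: \<pi>_def Transposition.transpose_def)
    show ?thesis
    proof (rule pointed_cover_low[of k n "\<lambda>i. U (\<pi> i)" "\<lambda>i. h (\<pi> i)"])
      show "topspace (RP2 n) \<subseteq> (\<Union>i\<le>k. U (\<pi> i))"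
      proof
        fix z assume "z \<in> topspace (RP2 n)"
        then obtain i where i: "i \<le> k" "z \<in> U i"
          using cover by blast
        then have "\<pi> i \<le> k" "z \<in> U (\<pi> (\<pi> i))"
          using \<pi> by (simp_all add: \<pi>_def)
        then show "z \<in> (\<Union>i\<le>k. U (\<pi> i))" by blast
      qed
      show "(cls b, cls b) \<in> U (\<pi> 0)"
        using j(2) by (simp add: \<pi>_def)
    qed (use U \<pi> b \<open>k > 0\<close> True in simp_all)
  next
    case False
    then have nk: "n < k" by simp
    obtain G where G: "\<And>i. i \<le> k \<Longrightarrow> odd2 n (G i)" "\<And>i. i \<le> k \<Longrightarrow> continuous_on (sph2 n) (G i)"
      "\<And>i. i \<le> k \<Longrightarrow> lip2 n (G i)" "\<And>z. z \<in> sph2 n \<Longrightarrow> \<exists>i\<le>k. G i z \<noteq> 0"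
      by (rule odd2_lip2_functions[OF f]) (assumption, assumption, assumption, rule that)
    have nG: "odd_lip n (G i)" if "i \<le> k" for i
      unfolding odd_lip_def using G(1-3)[OF that] by blast
    have "\<exists>G'. (\<forall>i\<le>k. odd_lip n (G' i)) \<and> (\<forall>z\<in>sph2 n. \<exists>i\<le>k. G' i z \<noteq> 0) \<and>
        (\<forall>z\<in>wedge_diag n b. \<exists>i\<le>n. G' i z \<noteq> 0)"
      by (rule eliminate_coordinates[OF nG G(4) b less_imp_le[OF nk]])
    then obtain G' where G': "\<And>i. i \<le> k \<Longrightarrow> odd_lip n (G' i)" "\<And>z. z \<in> sph2 n \<Longrightarrow> \<exists>i\<le>k. G' i z \<noteq> 0"
      "\<And>z. z \<in> wedge_diag n b \<Longrightarrow> \<exists>i\<le>n. G' i z \<noteq> 0"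
      by blast
    have bs: "(b, b) \<in> wedge_diag n b"
      using b by (simp add: wedge_diag_def)
    then obtain j where j: "j \<le> n" "G' j (b, b) \<noteq> 0"
      using G'(3) by blast
    \<comment> \<open>The transposition stays within \<open>0, ..., n\<close>, so the first
      \<open>n + 1\<close> coordinates are only permuted, and \<open>c\<close> makes the one moved
      to index 0 positive at \<open>(b, b)\<close>.\<close>
    define \<pi> where "\<pi> = Transposition.transpose 0 j"
    define c where "c = sgn (G' j (b, b))"
    define H where "H = (\<lambda>i z. c * G' (\<pi> i) z)"
    have c: "c \<noteq> 0"
      using j(2) by (simp add: c_def sgn_zero_iff)
    have \<pi>k: "\<pi> i \<le> k" if "i \<le> k" for i
      using that j(1) nk by (simp add: \<pi>_def Transposition.transpose_def)
    have \<pi>n: "\<pi> i \<le> n" if "i \<le> n" for i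
      using that j(1) by (simp add: \<pi>_def Transposition.transpose_def)
    have \<pi>\<pi>: "\<pi> (\<pi> i) = i" for i by (simp add: \<pi>_def)
    show ?thesis
    proof (rule pointed_cover_high[of k n H b])
      show "odd2 n (H i)" if "i \<le> k" for i
        using G'(1)[OF \<pi>k[OF that]] unfolding odd_lip_def odd2_def H_def by simp
      show "continuous_on (sph2 n) (H i)" if "i \<le> k" for i
        using G'(1)[OF \<pi>k[OF that]] unfolding odd_lip_def H_def by (intro continuous_on_mult continuous_on_const) simp
      show "\<exists>i\<le>k. H i z \<noteq> 0" if z: "z \<in> sph2 n" for z
      proof -
        obtain i where "i \<le> k" "G' i z \<noteq> 0"
          using G'(2)[OF z] by blast
        then show ?thesis
          using c \<pi>k \<pi>\<pi> by (intro exI[of _ "\<pi> i"]) (simp add: H_def)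
      qed
      show "\<exists>i\<le>n. H i z \<noteq> 0" if z: "z \<in> wedge_diag n b" for z
      proof -
        obtain i where "i \<le> n" "G' i z \<noteq> 0"
          using G'(3)[OF z] by blast
        then show ?thesis
          using c \<pi>n \<pi>\<pi> by (intro exI[of _ "\<pi> i"]) (simp add: H_def)
      qed
      show "H 0 (b, b) > 0"
        using j(2) by (simp add: H_def c_def \<pi>_def sgn_mult_self_eq zero_less_mult_iff sgn_if)
    qed (use b nk in simp_all)
  qed
qed

text \<open>The partial sums of a partition of unity cut \<open>[0, 1]\<close> into \<open>k + 1\<close> intervals; a set of the new
  family collects the points for which a given test value lies inside one of these intervals.\<close>

lemma planner_family:
  fixes k N :: nat
  assumes pc: "pointed_cover n b k U h" and b: "b \<in> topspace (RP n)"
  shows "\<exists>V g. (\<forall>j\<le>N. openin (RP2 n) (V j) \<and> motion_planner (RP n) (V j) (g j) \<and>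
           (b, b) \<in> V j \<and> (\<forall>t. g j (b, b) t = b)) \<and>
         (\<forall>z\<in>topspace (RP2 n). card {j. j \<le> N \<and> z \<notin> V j} \<le> k) \<and>
         (\<forall>p\<in>topspace (RP n). card {j. j \<le> N \<and> (p, b) \<notin> V j} \<le> n \<and> card {j. j \<le> N \<and> (b, p) \<notin> V j} \<le> n)"
proof -
  have U: "\<And>i. i \<le> k \<Longrightarrow> openin (RP2 n) (U i)" "\<And>i. i \<le> k \<Longrightarrow> motion_planner (RP n) (U i) (h i)"
    and cover: "topspace (RP2 n) \<subseteq> (\<Union>i\<le>k. U i)"
    and hb: "\<And>t. h 0 (b, b) t = b" and Ub: "\<And>i. i \<le> k \<Longrightarrow> i > 0 \<Longrightarrow> (b, b) \<notin> U i"
    using pc unfolding pointed_cover_def by simp_all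
  have wedge: "\<And>i p. i \<le> k \<Longrightarrow> i > n \<Longrightarrow> p \<in> topspace (RP n) \<Longrightarrow> (p, b) \<notin> U i \<and> (b, p) \<notin> U i"
    using pc unfolding pointed_cover_def by blast
  obtain \<rho> where \<rho>: "\<And>i. i \<le> k \<Longrightarrow> continuous_map (RP2 n) euclideanreal (\<rho> i)"
    "\<And>i z. i \<le> k \<Longrightarrow> z \<in> topspace (RP2 n) \<Longrightarrow> \<rho> i z \<ge> (0::real) \<and> (\<rho> i z > 0 \<longleftrightarrow> z \<in> U i)"
    "\<And>z. z \<in> topspace (RP2 n) \<Longrightarrow> (\<Sum>i\<le>k. \<rho> i z) = 1"
    by (rule partition_of_unity_RP2[OF U(1) cover]) (assumption, rule that)
  define S where "S = (\<lambda>m z. \<Sum>l<m. \<rho> l z)"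
  \<comment> \<open>\<open>N + 1\<close> distinct test values strictly inside the unit interval, so
    that none equals the extreme partial sums 0 and 1.\<close>
  define t where "t = (\<lambda>j. real (Suc j) / real (N + 2))"
  have t01: "0 < t j" "j \<le> N \<Longrightarrow> t j < 1" for j
    by (simp_all add: t_def divide_less_eq)
  have t_inj: "t j = t j' \<Longrightarrow> j = j'" for j j'
    by (simp add: t_def divide_cancel_right)
  have S_Suc: "S (Suc m) z = S m z + \<rho> m z" for m z by (simp add: S_def)
  have S_mono: "S m z \<le> S m' z" if "m \<le> m'" "m' \<le> Suc k" "z \<in> topspace (RP2 n)" for m m' z
    unfolding S_def using that \<rho>(2)[OF _ that(3)] by (intro sum_mono2) auto
  have S_top: "S (Suc k) z = 1" if "z \<in> topspace (RP2 n)" for z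
    using \<rho>(3)[OF that] by (simp only: S_def lessThan_Suc_atMost)
  have S_cont: "continuous_map (RP2 n) euclideanreal (S m)" if "m \<le> Suc k" for m
    unfolding S_def using that \<rho>(1) by (intro continuous_map_sum) auto
  \<comment> \<open>An interval with a test value in its interior has positive length, so
    \<open>W j i\<close> lies in \<open>U i\<close>; for fixed \<open>j\<close> these sets are
    disjoint.\<close>
  define W where "W = (\<lambda>j i. {z \<in> topspace (RP2 n). S i z < t j \<and> t j < S (Suc i) z})"
  define V where "V = (\<lambda>j. \<Union>i\<in>{..k}. W j i)"
  have W_U: "W j i \<subseteq> U i" if "i \<le> k" for i j
  proof
    fix z assume z: "z \<in> W j i"
    then have "\<rho> i z > 0"
      using S_Suc[of i z] by (simp add: W_def)
    then show "z \<in> U i"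
      using \<rho>(2)[OF that, of z] z by (simp add: W_def)
  qed
  have W_open: "openin (RP2 n) (W j i)" if "i \<le> k" for i j
  proof -
    have "W j i = {z \<in> topspace (RP2 n). S i z \<in> {..<t j}} \<inter> {z \<in> topspace (RP2 n). S (Suc i) z \<in> {t j<..}}"
      by (auto simp only: W_def lessThan_iff greaterThan_iff)
    moreover have "openin (RP2 n) {z \<in> topspace (RP2 n). S i z \<in> {..<t j}}"
      using S_cont[of i] that by (intro openin_continuous_map_preimage[of _ euclideanreal]) simp_all
    moreover have "openin (RP2 n) {z \<in> topspace (RP2 n). S (Suc i) z \<in> {t j<..}}"
      using S_cont[of "Suc i"] that by (intro openin_continuous_map_preimage[of _ euclideanreal]) simp_all
    ultimately show ?thesis by (simp only: openin_Int)
  qed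
  have W_disj: "W j i \<inter> W j i' = {}" if "i \<in> {..k}" "i' \<in> {..k}" "i \<noteq> i'" for i i' j
  proof -
    have "False" if "z \<in> W j i" "z \<in> W j i'" "i < i'" "i' \<le> k" for z i i'
    proof -
      have "S (Suc i) z \<le> S i' z"
        using that by (intro S_mono) (simp_all add: W_def)
      then show False
        using that(1,2) by (simp add: W_def)
    qed
    then show ?thesis
      using that by (metis atMost_iff disjoint_iff linorder_neqE_nat)
  qed
  have V_open: "openin (RP2 n) (V j)" for j
    unfolding V_def using W_open by (intro openin_Union) blast
  define g where "g = (\<lambda>j. SOME g. motion_planner (RP n) (V j) g \<and> (\<forall>i\<in>{..k}. \<forall>z\<in>W j i. g z = h i z))"
  have g: "motion_planner (RP n) (V j) (g j) \<and> (\<forall>i\<in>{..k}. \<forall>z\<in>W j i. g j z = h i z)" for j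
  proof -
    have "\<exists>g. motion_planner (RP n) (V j) g \<and> (\<forall>i\<in>{..k}. \<forall>z\<in>W j i. g z = h i z)"
      unfolding V_def
    proof (rule motion_planner_disjoint_Union)
      fix i assume "i \<in> {..k}"
      then have i: "i \<le> k" by simp
      show "openin (RP2 n) (W j i)" by (rule W_open[OF i])
      show "motion_planner (RP n) (W j i) (h i)"
        by (rule motion_planner_subset[OF U(2)[OF i] W_U[OF i]])
    qed (rule W_disj)
    then show ?thesis
      unfolding g_def by (rule someI_ex)
  qed
  have missed: "\<exists>m\<in>{1..k}. \<rho> m z > 0 \<and> S m z = t j"
    if z: "z \<in> topspace (RP2 n)" and j: "j \<le> N" and zV: "z \<notin> V j" for z j
  proof -
    \<comment> \<open>A missed test value is an inner break point. The least such \<open>m\<close>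
      skips intervals of length zero, hence \<open>\<rho> m\<close> is positive there;
      \<open>m = 0\<close> is impossible since \<open>S 0\<close> is 0.\<close>
    define m where "m = (LEAST m. t j < S (Suc m) z)"
    have ex: "t j < S (Suc k) z"
      using t01(2)[OF j] S_top[OF z] by simp
    then have m: "t j < S (Suc m) z" "m \<le> k"
      unfolding m_def by (rule LeastI, rule Least_le)
    have Sm: "S m z \<le> t j"
    proof (cases m)
      case 0
      then show ?thesis
        using t01(1)[of j] by (simp add: S_def)
    next
      case (Suc m')
      then have "\<not> t j < S (Suc m') z"
        using not_less_Least[of m' "\<lambda>m. t j < S (Suc m) z"] by (simp add: m_def)
      then show ?thesis
        using Suc by simp
    qed
    have "\<not> S m z < t j"
    proof
      assume "S m z < t j"
      then have "z \<in> W j m"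
        using z m(1) unfolding W_def by blast
      then show False
        using zV m(2) unfolding V_def by blast
    qed
    then have eq: "S m z = t j"
      using Sm by simp
    moreover have "m \<noteq> 0"
    proof
      assume "m = 0"
      then show False
        using eq t01(1)[of j] by (simp add: S_def)
    qed
    moreover have "\<rho> m z > 0"
      using m(1) eq S_Suc[of m z] by simp
    ultimately show ?thesis
      using m(2) by (intro bexI[of _ m]) simp_all
  qed
  have card_missed: "card {j. j \<le> N \<and> z \<notin> V j} \<le> card M"
    if z: "z \<in> topspace (RP2 n)" and M: "finite M" "\<And>m. m \<in> {1..k} \<Longrightarrow> \<rho> m z > 0 \<Longrightarrow> m \<in> M" for z M
  \<comment> \<open>A break point determines the test value that it hits, so the misses are counted
    by the indices of positive weight.\<close>
  proof (rule surj_card_le[OF M(1)])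
    show "{j. j \<le> N \<and> z \<notin> V j} \<subseteq> (\<lambda>m. THE j. t j = S m z) ` M"
    proof
      fix j assume "j \<in> {j. j \<le> N \<and> z \<notin> V j}"
      then obtain m where m: "m \<in> {1..k}" "\<rho> m z > 0" "S m z = t j"
        using missed[OF z] by blast
      have "(THE j. t j = S m z) = j"
      proof (rule the_equality)
        show "t j = S m z"
          using m(3) by simp
        show "j' = j" if "t j' = S m z" for j'
          using that m(3) by (intro t_inj) simp
      qed
      then show "j \<in> (\<lambda>m. THE j. t j = S m z) ` M"
        using M(2)[OF m(1,2)] by (intro image_eqI) simp_all
    qed
  qed
  have bb: "(b, b) \<in> topspace (RP2 n)"
    using b by simp
  have bb_V: "(b, b) \<in> V j" if j: "j \<le> N" for j
  proof (rule ccontr)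
    assume "(b, b) \<notin> V j"
    then obtain m where m: "m \<in> {1..k}" "\<rho> m (b, b) > 0"
      using missed[OF bb j] by blast
    then have "m \<le> k" "m > 0" by simp_all
    then show False
      using Ub \<rho>(2)[OF _ bb] m(2) by blast
  qed
  have g_b: "g j (b, b) t = b" if j: "j \<le> N" for j t
  proof -
    obtain i where i: "i \<in> {..k}" "(b, b) \<in> W j i"
      using bb_V[OF j] unfolding V_def by blast
    then have "i = 0"
      using W_U[of i j] Ub[of i] by (metis atMost_iff gr0I subsetD)
    moreover have "g j (b, b) = h i (b, b)"
      using conjunct2[OF g[of j]] i by blast
    ultimately show ?thesis
      using hb by simp
  qed
  have c_all: "card {j. j \<le> N \<and> z \<notin> V j} \<le> k" if "z \<in> topspace (RP2 n)" for z
    using card_missed[OF that, of "{1..k}"] by simp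
  have c_wedge: "card {j. j \<le> N \<and> z \<notin> V j} \<le> n" if z: "z \<in> topspace (RP2 n)" "\<And>i. i \<le> k \<Longrightarrow> i > n \<Longrightarrow> z \<notin> U i" for z
  proof -
    have "m \<in> {1..n}" if m: "m \<in> {1..k}" "\<rho> m z > 0" for m
    proof -
      have "m \<le> k" "m \<ge> 1"
        using m(1) by simp_all
      then have "z \<in> U m"
        using \<rho>(2)[OF _ z(1)] m(2) by blast
      then show ?thesis
        using z(2)[OF \<open>m \<le> k\<close>] \<open>m \<ge> 1\<close> by (meson atLeastAtMost_iff not_le)
    qed
    then show ?thesis
      using card_missed[OF z(1), of "{1..n}"] by simp
  qed
  have c_l: "card {j. j \<le> N \<and> (p, b) \<notin> V j} \<le> n" if p: "p \<in> topspace (RP n)" for p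
  proof (rule c_wedge)
    show "(p, b) \<in> topspace (RP2 n)"
      using p b by (simp only: topspace_prod_topology mem_Sigma_iff simp_thms)
    show "\<And>i. i \<le> k \<Longrightarrow> i > n \<Longrightarrow> (p, b) \<notin> U i"
      using wedge p by blast
  qed
  have c_r: "card {j. j \<le> N \<and> (b, p) \<notin> V j} \<le> n" if p: "p \<in> topspace (RP n)" for p
  proof (rule c_wedge)
    show "(b, p) \<in> topspace (RP2 n)"
      using p b by (simp only: topspace_prod_topology mem_Sigma_iff simp_thms)
    show "\<And>i. i \<le> k \<Longrightarrow> i > n \<Longrightarrow> (b, p) \<notin> U i"
      using wedge p by blast
  qed
  show ?thesis
    by (intro exI[of _ V] exI[of _ g] conjI allI impI ballI V_open conjunct1[OF g] bb_V g_b c_all c_l c_r)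
qed

section \<open>Polyhedral products\<close>

text \<open>Waiting until time \<open>1/2 - \<tau> (fst z)\<close> and arriving at time \<open>1/2 + \<tau> (snd z)\<close>, where \<open>\<tau>\<close> vanishes only at
  the base point; if both summands vanish the quotient has the value \<open>0\<close>, which is harmless because the
  planned motion is constant there.\<close>

definition stop_and_go :: "('a \<Rightarrow> real) \<Rightarrow> 'a \<times> 'a \<Rightarrow> real \<Rightarrow> real" where
  "stop_and_go \<tau> z u = max 0 (min 1 ((u - 1/2 + \<tau> (fst z)) / (\<tau> (fst z) + \<tau> (snd z))))"

lemma stop_and_go_bounds: "stop_and_go \<tau> z u \<in> {0..1}"
  by (simp add: stop_and_go_def)

lemma stop_and_go_early:
  assumes "u - 1/2 + \<tau> (fst z) \<le> 0" "\<tau> (fst z) \<ge> 0" "\<tau> (snd z) \<ge> 0"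
  shows "stop_and_go \<tau> z u = 0"
proof -
  have "(u - 1/2 + \<tau> (fst z)) / (\<tau> (fst z) + \<tau> (snd z)) \<le> 0"
    using assms by (intro divide_nonpos_nonneg) simp_all
  then show ?thesis by (simp add: stop_and_go_def)
qed

lemma stop_and_go_late:
  assumes "u - 1/2 \<ge> \<tau> (snd z)" "\<tau> (fst z) + \<tau> (snd z) > 0"
  shows "stop_and_go \<tau> z u = 1"
proof -
  have "(u - 1/2 + \<tau> (fst z)) / (\<tau> (fst z) + \<tau> (snd z)) \<ge> 1"
    using assms by (simp add: le_divide_eq)
  then show ?thesis by (simp add: stop_and_go_def)
qed

text \<open>Away from \<open>(b, b)\<close> the denominator is positive and the formula is a
  composition of continuous maps. At \<open>(b, b)\<close> the new time may jump, but
  \<open>g\<close> sends the whole slice over \<open>(b, b)\<close> to \<open>b\<close>, and the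
  tube lemma controls the nearby slices at all times at once.\<close>

lemma continuous_map_stop_and_go:
  assumes g: "motion_planner X V g" and V: "openin (prod_topology X X) V"
    and gb: "\<And>t. g (b, b) t = b"
    and \<tau>: "continuous_map X euclideanreal \<tau>" "\<And>x. x \<in> topspace X \<Longrightarrow> \<tau> x \<ge> 0"
      "\<And>x. x \<in> topspace X \<Longrightarrow> \<tau> x = 0 \<longleftrightarrow> x = b"
  shows "continuous_map (prod_topology (subtopology (prod_topology X X) V) II) X
           (\<lambda>(z, u). g z (stop_and_go \<tau> z u))"
proof -
  let ?V = "subtopology (prod_topology X X) V"
  have gc: "continuous_map (prod_topology ?V II) X (\<lambda>(z, t). g z t)"
    using g by (simp add: motion_planner_def)
  have Vtop: "V \<subseteq> topspace (prod_topology X X)"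
    using V by (rule openin_subset)
  then have topV: "topspace ?V = V" by (simp add: Int_absorb1)
  define T where "T = (\<lambda>z. \<tau> (fst z) + \<tau> (snd z))"
  have \<tau>f: "continuous_map (prod_topology X X) euclideanreal (\<lambda>z. \<tau> (fst z))"
    and \<tau>s: "continuous_map (prod_topology X X) euclideanreal (\<lambda>z. \<tau> (snd z))"
    using continuous_map_compose[OF continuous_map_fst \<tau>(1), of X]
      continuous_map_compose[OF continuous_map_snd \<tau>(1), of X] by (simp_all only: o_def)
  then have Tc: "continuous_map (prod_topology X X) euclideanreal T"
    unfolding T_def by (intro continuous_map_add)
  define V0 where "V0 = V \<inter> {z \<in> topspace (prod_topology X X). T z \<in> {0<..}}"
  have V0: "openin (prod_topology X X) V0"
    unfolding V0_def using V Tc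
    by (intro openin_Int openin_continuous_map_preimage[of _ euclideanreal]) simp_all
  have V0V: "V0 \<subseteq> V"
    unfolding V0_def by (rule Int_lower1)
  have not_V0: "z = (b, b)" if "z \<in> V" "z \<notin> V0" for z
  proof -
    have z: "fst z \<in> topspace X" "snd z \<in> topspace X"
      using that(1) Vtop by (auto simp: mem_Times_iff)
    have "T z \<le> 0"
      using that Vtop unfolding V0_def by auto
    then have "\<tau> (fst z) = 0" "\<tau> (snd z) = 0"
      using \<tau>(2)[OF z(1)] \<tau>(2)[OF z(2)] unfolding T_def by linarith+
    then show ?thesis
      using \<tau>(3)[OF z(1)] \<tau>(3)[OF z(2)] by (simp add: prod_eq_iff)
  qed
  let ?Z = "prod_topology (subtopology (prod_topology X X) V0) II"
  have Q0: "continuous_map ?Z X (\<lambda>(z, u). g z (stop_and_go \<tau> z u))"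
  proof -
    have p1: "continuous_map ?Z (prod_topology X X) fst"
      using continuous_map_fst[of "subtopology (prod_topology X X) V0" II]
      by (simp add: continuous_map_in_subtopology)
    have p2: "continuous_map ?Z euclideanreal snd"
      using continuous_map_snd[of "subtopology (prod_topology X X) V0" II]
      by (simp add: continuous_map_in_subtopology)
    have f1: "continuous_map ?Z euclideanreal (\<lambda>y. \<tau> (fst (fst y)))"
      using continuous_map_compose[OF p1 \<tau>f] by (simp only: o_def)
    have f2: "continuous_map ?Z euclideanreal (\<lambda>y. \<tau> (snd (fst y)))"
      using continuous_map_compose[OF p1 \<tau>s] by (simp only: o_def)
    have "continuous_map ?Z euclideanreal (\<lambda>y. stop_and_go \<tau> (fst y) (snd y))"
      unfolding stop_and_go_def
    proof (intro continuous_map_real_max continuous_map_real_min continuous_map_canonical_const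
        continuous_map_real_divide continuous_map_add continuous_map_diff p2 f1 f2)
      fix y assume "y \<in> topspace ?Z"
      then have "fst y \<in> V0" by auto
      then show "\<tau> (fst (fst y)) + \<tau> (snd (fst y)) \<noteq> 0"
        by (auto simp: V0_def T_def)
    qed
    then have "continuous_map ?Z II (\<lambda>y. stop_and_go \<tau> (fst y) (snd y))"
      unfolding continuous_map_in_subtopology by (intro conjI funcsetI stop_and_go_bounds)
    moreover have "continuous_map ?Z ?V fst"
      using p1 V0V by (auto simp: continuous_map_in_subtopology)
    ultimately have "continuous_map ?Z (prod_topology ?V II) (\<lambda>y. (fst y, stop_and_go \<tau> (fst y) (snd y)))"
      by (rule continuous_map_pairedI[rotated])
    from continuous_map_compose[OF this gc] show ?thesis
      by (simp only: o_def case_prod_beta' fst_conv snd_conv)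
  qed
  have gV: "g z t \<in> topspace X" if "z \<in> V" "t \<in> {0..1}" for z t
    using continuous_map_funspace[OF gc] that topV by (auto simp: Pi_iff)
  show ?thesis
    unfolding continuous_map_def
  proof (intro conjI allI impI)
    show "(\<lambda>(z, u). g z (stop_and_go \<tau> z u)) \<in> topspace (prod_topology ?V II) \<rightarrow> topspace X"
    proof (rule funcsetI)
      fix y assume y: "y \<in> topspace (prod_topology ?V II)"
      then have "fst y \<in> V"
        using topV by (simp only: topspace_prod_topology mem_Times_iff simp_thms)
      then show "(\<lambda>(z, u). g z (stop_and_go \<tau> z u)) y \<in> topspace X"
        unfolding case_prod_beta' using stop_and_go_bounds by (rule gV)
    qed
    fix A assume A: "openin X A"
    let ?P = "{y \<in> topspace (prod_topology ?V II). (\<lambda>(z, u). g z (stop_and_go \<tau> z u)) y \<in> A}"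
    show "openin (prod_topology ?V II) ?P"
    proof (subst openin_subopen, intro ballI)
      fix y assume y: "y \<in> ?P"
      obtain z u where zu: "y = (z, u)"
        by (cases y)
      have z: "z \<in> V" "u \<in> {0..1}" "g z (stop_and_go \<tau> z u) \<in> A"
        using y topV by (simp_all add: zu)
      show "\<exists>B. openin (prod_topology ?V II) B \<and> y \<in> B \<and> B \<subseteq> ?P"
      proof (cases "z \<in> V0")
        case True
        define B where "B = {y \<in> topspace ?Z. (\<lambda>(z, u). g z (stop_and_go \<tau> z u)) y \<in> A}"
        have B_Z: "openin ?Z B"
          unfolding B_def using Q0 A by (rule openin_continuous_map_preimage)
        have Z_eq: "?Z = subtopology (prod_topology ?V II) (V0 \<times> topspace II)"
          by (rule subtopology_prod_left[OF V0V, symmetric])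
        have "openin ?V V0"
          unfolding openin_subtopology using V0 V0V by (intro exI[of _ V0] conjI) auto
        then have "openin (prod_topology ?V II) (V0 \<times> topspace II)"
          by (simp only: openin_prod_Times_iff openin_topspace simp_thms)
        with B_Z[unfolded Z_eq] have "openin (prod_topology ?V II) B"
          by (rule openin_trans_full)
        moreover have topZ: "topspace ?Z = V0 \<times> {0..1}"
          using openin_subset[OF V0] by (simp add: Int_absorb1)
        then have "y \<in> B"
          unfolding B_def zu using True z(2,3) by simp
        moreover have "B \<subseteq> ?P"
        proof
          fix y' assume "y' \<in> B"
          then have y': "y' \<in> V0 \<times> {0..1}" "(\<lambda>(z, u). g z (stop_and_go \<tau> z u)) y' \<in> A"
            unfolding B_def topZ by blast+
          then have "y' \<in> topspace (prod_topology ?V II)"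
            unfolding topspace_prod_topology topV using V0V by auto
          then show "y' \<in> ?P"
            using y'(2) by blast
        qed
        ultimately show ?thesis by (intro exI[of _ B] conjI)
      next
        case False
        then have zb: "z = (b, b)"
          using not_V0 z(1) by blast
        then have bA: "b \<in> A"
          using z(3) gb by simp
        have op: "openin (prod_topology ?V II) {y \<in> topspace (prod_topology ?V II). (\<lambda>(z, t). g z t) y \<in> A}"
          using gc A by (rule openin_continuous_map_preimage)
        have "compactin II {0..1}" by (simp add: compactin_subtopology)
        moreover have "z \<in> topspace ?V"
          using z(1) topV by simp
        moreover have "{z} \<times> {0..1} \<subseteq> {y \<in> topspace (prod_topology ?V II). (\<lambda>(z, t). g z t) y \<in> A}"
        proof
          fix y' assume "y' \<in> {z} \<times> {0..1::real}"
          then obtain u' where u': "y' = (z, u')" "u' \<in> {0..1}"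
            by blast
          have "g z u' = b"
            unfolding zb by (rule gb)
          then show "y' \<in> {y \<in> topspace (prod_topology ?V II). (\<lambda>(z, t). g z t) y \<in> A}"
            using u'(2) bA z(1) topV unfolding u'(1) by simp
        qed
        ultimately have "\<exists>N M. openin ?V N \<and> openin II M \<and> z \<in> N \<and> {0..1} \<subseteq> M \<and>
          N \<times> M \<subseteq> {y \<in> topspace (prod_topology ?V II). (\<lambda>(z, t). g z t) y \<in> A}"
          by (rule tube_lemma_right[OF op])
        then obtain N M where N: "openin ?V N" "z \<in> N" "{0..1} \<subseteq> M"
          "N \<times> M \<subseteq> {y \<in> topspace (prod_topology ?V II). (\<lambda>(z, t). g z t) y \<in> A}"
          by (elim exE conjE) (rule that)
        have "openin (prod_topology ?V II) (N \<times> topspace II)"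
          using N(1) by (simp only: openin_prod_Times_iff openin_topspace simp_thms)
        moreover have "y \<in> N \<times> topspace II"
          using N(2) z(2) by (simp add: zu)
        moreover have "N \<times> topspace II \<subseteq> ?P"
        proof
          fix y' assume y': "y' \<in> N \<times> topspace II"
          obtain z' u' where zu': "y' = (z', u')"
            by (cases y')
          have z': "z' \<in> N" "u' \<in> {0..1}"
            using y' by (simp_all add: zu')
          have "stop_and_go \<tau> z' u' \<in> M"
            using N(3) stop_and_go_bounds by blast
          then have "(z', stop_and_go \<tau> z' u') \<in> {y \<in> topspace (prod_topology ?V II). (\<lambda>(z, t). g z t) y \<in> A}"
            using z'(1) by (intro subsetD[OF N(4)]) simp
          then show "y' \<in> ?P"
            using z'(2) by (simp add: zu')
        qed
        ultimately show ?thesis by (intro exI[of _ "N \<times> topspace II"] conjI)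
      qed
    qed
  qed
qed

section \<open>Assembly and counting in the polyhedral product\<close>

lemma TC_le_of_planners:
  fixes N :: nat
  assumes "\<And>j. j \<le> N \<Longrightarrow> openin (prod_topology X X) (W j)"
    and "\<And>j. j \<le> N \<Longrightarrow> \<exists>h. motion_planner X (W j) h"
    and "topspace (prod_topology X X) \<subseteq> (\<Union>j\<le>N. W j)"
  shows "TC X \<le> enat N"
proof -
  have sub: "W j \<subseteq> topspace (prod_topology X X)" if "j \<le> N" for j
    using assms(1)[OF that] by (rule openin_subset)
  have "has_local_section X (W j)" if "j \<le> N" for j
    using has_local_section_iff_motion_planner[OF sub[OF that]] assms(2)[OF that] by blast
  moreover have "(\<Union>j\<le>N. W j) = topspace (prod_topology X X)"
    using assms(3) sub by (intro equalityI UN_least) simp_all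
  ultimately show ?thesis
    unfolding TC_def using assms(1) by (intro Inf_lower) blast
qed

text \<open>A finite infimum of extended natural numbers is attained; an empty set of candidates
  would have infimum \<infinity>.\<close>

lemma planners_of_TC_eq_enat:
  fixes X :: "'a topology"
  assumes "TC X = enat k"
  shows "\<exists>U h. (\<forall>i\<le>k. openin (prod_topology X X) (U i) \<and> motion_planner X (U i) (h i)) \<and>
    topspace (prod_topology X X) \<subseteq> (\<Union>i\<le>k. U i)"
proof -
  define P where "P = (\<lambda>n. \<exists>U :: nat \<Rightarrow> ('a \<times> 'a) set.
       (\<forall>i\<le>n. openin (prod_topology X X) (U i) \<and> has_local_section X (U i)) \<and>
       (\<Union>i\<le>n. U i) = topspace (prod_topology X X))"
  define A where "A = {enat n | n. P n}"
  have TC_A: "TC X = Inf A"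
    unfolding A_def P_def by (rule TC_def)
  have "A \<noteq> {}"
  proof
    assume "A = {}"
    then have "TC X = \<infinity>"
      unfolding TC_A by (simp add: top_enat_def)
    then show False
      using assms by simp
  qed
  then have "Inf A \<in> A" by (metis ex_in_conv wellorder_InfI)
  then have "enat k \<in> A"
    using assms TC_A by (simp only:)
  then have "P k"
    unfolding A_def by blast
  then obtain U where U: "\<And>i. i \<le> k \<Longrightarrow> openin (prod_topology X X) (U i)"
      "\<And>i. i \<le> k \<Longrightarrow> has_local_section X (U i)" "(\<Union>i\<le>k. U i) = topspace (prod_topology X X)"
    unfolding P_def by blast
  define h where "h = (\<lambda>i. SOME h. motion_planner X (U i) h)"
  have "motion_planner X (U i) (h i)" if "i \<le> k" for i
  proof -
    have "\<exists>h. motion_planner X (U i) h"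
      using has_local_section_iff_motion_planner[OF openin_subset[OF U(1)[OF that]]] U(2)[OF that] by blast
    then show ?thesis
      unfolding h_def by (rule someI_ex)
  qed
  then show ?thesis
    using U(1,3) by (intro exI[of _ U] exI[of _ h] conjI allI impI) simp_all
qed

text \<open>With \<open>\<tau> i\<close> at most 1/2 all departure and arrival times lie in the unit
  interval. Up to time 1/2 the motion stays in a piece P^\<sigma> containing the start, afterwards
  in one containing the end.\<close>

lemma TC_polyhedral_product_le:
  fixes X :: "'i \<Rightarrow> 'a topology" and D d :: "'i \<Rightarrow> nat" and N :: nat
  assumes I: "finite I" and K: "abstract_simplicial_complex I K"
    and V: "\<And>i j. i \<in> I \<Longrightarrow> j \<le> N \<Longrightarrow> openin (prod_topology (X i) (X i)) (V i j)"
    and g: "\<And>i j. i \<in> I \<Longrightarrow> j \<le> N \<Longrightarrow> motion_planner (X i) (V i j) (g i j)"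
    and Vb: "\<And>i j. i \<in> I \<Longrightarrow> j \<le> N \<Longrightarrow> (b i, b i) \<in> V i j"
    and gb: "\<And>i j t. i \<in> I \<Longrightarrow> j \<le> N \<Longrightarrow> g i j (b i, b i) t = b i"
    and D: "\<And>i z. i \<in> I \<Longrightarrow> z \<in> topspace (prod_topology (X i) (X i)) \<Longrightarrow> card {j. j \<le> N \<and> z \<notin> V i j} \<le> D i"
    and d: "\<And>i p. i \<in> I \<Longrightarrow> p \<in> topspace (X i) \<Longrightarrow> card {j. j \<le> N \<and> (p, b i) \<notin> V i j} \<le> d i"
      "\<And>i p. i \<in> I \<Longrightarrow> p \<in> topspace (X i) \<Longrightarrow> card {j. j \<le> N \<and> (b i, p) \<notin> V i j} \<le> d i"
    and \<tau>: "\<And>i. i \<in> I \<Longrightarrow> continuous_map (X i) euclideanreal (\<tau> i)"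
      "\<And>i x. i \<in> I \<Longrightarrow> x \<in> topspace (X i) \<Longrightarrow> 0 \<le> \<tau> i x \<and> \<tau> i x \<le> 1/2 \<and> (\<tau> i x = 0 \<longleftrightarrow> x = b i)"
    and N: "\<And>\<sigma>1 \<sigma>2. \<sigma>1 \<in> K \<Longrightarrow> \<sigma>2 \<in> K \<Longrightarrow>
      (\<Sum>i\<in>(\<sigma>1 - \<sigma>2) \<union> (\<sigma>2 - \<sigma>1). d i) + (\<Sum>i\<in>\<sigma>1 \<inter> \<sigma>2. D i) \<le> N"
  shows "TC (polyhedral_product I X b K) \<le> enat N"
proof -
  let ?P = "polyhedral_product I X b K"
  let ?C = "\<lambda>\<sigma>. \<Pi>\<^sub>E i\<in>I. if i \<in> \<sigma> then topspace (X i) else {b i}"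
  have b: "b i \<in> topspace (X i)" if "i \<in> I" for i
    using openin_subset[OF V[OF that le0]] Vb[OF that le0] by auto
  have C_sub: "?C \<sigma> \<subseteq> (\<Pi>\<^sub>E i\<in>I. topspace (X i))" for \<sigma>
    using b by (intro PiE_mono) auto
  have top_P: "topspace ?P = (\<Union>\<sigma>\<in>K. ?C \<sigma>)"
    unfolding polyhedral_product_def using C_sub by (auto simp: Int_absorb1 UN_subset_iff)
  have proj: "continuous_map ?P (X i) (\<lambda>x. x i)" if "i \<in> I" for i
    unfolding polyhedral_product_def using that
    by (intro continuous_map_from_subtopology continuous_map_product_projection)
  have proj2: "continuous_map (prod_topology ?P ?P) (prod_topology (X i) (X i)) (\<lambda>z. (fst z i, snd z i))" if "i \<in> I" for i
    using continuous_map_compose[OF continuous_map_fst proj[OF that], of ?P]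
      continuous_map_compose[OF continuous_map_snd proj[OF that], of ?P]
    by (intro continuous_map_pairedI) (simp_all only: o_def)
  define W where "W = (\<lambda>j. {z \<in> topspace (prod_topology ?P ?P). \<forall>i\<in>I. (fst z i, snd z i) \<in> V i j})"
  have W_open: "openin (prod_topology ?P ?P) (W j)" if j: "j \<le> N" for j
  \<comment> \<open>An intersection over the empty family would be \<open>UNIV\<close> instead of
    the whole space.\<close>
  proof (cases "I = {}")
    case True
    then have "W j = topspace (prod_topology ?P ?P)"
      unfolding W_def by blast
    then show ?thesis by (simp only: openin_topspace)
  next
    case False
    have "W j = (\<Inter>i\<in>I. {z \<in> topspace (prod_topology ?P ?P). (fst z i, snd z i) \<in> V i j})"
      using False unfolding W_def by blast
    moreover have "openin (prod_topology ?P ?P) {z \<in> topspace (prod_topology ?P ?P). (fst z i, snd z i) \<in> V i j}"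
      if "i \<in> I" for i
      using proj2[OF that] V[OF that j] by (rule openin_continuous_map_preimage)
    ultimately show ?thesis
      using I False by (simp only:) (intro openin_INT2, simp_all)
  qed
  define r where "r = (\<lambda>i z u. stop_and_go (\<tau> i) (fst z i, snd z i) u)"
  define H where "H = (\<lambda>j z u. \<lambda>i\<in>I. g i j (fst z i, snd z i) (r i z u))"
  have H_planner: "motion_planner ?P (W j) (H j)" if j: "j \<le> N" for j
  proof -
    let ?Y = "prod_topology (subtopology (prod_topology ?P ?P) (W j)) II"
    have Wtop: "W j \<subseteq> topspace (prod_topology ?P ?P)"
      using W_open[OF j] by (rule openin_subset)
    have comp: "continuous_map ?Y (X i) (\<lambda>y. g i j (fst (fst y) i, snd (fst y) i) (r i (fst y) (snd y)))" if i: "i \<in> I" for i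
    proof -
      have "continuous_map (subtopology (prod_topology ?P ?P) (W j)) (subtopology (prod_topology (X i) (X i)) (V i j)) (\<lambda>z. (fst z i, snd z i))"
        using continuous_map_from_subtopology[OF proj2[OF i], of "W j"] i
        unfolding continuous_map_in_subtopology by (auto simp: W_def)
      from continuous_map_compose[OF continuous_map_fst this, of II]
      have "continuous_map ?Y (subtopology (prod_topology (X i) (X i)) (V i j)) (\<lambda>y. (fst (fst y) i, snd (fst y) i))"
        by (simp only: o_def)
      then have 1: "continuous_map ?Y (prod_topology (subtopology (prod_topology (X i) (X i)) (V i j)) II)
          (\<lambda>y. ((fst (fst y) i, snd (fst y) i), snd y))"
        by (intro continuous_map_pairedI continuous_map_snd)
      have 2: "continuous_map (prod_topology (subtopology (prod_topology (X i) (X i)) (V i j)) II) (X i)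
          (\<lambda>(z, u). g i j z (stop_and_go (\<tau> i) z u))"
        using g[OF i j] V[OF i j] gb[OF i j] \<tau>(1)[OF i] \<tau>(2)[OF i]
        by (intro continuous_map_stop_and_go[where b = "b i"]) simp_all
      from continuous_map_compose[OF 1 2] show ?thesis
        by (simp only: o_def case_prod_beta' fst_conv snd_conv r_def)
    qed
    have zW: "z \<in> topspace (prod_topology ?P ?P) \<and> (\<forall>i\<in>I. (fst z i, snd z i) \<in> V i j)" if "z \<in> W j" for z
      using that unfolding W_def by blast
    have in_X: "x i \<in> topspace (X i)" if "x \<in> topspace ?P" "i \<in> I" for x i
      using continuous_map_funspace[OF proj[OF that(2)]] that(1) by blast
    have in_X2: "fst z i \<in> topspace (X i)" "snd z i \<in> topspace (X i)" if "z \<in> W j" "i \<in> I" for z i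
      using zW[OF that(1)] in_X that(2) by (simp_all add: mem_Times_iff)
    have ends: "g i j (fst z i, snd z i) 0 = fst z i" "g i j (fst z i, snd z i) 1 = snd z i" if z: "z \<in> W j" and i: "i \<in> I" for z i
    proof -
      have "(fst z i, snd z i) \<in> topspace (prod_topology (X i) (X i)) \<inter> V i j"
        using in_X2[OF z i] zW[OF z] i by simp
      then show "g i j (fst z i, snd z i) 0 = fst z i" "g i j (fst z i, snd z i) 1 = snd z i"
        using g[OF i j] unfolding motion_planner_def by (metis fst_conv, metis snd_conv)
    qed
    have early: "g i j (fst z i, snd z i) (r i z u) = b i"
      if z: "z \<in> W j" and i: "i \<in> I" and u: "u \<le> 1/2" and e: "fst z i = b i" for z i u
    proof -
      have "\<tau> i (b i) = 0"
        using \<tau>(2)[OF i b[OF i]] by simp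
      then have "r i z u = 0"
        unfolding r_def using u e \<tau>(2)[OF i in_X2(2)[OF z i]] by (intro stop_and_go_early) simp_all
      then show ?thesis
        using ends(1)[OF z i] e by simp
    qed
    have late: "g i j (fst z i, snd z i) (r i z u) = b i"
      if z: "z \<in> W j" and i: "i \<in> I" and u: "u \<ge> 1/2" and e: "snd z i = b i" for z i u
    \<comment> \<open>With both ends at the base point the denominator is 0 and the reparametrised
      time is 0 instead of 1; constancy of the planner gives the claim.\<close>
    proof (cases "fst z i = b i")
      case True
      then show ?thesis
        using gb[OF i j] e by simp
    next
      case False
      have "\<tau> i (b i) = 0"
        using \<tau>(2)[OF i b[OF i]] by simp
      moreover have "\<tau> i (fst z i) > 0"
        using \<tau>(2)[OF i in_X2(1)[OF z i]] False by linarith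
      ultimately have "r i z u = 1"
        unfolding r_def using u e by (intro stop_and_go_late) simp_all
      then show ?thesis
        using ends(2)[OF z i] e by simp
    qed
    have H_in_C: "H j z u \<in> (\<Union>\<sigma>\<in>K. ?C \<sigma>)" if z: "z \<in> W j" and u: "u \<in> {0..1}" for z u
    proof -
      have zP: "fst z \<in> (\<Union>\<sigma>\<in>K. ?C \<sigma>)" "snd z \<in> (\<Union>\<sigma>\<in>K. ?C \<sigma>)"
        using zW[OF z] unfolding topspace_prod_topology mem_Times_iff top_P by simp_all
      have Hi: "H j z u i \<in> topspace (X i)" if i: "i \<in> I" for i
      proof -
        have "(z, u) \<in> topspace ?Y"
          using z u Wtop by auto
        from continuous_map_funspace[OF comp[OF i]] this show ?thesis
          using i by (auto simp: Pi_iff H_def)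
      qed
      have ext: "H j z u \<in> extensional I" by (simp add: H_def)
      show ?thesis
      proof (cases "u \<le> 1/2")
        case True
        obtain \<sigma> where \<sigma>: "\<sigma> \<in> K" "fst z \<in> ?C \<sigma>"
          using zP(1) by blast
        have "H j z u \<in> ?C \<sigma>"
        proof (rule PiE_I)
          fix i assume i: "i \<in> I"
          show "H j z u i \<in> (if i \<in> \<sigma> then topspace (X i) else {b i})"
          proof (cases "i \<in> \<sigma>")
            case True
            then show ?thesis
              using Hi[OF i] by simp
          next
            case False
            then have "fst z i = b i"
              using PiE_mem[OF \<sigma>(2) i] by simp
            then show ?thesis
              using False early[OF z i \<open>u \<le> 1/2\<close>] i by (simp add: H_def)
          qed
        qed (simp add: H_def)
        then show ?thesis
          using \<sigma>(1) by blast
      next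
        case u2: False
        obtain \<sigma> where \<sigma>: "\<sigma> \<in> K" "snd z \<in> ?C \<sigma>"
          using zP(2) by blast
        have "H j z u \<in> ?C \<sigma>"
        proof (rule PiE_I)
          fix i assume i: "i \<in> I"
          show "H j z u i \<in> (if i \<in> \<sigma> then topspace (X i) else {b i})"
          proof (cases "i \<in> \<sigma>")
            case True
            then show ?thesis
              using Hi[OF i] by simp
          next
            case False
            then have "snd z i = b i"
              using PiE_mem[OF \<sigma>(2) i] by simp
            then show ?thesis
              using False late[OF z i] u2 i by (simp add: H_def)
          qed
        qed (simp add: H_def)
        then show ?thesis
          using \<sigma>(1) by blast
      qed
    qed
    have "continuous_map ?Y (product_topology X I) (\<lambda>y. H j (fst y) (snd y))"
      unfolding continuous_map_componentwise
    proof (intro conjI ballI)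
      show "(\<lambda>y. H j (fst y) (snd y)) ` topspace ?Y \<subseteq> extensional I"
        by (rule image_subsetI) (simp add: H_def)
      show "continuous_map ?Y (X i) (\<lambda>y. H j (fst y) (snd y) i)" if "i \<in> I" for i
        using comp[OF that] that by (simp add: H_def)
    qed
    then have "continuous_map ?Y ?P (\<lambda>y. H j (fst y) (snd y))"
      unfolding polyhedral_product_def continuous_map_in_subtopology
    proof (intro conjI funcsetI)
      fix y assume "y \<in> topspace (prod_topology (subtopology (prod_topology
          (subtopology (product_topology X I) (\<Union>\<sigma>\<in>K. ?C \<sigma>))
          (subtopology (product_topology X I) (\<Union>\<sigma>\<in>K. ?C \<sigma>))) (W j)) II)"
      then have "fst y \<in> W j" "snd y \<in> {0..1}" by auto
      then show "H j (fst y) (snd y) \<in> (\<Union>\<sigma>\<in>K. ?C \<sigma>)" by (rule H_in_C)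
    qed
    moreover have "H j z 0 = fst z \<and> H j z 1 = snd z" if "z \<in> topspace (prod_topology ?P ?P) \<inter> W j" for z
    proof -
      have z: "z \<in> W j"
        using that by blast
      have ex: "fst z \<in> extensional I" "snd z \<in> extensional I"
        using zW[OF z] unfolding topspace_prod_topology mem_Times_iff top_P by (auto simp: PiE_def)
      have H0: "H j z 0 i = fst z i" and H1: "H j z 1 i = snd z i" if i: "i \<in> I" for i
      proof -
        have \<tau>i: "0 \<le> \<tau> i (fst z i)" "\<tau> i (fst z i) \<le> 1/2" "0 \<le> \<tau> i (snd z i)" "\<tau> i (snd z i) \<le> 1/2"
          using \<tau>(2)[OF i in_X2(1)[OF z i]] \<tau>(2)[OF i in_X2(2)[OF z i]] by simp_all
        have "r i z 0 = 0"
          unfolding r_def using \<tau>i by (intro stop_and_go_early) simp_all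
        then show "H j z 0 i = fst z i"
          using ends(1)[OF z i] i by (simp add: H_def)
        show "H j z 1 i = snd z i"
        proof (cases "snd z i = b i")
          case True
          then show ?thesis
            using late[OF z i, of 1] i by (simp add: H_def)
        next
          case False
          then have "\<tau> i (snd z i) > 0"
            using \<tau>(2)[OF i in_X2(2)[OF z i]] by linarith
          then have "r i z 1 = 1"
            unfolding r_def using \<tau>i by (intro stop_and_go_late) simp_all
          then show ?thesis
            using ends(2)[OF z i] i by (simp add: H_def)
        qed
      qed
      have "H j z 0 \<in> extensional I" "H j z 1 \<in> extensional I" by (simp_all add: H_def)
      then show ?thesis
        using ex H0 H1 by (intro conjI extensionalityI[of _ I]) simp_all
    qed
    ultimately show ?thesis
      unfolding motion_planner_def case_prod_beta' by blast
  qed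
  have "topspace (prod_topology ?P ?P) \<subseteq> (\<Union>j\<le>N. W j)"
  proof
    fix z assume z: "z \<in> topspace (prod_topology ?P ?P)"
    then have zP: "fst z \<in> (\<Union>\<sigma>\<in>K. ?C \<sigma>)" "snd z \<in> (\<Union>\<sigma>\<in>K. ?C \<sigma>)"
      unfolding topspace_prod_topology mem_Times_iff top_P by simp_all
    \<comment> \<open>Being contained in a face, the support of a point is itself a face. Using it
      in place of an arbitrary face containing it makes a coordinate at the base point visible to
      the finer count.\<close>
    have supp: "{i \<in> I. x i \<noteq> b i} \<in> K" if "x \<in> (\<Union>\<sigma>\<in>K. ?C \<sigma>)" for x
    proof -
      obtain \<sigma> where \<sigma>: "\<sigma> \<in> K" "x \<in> ?C \<sigma>"
        using \<open>x \<in> (\<Union>\<sigma>\<in>K. ?C \<sigma>)\<close> by blast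
      have "{i \<in> I. x i \<noteq> b i} \<subseteq> \<sigma>"
      proof clarify
        fix i assume i: "i \<in> I" "x i \<noteq> b i"
        show "i \<in> \<sigma>"
        proof (rule ccontr)
          assume "i \<notin> \<sigma>"
          then have "x i = b i"
            using PiE_mem[OF \<sigma>(2) i(1)] by simp
          then show False
            using i(2) by simp
        qed
      qed
      then show ?thesis
        using K \<sigma>(1) unfolding abstract_simplicial_complex_def by blast
    qed
    define \<sigma>1 where "\<sigma>1 = {i \<in> I. fst z i \<noteq> b i}"
    define \<sigma>2 where "\<sigma>2 = {i \<in> I. snd z i \<noteq> b i}"
    have \<sigma>K: "\<sigma>1 \<in> K" "\<sigma>2 \<in> K"
      unfolding \<sigma>1_def \<sigma>2_def using supp zP by blast+
    have \<sigma>I: "\<sigma>1 \<subseteq> I" "\<sigma>2 \<subseteq> I"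
      by (auto simp: \<sigma>1_def \<sigma>2_def)
    define M where "M = (\<lambda>i. {j. j \<le> N \<and> (fst z i, snd z i) \<notin> V i j})"
    have finM: "finite (M i)" for i by (simp add: M_def)
    have in_X: "fst z i \<in> topspace (X i)" "snd z i \<in> topspace (X i)" if "i \<in> I" for i
      using zP C_sub that by (blast dest: PiE_mem)+
    have M_le: "card (M i) \<le> (if i \<in> \<sigma>1 \<inter> \<sigma>2 then D i else if i \<in> (\<sigma>1 - \<sigma>2) \<union> (\<sigma>2 - \<sigma>1) then d i else 0)"
      if i: "i \<in> I" for i
    proof -
      consider "i \<in> \<sigma>1 \<inter> \<sigma>2" | "i \<in> \<sigma>1 - \<sigma>2" | "i \<in> \<sigma>2 - \<sigma>1" | "i \<notin> \<sigma>1" "i \<notin> \<sigma>2"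
        by blast
      then show ?thesis
      proof cases
        case 1
        have "card (M i) \<le> D i"
          unfolding M_def using in_X[OF i] by (intro D[OF i]) simp
        then show ?thesis
          using 1 by simp
      next
        case 2
        then have "snd z i = b i"
          using i by (simp add: \<sigma>2_def)
        then have "card (M i) \<le> d i"
          unfolding M_def using d(1)[OF i in_X(1)[OF i]] by simp
        then show ?thesis
          using 2 by simp
      next
        case 3
        then have "fst z i = b i"
          using i by (simp add: \<sigma>1_def)
        then have "card (M i) \<le> d i"
          unfolding M_def using d(2)[OF i in_X(2)[OF i]] by simp
        then show ?thesis
          using 3 by simp
      next
        case 4
        then have "fst z i = b i" "snd z i = b i"
          using i by (simp_all add: \<sigma>1_def \<sigma>2_def)
        then have "M i = {}"
          unfolding M_def using Vb[OF i] by simp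
        then show ?thesis by simp
      qed
    qed
    have "card (\<Union>i\<in>I. M i) \<le> (\<Sum>i\<in>I. card (M i))"
      by (rule card_UN_le[OF I])
    also have "\<dots> \<le> (\<Sum>i\<in>I. if i \<in> \<sigma>1 \<inter> \<sigma>2 then D i else if i \<in> (\<sigma>1 - \<sigma>2) \<union> (\<sigma>2 - \<sigma>1) then d i else 0)"
      by (intro sum_mono M_le)
    also have "\<dots> = (\<Sum>i\<in>I. (if i \<in> \<sigma>1 \<inter> \<sigma>2 then D i else 0)) + (\<Sum>i\<in>I. if i \<in> (\<sigma>1 - \<sigma>2) \<union> (\<sigma>2 - \<sigma>1) then d i else 0)"
      unfolding sum.distrib[symmetric] by (intro sum.cong refl) auto
    also have "\<dots> = (\<Sum>i\<in>\<sigma>1 \<inter> \<sigma>2. D i) + (\<Sum>i\<in>(\<sigma>1 - \<sigma>2) \<union> (\<sigma>2 - \<sigma>1). d i)"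
    proof -
      have "I \<inter> (\<sigma>1 \<inter> \<sigma>2) = \<sigma>1 \<inter> \<sigma>2" "I \<inter> ((\<sigma>1 - \<sigma>2) \<union> (\<sigma>2 - \<sigma>1)) = (\<sigma>1 - \<sigma>2) \<union> (\<sigma>2 - \<sigma>1)"
        using \<sigma>I by blast+
      then show ?thesis
        using sum.inter_restrict[OF I, of D "\<sigma>1 \<inter> \<sigma>2"] sum.inter_restrict[OF I, of d "(\<sigma>1 - \<sigma>2) \<union> (\<sigma>2 - \<sigma>1)"]
        by (simp only:)
    qed
    also have "\<dots> \<le> N"
      using N[OF \<sigma>K] by (simp only: add.commute)
    finally have "card (\<Union>i\<in>I. M i) < card {..N}" by simp
    moreover have "finite (\<Union>i\<in>I. M i)"
      using I finM by blast
    ultimately obtain j where j: "j \<in> {..N}" "j \<notin> (\<Union>i\<in>I. M i)"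
      by (metis card_mono not_le subsetI)
    then have "z \<in> W j"
      using z by (auto simp: W_def M_def)
    then show "z \<in> (\<Union>j\<le>N. W j)"
      using j(1) by blast
  qed
  note cover = this
  show ?thesis
  proof (rule TC_le_of_planners)
    show "\<exists>h. motion_planner ?P (W j) h" if "j \<le> N" for j
      using H_planner[OF that] by (rule exI[of "motion_planner ?P (W j)"])
  qed (rule W_open cover; assumption)+
qed

text \<open>\<open>\<tau>\<close> is half the squared sine of the angle to the base line, written
  through projection matrices so as to be well defined on P^n; the factor 1/2 gives the bound
  required of waiting times.\<close>

lemma base_distance:
  assumes "b \<in> sph n"
  shows "\<exists>\<tau>. continuous_map (RP n) euclideanreal \<tau> \<and>
    (\<forall>p\<in>topspace (RP n). 0 \<le> \<tau> p \<and> \<tau> p \<le> 1/2 \<and> (\<tau> p = (0::real) \<longleftrightarrow> p = cls b))"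
proof -
  define \<tau> where "\<tau> = (\<lambda>p. (1 - (\<Sum>i\<le>n. \<Sum>j\<le>n. kap p i j * (b i * b j))) / 2)"
  have "continuous_map (RP n) euclideanreal \<tau>"
    unfolding \<tau>_def
    by (intro continuous_map_real_divide continuous_map_diff continuous_map_canonical_const continuous_map_sum
        continuous_map_real_mult continuous_map_kap) simp_all
  moreover have "0 \<le> \<tau> p \<and> \<tau> p \<le> 1/2 \<and> (\<tau> p = 0 \<longleftrightarrow> p = cls b)" if p: "p \<in> topspace (RP n)" for p
  proof -
    obtain x where x: "p = cls x" "x \<in> sph n"
      using p unfolding topspace_RP by (rule imageE)
    have "\<tau> p = (1 - (ip n x b)\<^sup>2) / 2"
      unfolding \<tau>_def x(1) kap_ip[symmetric] kap_cls by (rule refl)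
    moreover have "p = cls b \<longleftrightarrow> (ip n x b)\<^sup>2 = 1"
      unfolding x(1) cls_eq_iff using ip_square_eq_1_iff[OF x(2) assms] by simp
    ultimately show ?thesis
      using ip_square_le_1[OF x(2) assms] by auto
  qed
  ultimately show ?thesis by blast
qed

lemma sum_enat: "finite A \<Longrightarrow> (\<Sum>i\<in>A. enat (f i)) = enat (\<Sum>i\<in>A. f i)"
  by (induction rule: finite_induct) (simp_all add: zero_enat_def)

theorem theorem1p7:
  fixes m :: nat and n :: "nat \<Rightarrow> nat"
    and b :: "nat \<Rightarrow> (nat \<Rightarrow> real) set"
    and K :: "nat set set"
  assumes "\<And>i. i \<in> {1..m} \<Longrightarrow> n i > 0"
    and "\<And>i. i \<in> {1..m} \<Longrightarrow> b i \<in> topspace (real_projective_space (n i))"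
    and "abstract_simplicial_complex {1..m} K"
  shows "TC (polyhedral_product {1..m} (\<lambda>i. real_projective_space (n i)) b K)
    \<le> Max {(\<Sum>i\<in>(\<sigma>1 - \<sigma>2) \<union> (\<sigma>2 - \<sigma>1). enat (n i)) +
            (\<Sum>i\<in>\<sigma>1 \<inter> \<sigma>2. TC (real_projective_space (n i))) | \<sigma>1 \<sigma>2. \<sigma>1 \<in> K \<and> \<sigma>2 \<in> K}"
proof -
  define c where "c = (\<lambda>\<sigma>1 \<sigma>2. (\<Sum>i\<in>(\<sigma>1 - \<sigma>2) \<union> (\<sigma>2 - \<sigma>1). enat (n i)) + (\<Sum>i\<in>\<sigma>1 \<inter> \<sigma>2. TC (RP (n i))))"
  let ?R = "Max {c \<sigma>1 \<sigma>2 | \<sigma>1 \<sigma>2. \<sigma>1 \<in> K \<and> \<sigma>2 \<in> K}"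
  have K_sub: "K \<subseteq> Pow {1..m}" and K_vertex: "\<And>i. i \<in> {1..m} \<Longrightarrow> {i} \<in> K"
    using assms(3) unfolding abstract_simplicial_complex_def by blast+
  have "finite K"
    using K_sub by (rule finite_subset) simp
  moreover have "{c \<sigma>1 \<sigma>2 | \<sigma>1 \<sigma>2. \<sigma>1 \<in> K \<and> \<sigma>2 \<in> K} = (\<lambda>(\<sigma>1, \<sigma>2). c \<sigma>1 \<sigma>2) ` (K \<times> K)"
    by auto
  ultimately have fin: "finite {c \<sigma>1 \<sigma>2 | \<sigma>1 \<sigma>2. \<sigma>1 \<in> K \<and> \<sigma>2 \<in> K}"
    by simp
  have c_le: "c \<sigma>1 \<sigma>2 \<le> ?R" if "\<sigma>1 \<in> K" "\<sigma>2 \<in> K" for \<sigma>1 \<sigma>2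
    using fin that by (intro Max_ge) blast+
  have "TC (polyhedral_product {1..m} (\<lambda>i. RP (n i)) b K) \<le> ?R"
  proof (cases ?R)
    case infinity
    then show ?thesis by simp
  next
    case (enat N)
    \<comment> \<open>\<open>N\<close> is the claimed bound itself. Taking both faces equal to
      \<open>{i}\<close> leaves only the term \<open>TC (RP (n i))\<close>, so finiteness of the
      bound makes every factor finite.\<close>
    have "TC (RP (n i)) \<le> enat N" if "i \<in> {1..m}" for i
      using c_le[OF K_vertex[OF that] K_vertex[OF that]] enat by (simp add: c_def)
    then have "\<exists>k. TC (RP (n i)) = enat k" if "i \<in> {1..m}" for i
      using that by (meson enat_ile)
    then obtain D where D: "\<And>i. i \<in> {1..m} \<Longrightarrow> TC (RP (n i)) = enat (D i)"
      by metis
    define good where "good = (\<lambda>i (V, g, \<tau>). (\<forall>j\<le>N. openin (RP2 (n i)) (V j) \<and> motion_planner (RP (n i)) (V j) (g j) \<and>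
           (b i, b i) \<in> V j \<and> (\<forall>t. g j (b i, b i) t = b i)) \<and>
         (\<forall>z\<in>topspace (RP2 (n i)). card {j. j \<le> N \<and> z \<notin> V j} \<le> D i) \<and>
         (\<forall>p\<in>topspace (RP (n i)). card {j. j \<le> N \<and> (p, b i) \<notin> V j} \<le> n i \<and> card {j. j \<le> N \<and> (b i, p) \<notin> V j} \<le> n i) \<and>
         continuous_map (RP (n i)) euclideanreal \<tau> \<and>
         (\<forall>p\<in>topspace (RP (n i)). 0 \<le> \<tau> p \<and> \<tau> p \<le> 1/2 \<and> (\<tau> p = 0 \<longleftrightarrow> p = b i)))"
    have "\<exists>y. good i y" if i: "i \<in> {1..m}" for i
    proof -
      obtain \<beta> where \<beta>: "b i = cls \<beta>" "\<beta> \<in> sph (n i)"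
        using assms(2)[OF i] unfolding topspace_RP by (rule imageE)
      obtain U h where U: "\<And>j. j \<le> D i \<Longrightarrow> openin (RP2 (n i)) (U j)"
        "\<And>j. j \<le> D i \<Longrightarrow> motion_planner (RP (n i)) (U j) (h j)" "topspace (RP2 (n i)) \<subseteq> (\<Union>j\<le>D i. U j)"
        using planners_of_TC_eq_enat[OF D[OF i]] by blast
      have "\<exists>U h. pointed_cover (n i) (cls \<beta>) (D i) U h"
        by (rule pointed_cover_exists[OF assms(1)[OF i] U \<beta>(2)])
      then obtain U h where "pointed_cover (n i) (b i) (D i) U h"
        unfolding \<beta>(1) by blast
      note family = planner_family[OF this assms(2)[OF i], of N]
      obtain V g where V: "(\<forall>j\<le>N. openin (RP2 (n i)) (V j) \<and> motion_planner (RP (n i)) (V j) (g j) \<and>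
           (b i, b i) \<in> V j \<and> (\<forall>t. g j (b i, b i) t = b i)) \<and>
         (\<forall>z\<in>topspace (RP2 (n i)). card {j. j \<le> N \<and> z \<notin> V j} \<le> D i) \<and>
         (\<forall>p\<in>topspace (RP (n i)). card {j. j \<le> N \<and> (p, b i) \<notin> V j} \<le> n i \<and> card {j. j \<le> N \<and> (b i, p) \<notin> V j} \<le> n i)"
        using family by (elim exE) (rule that)
      obtain \<tau> where \<tau>: "continuous_map (RP (n i)) euclideanreal \<tau> \<and>
         (\<forall>p\<in>topspace (RP (n i)). 0 \<le> \<tau> p \<and> \<tau> p \<le> 1/2 \<and> (\<tau> p = 0 \<longleftrightarrow> p = b i))"
      proof -
        have "\<exists>\<tau>. continuous_map (RP (n i)) euclideanreal \<tau> \<and>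
         (\<forall>p\<in>topspace (RP (n i)). 0 \<le> \<tau> p \<and> \<tau> p \<le> 1/2 \<and> (\<tau> p = (0::real) \<longleftrightarrow> p = b i))"
          unfolding \<beta>(1) by (rule base_distance[OF \<beta>(2)])
        then show ?thesis by (elim exE) (rule that)
      qed
      have "good i (V, g, \<tau>)"
        unfolding good_def prod.case using V \<tau> by (intro conjI) (elim conjE, assumption)+
      then show ?thesis by (rule exI)
    qed
    then have good: "good i (SOME y. good i y)" if "i \<in> {1..m}" for i
      using that by (blast intro: someI_ex)
    define V where "V = (\<lambda>i. fst (SOME y. good i y))"
    define g where "g = (\<lambda>i. fst (snd (SOME y. good i y)))"
    define \<tau> where "\<tau> = (\<lambda>i. snd (snd (SOME y. good i y)))"
    have good: "good i (V i, g i, \<tau> i)" if "i \<in> {1..m}" for i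
      using good[OF that] by (simp add: V_def g_def \<tau>_def)
    have bound: "(\<Sum>i\<in>(\<sigma>1 - \<sigma>2) \<union> (\<sigma>2 - \<sigma>1). n i) + (\<Sum>i\<in>\<sigma>1 \<inter> \<sigma>2. D i) \<le> N"
      if \<sigma>: "\<sigma>1 \<in> K" "\<sigma>2 \<in> K" for \<sigma>1 \<sigma>2
    proof -
      have sub: "\<sigma>1 \<subseteq> {1..m}" "\<sigma>2 \<subseteq> {1..m}"
        using \<sigma> K_sub by blast+
      then have fin: "finite \<sigma>1" "finite \<sigma>2"
        by (meson finite_atLeastAtMost finite_subset)+
      have "(\<Sum>i\<in>\<sigma>1 \<inter> \<sigma>2. TC (RP (n i))) = (\<Sum>i\<in>\<sigma>1 \<inter> \<sigma>2. enat (D i))"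
        using sub D by (intro sum.cong refl) blast
      then have "c \<sigma>1 \<sigma>2 = enat ((\<Sum>i\<in>(\<sigma>1 - \<sigma>2) \<union> (\<sigma>2 - \<sigma>1). n i) + (\<Sum>i\<in>\<sigma>1 \<inter> \<sigma>2. D i))"
        unfolding c_def using fin by (simp only: sum_enat finite_Un finite_Diff finite_Int plus_enat_simps simp_thms)
      then show ?thesis
        using c_le[OF \<sigma>] enat by simp
    qed
    have good_facts:
      "\<And>i j. i \<in> {1..m} \<Longrightarrow> j \<le> N \<Longrightarrow> openin (RP2 (n i)) (V i j)"
      "\<And>i j. i \<in> {1..m} \<Longrightarrow> j \<le> N \<Longrightarrow> motion_planner (RP (n i)) (V i j) (g i j)"
      "\<And>i j. i \<in> {1..m} \<Longrightarrow> j \<le> N \<Longrightarrow> (b i, b i) \<in> V i j"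
      "\<And>i j t. i \<in> {1..m} \<Longrightarrow> j \<le> N \<Longrightarrow> g i j (b i, b i) t = b i"
      "\<And>i z. i \<in> {1..m} \<Longrightarrow> z \<in> topspace (RP2 (n i)) \<Longrightarrow> card {j. j \<le> N \<and> z \<notin> V i j} \<le> D i"
      "\<And>i p. i \<in> {1..m} \<Longrightarrow> p \<in> topspace (RP (n i)) \<Longrightarrow> card {j. j \<le> N \<and> (p, b i) \<notin> V i j} \<le> n i"
      "\<And>i p. i \<in> {1..m} \<Longrightarrow> p \<in> topspace (RP (n i)) \<Longrightarrow> card {j. j \<le> N \<and> (b i, p) \<notin> V i j} \<le> n i"
      "\<And>i. i \<in> {1..m} \<Longrightarrow> continuous_map (RP (n i)) euclideanreal (\<tau> i)"
      "\<And>i x. i \<in> {1..m} \<Longrightarrow> x \<in> topspace (RP (n i)) \<Longrightarrow>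
        0 \<le> \<tau> i x \<and> \<tau> i x \<le> 1/2 \<and> (\<tau> i x = 0 \<longleftrightarrow> x = b i)"
      using good[unfolded good_def prod.case] by blast+
    have "TC (polyhedral_product {1..m} (\<lambda>i. RP (n i)) b K) \<le> enat N"
      by (rule TC_polyhedral_product_le[where D = D and d = n and V = V and g = g and \<tau> = \<tau>])
        (assumption | rule finite_atLeastAtMost assms(3) good_facts bound)+
    then show ?thesis
      using enat by simp
  qed
  then show ?thesis
    unfolding c_def .
qed

end
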